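(* Let $T\in(0,\infty)$, let $\nu$ satisfy (H0) and let the spatial Feller semigroup $e^{\mathcal L}$ on $C_\infty(\Omega)$ satisfy (H1) (both conditions are stated in the context). Let $g\in L^\infty((0,T)\times\Omega)$ and $\phi_0\in \operatorname{Dom}(\mathcal L^\nu)$. Then there exists a unique generalised solution $u$ to the problem $$\mathcal H^\nu_0 u=-g\ \text{ in }(0,T]\times\Omega,\qquad u(0,\cdot)=\phi_0\ \text{ in }\Omega .$$ Moreover, the generalised solution has the stochastic representation, for $(t,x)\in(0,T]\times\Omega$, $$u(t,x)=\mathbf E\left[\phi_0\left(B^x_{S^\nu_{\tau_0(t)}}\right)\mathbf 1_{\{\tau_0(t)<\tau_0(\tau_\Omega(x))\}}\right]+\mathbf E\left[\int_0^{\tau_0(t)\wedge\tau_0(\tau_\Omega(x))}g\left(t-S^\nu_r,B^x_{S^\nu_r}\right)dr\right].$$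
   Context: **Function spaces.** For $E\subset\mathbb R^d$, $C_\infty(E)$ is the Banach space (sup norm) of continuous real functions on the one-point compactification $E\cup\{\partial\}$ that vanish at $\partial$ (continuous functions on $E$ vanishing at infinity). $C_{\partial\Omega}([0,T]\times\Omega):=C_\infty([0,T]\times\Omega)$. A Feller semigroup is a strongly continuous contraction semigroup on such a space preserving non-negative functions; its generator and domain are the usual ones. **Spatial process.** $\Omega\subset\mathbb R^d$ is either bounded open, the closure of an open set, or compact. $(\mathcal L,\operatorname{Dom}(\mathcal L))$ generates a Feller semigroup $\{e^{r\mathcal L}\}_{r\ge0}$ on $C_\infty(\Omega)$, with associated càdlàg Feller process $B^x$ started at $x\in\Omega$, so $e^{r\mathcal L}v(x)=\mathbf E[v(B^x_r)]$. $\tau_\Omega(x)=\inf\{s>0:B^x_s\notin\Omega\}$ is its life time, after which $B^x$ stays in the cemetery $\partial$; functions are set to $0$ at the cemetery. **(H1).** For each $r>0$ and $x\in\Omega$, $e^{r\mathcal L}$ has a density $y\mapsto p^\Omega_r(x,y)$ with respect to Lebesgue measure on $\Omega$. **(H0).** $\nu:(0,\infty)\to[0,\infty)$ is continuous with $\int_0^\infty(r\wedge1)\nu(r)\,dr<\infty$ and $\int_0^\infty\nu(r)\,dr=\infty$. **Subordinator.** $S^\nu$ is the Lévy subordinator, independent of $B$, with $\log\mathbf E[e^{-kS^\nu_r}]=r\int_0^\infty(e^{-ks}-1)\nu(s)\,ds$ for $r,k>0$; $p^\nu_r$ is the Lebesgue density of $S^\nu_r$, $r>0$ (it exists under (H0)).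 $\tau_0(t)=\inf\{r>0:S^\nu_r>t\}$ for $t>0$, and $\tau_0(\infty)=\infty$. **Generators.** $(\mathcal L^\nu,\operatorname{Dom}(\mathcal L^\nu))$ is the generator of the Feller semigroup $e^{r\mathcal L^\nu}=\int_0^\infty e^{s\mathcal L}(\cdot)\,p^\nu_r(s)\,ds$ ($r>0$) on $C_\infty(\Omega)$. $(\mathcal H^\nu_0,\operatorname{Dom}(\mathcal H^\nu_0))$ is the generator of the Feller semigroup on $C_{\partial\Omega}([0,T]\times\Omega)$ given for $r>0$ by $$e^{r\mathcal H^\nu_0}u(t,x)=\int_0^t \big(e^{s\mathcal L}u(t-s,\cdot)\big)(x)\,p^\nu_r(s)\,ds+\int_t^\infty \big(e^{s\mathcal L}u(0,\cdot)\big)(x)\,p^\nu_r(s)\,ds,$$ and by the identity for $r=0$. **Solution in the domain of the generator.** For $g\in C_{\partial\Omega}([0,T]\times\Omega)$, this is a function $u\in\operatorname{Dom}(\mathcal H^\nu_0)$ with $\mathcal H^\nu_0u=-g$ on $(0,T]\times\Omega$ and $u(0)=\phi_0$. **Bpw a.e. convergence.** $g_n\to g$ bpw a.e. means $g_n\to g$ almost everywhere and $\sup_n\|g_n\|_\infty<\infty$. **Generalised solution.** For $g\in L^\infty((0,T)\times\Omega)$ and $\phi_0\in\operatorname{Dom}(\mathcal L^\nu)$, $u$ is a generalised solution if $u=\lim_{n\to\infty}u_n$ pointwise, where $\{u_n\}_{n\ge1}$ are the solutions in the domain of the generator (with initial value $\phi_0$) for some forcing terms $\{g_n\}_{n\ge1}\subset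 C_{\partial\Omega}([0,T]\times\Omega)$ such that $g_n(0,\cdot)=-\mathcal L^\nu\phi_0$ for all $n$ and $g_n\to g$ bpw a.e. *)

theory Defs
  imports "HOL-Probability.Probability"
begin

section \<open>Functions vanishing at infinity\<close>

text \<open>
  Functions on \<open>E\<close> are represented by functions on the whole type; the cemetery is \<open>None\<close>.
\<close>

definition at_cemetery_zero :: "('a \<Rightarrow> real) \<Rightarrow> 'a option \<Rightarrow> real" where
  "at_cemetery_zero f z = (case z of None \<Rightarrow> 0 | Some x \<Rightarrow> f x)"

text \<open>
  Being zero outside \<open>E\<close> is only a normalisation: it makes the representation of a function
  on \<open>E\<close> unique.
\<close>

definition C_infty :: "'a::topological_space set \<Rightarrow> ('a \<Rightarrow> real) set" where
  "C_infty E = {f.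
     continuous_map (Alexandroff_compactification (top_of_set E)) euclideanreal
       (at_cemetery_zero f) \<and> (\<forall>x. x \<notin> E \<longrightarrow> f x = 0)}"

definition sup_norm :: "'a set \<Rightarrow> ('a \<Rightarrow> real) \<Rightarrow> real" where
  "sup_norm E f = (SUP x\<in>E. \<bar>f x\<bar>)"

section \<open>Feller semigroups and generators\<close>

text \<open>
  Only times \<open>r \<ge> 0\<close> and functions in \<open>C_infty E\<close> matter. Uniform convergence on \<open>E\<close> is
  convergence in the sup norm.
\<close>

definition feller_semigroup ::
    "'a::topological_space set \<Rightarrow> (real \<Rightarrow> ('a \<Rightarrow> real) \<Rightarrow> 'a \<Rightarrow> real) \<Rightarrow> bool" where
  "feller_semigroup E P \<longleftrightarrow>
     (\<forall>r\<ge>0. \<forall>f\<in>C_infty E. P r f \<in> C_infty E) \<and>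
     (\<forall>r\<ge>0. \<forall>f\<in>C_infty E. \<forall>h\<in>C_infty E. \<forall>a b.
        P r (\<lambda>x. a * f x + b * h x) = (\<lambda>x. a * P r f x + b * P r h x)) \<and>
     (\<forall>f\<in>C_infty E. P 0 f = f) \<and>
     (\<forall>r\<ge>0. \<forall>s\<ge>0. \<forall>f\<in>C_infty E. P (r + s) f = P r (P s f)) \<and>
     (\<forall>r\<ge>0. \<forall>f\<in>C_infty E. sup_norm E (P r f) \<le> sup_norm E f) \<and>
     (\<forall>r\<ge>0. \<forall>f\<in>C_infty E. (\<forall>x\<in>E. 0 \<le> f x) \<longrightarrow> (\<forall>x\<in>E. 0 \<le> P r f x)) \<and>
     (\<forall>f\<in>C_infty E. uniform_limit E (\<lambda>r. P r f) f (at_right 0))"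

definition generator_rel ::
    "'a::topological_space set \<Rightarrow> (real \<Rightarrow> ('a \<Rightarrow> real) \<Rightarrow> 'a \<Rightarrow> real) \<Rightarrow>
     ('a \<Rightarrow> real) \<Rightarrow> ('a \<Rightarrow> real) \<Rightarrow> bool" where
  "generator_rel E P f h \<longleftrightarrow> f \<in> C_infty E \<and> h \<in> C_infty E \<and>
     uniform_limit E (\<lambda>r x. (P r f x - f x) / r) h (at_right 0)"

definition generator_dom ::
    "'a::topological_space set \<Rightarrow> (real \<Rightarrow> ('a \<Rightarrow> real) \<Rightarrow> 'a \<Rightarrow> real) \<Rightarrow> ('a \<Rightarrow> real) set" where
  "generator_dom E P = {f. \<exists>h. generator_rel E P f h}"

definition generator ::
    "'a::topological_space set \<Rightarrow> (real \<Rightarrow> ('a \<Rightarrow> real) \<Rightarrow> 'a \<Rightarrow> real) \<Rightarrow>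
     ('a \<Rightarrow> real) \<Rightarrow> 'a \<Rightarrow> real" where
  "generator E P f = (THE h. generator_rel E P f h)"

section \<open>Assumptions on the data\<close>

definition admissible_domain :: "'a::euclidean_space set \<Rightarrow> bool" where
  "admissible_domain \<Omega> \<longleftrightarrow>
     (bounded \<Omega> \<and> open \<Omega>) \<or> (\<exists>U. open U \<and> \<Omega> = closure U) \<or> compact \<Omega>"

definition H0 :: "(real \<Rightarrow> real) \<Rightarrow> bool" where
  "H0 \<nu> \<longleftrightarrow> continuous_on {0<..} \<nu> \<and> (\<forall>r>0. 0 \<le> \<nu> r) \<and>
     (\<integral>\<^sup>+ r. ennreal (min r 1 * \<nu> r) * indicator {0<..} r \<partial>lborel) < \<infinity> \<and>
     (\<integral>\<^sup>+ r. ennreal (\<nu> r) * indicator {0<..} r \<partial>lborel) = \<infinity>"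

definition H1 ::
    "'a::euclidean_space set \<Rightarrow> (real \<Rightarrow> ('a \<Rightarrow> real) \<Rightarrow> 'a \<Rightarrow> real) \<Rightarrow> bool" where
  "H1 \<Omega> P \<longleftrightarrow> (\<forall>r>0. \<forall>x\<in>\<Omega>. \<exists>p.
     (\<forall>y\<in>\<Omega>. 0 \<le> p y) \<and> set_integrable lborel \<Omega> p \<and>
     (\<forall>v\<in>C_infty \<Omega>. P r v x = (LINT y:\<Omega>|lborel. v y * p y)))"

section \<open>Processes\<close>

definition borel_sigma_of :: "'a topology \<Rightarrow> 'a measure" where
  "borel_sigma_of X = sigma (topspace X) {U. openin X U}"

text \<open>The \<open>\<sigma>\<close>-algebra on the sample space generated by \<open>X i\<close>, \<open>i \<in> I\<close>.\<close>

definition sigma_of_process ::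
    "'w measure \<Rightarrow> 'b measure \<Rightarrow> ('i \<Rightarrow> 'w \<Rightarrow> 'b) \<Rightarrow> 'i set \<Rightarrow> 'w measure" where
  "sigma_of_process M N X I =
     sigma (space M) {X i -` A \<inter> space M | i A. i \<in> I \<and> A \<in> sets N}"

abbreviation compactified :: "'a::topological_space set \<Rightarrow> 'a option topology" where
  "compactified \<Omega> \<equiv> Alexandroff_compactification (top_of_set \<Omega>)"

text \<open>
  The process starts at \<open>x\<close> and is Markov with respect to its own filtration, with transition
  semigroup \<open>P\<close>; in particular \<open>P r v x\<close> is the expectation of \<open>v\<close> at time \<open>r\<close>. Path properties
  are required of every path, so that expectations of path functionals are meaningful without
  completing \<open>M\<close>.
\<close>

definition feller_process ::
    "'w measure \<Rightarrow> 'a::euclidean_space set \<Rightarrow> (real \<Rightarrow> ('a \<Rightarrow> real) \<Rightarrow> 'a \<Rightarrow> real) \<Rightarrow>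
     'a \<Rightarrow> (real \<Rightarrow> 'w \<Rightarrow> 'a option) \<Rightarrow> bool" where
  "feller_process M \<Omega> P x B \<longleftrightarrow>
     (\<forall>r\<ge>0. B r \<in> measurable M (borel_sigma_of (compactified \<Omega>))) \<and>
     (\<forall>\<omega>\<in>space M. B 0 \<omega> = Some x) \<and>
     (\<forall>\<omega>\<in>space M. \<forall>r\<ge>0. limitin (compactified \<Omega>) (\<lambda>s. B s \<omega>) (B r \<omega>) (at_right r)) \<and>
     (\<forall>\<omega>\<in>space M. \<forall>r>0. \<exists>l. limitin (compactified \<Omega>) (\<lambda>s. B s \<omega>) l (at_left r)) \<and>
     (\<forall>\<omega>\<in>space M. \<forall>r\<ge>0. \<forall>s\<ge>r. B r \<omega> = None \<longrightarrow> B s \<omega> = None) \<and>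
     (\<forall>s\<ge>0. \<forall>r\<ge>0. \<forall>v\<in>C_infty \<Omega>. AE \<omega> in M.
        real_cond_exp M (sigma_of_process M (borel_sigma_of (compactified \<Omega>)) B {0..s})
          (\<lambda>\<omega>. at_cemetery_zero v (B (s + r) \<omega>)) \<omega>
        = at_cemetery_zero (P r v) (B s \<omega>))"

definition levy_subordinator ::
    "'w measure \<Rightarrow> (real \<Rightarrow> real) \<Rightarrow> (real \<Rightarrow> 'w \<Rightarrow> real) \<Rightarrow> bool" where
  "levy_subordinator M \<nu> S \<longleftrightarrow>
     (\<forall>r\<ge>0. S r \<in> borel_measurable M) \<and>
     (\<forall>\<omega>\<in>space M. S 0 \<omega> = 0) \<and>
     (\<forall>\<omega>\<in>space M. \<forall>r\<ge>0. \<forall>s\<ge>r. S r \<omega> \<le> S s \<omega>) \<and>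
     (\<forall>\<omega>\<in>space M. \<forall>r\<ge>0. ((\<lambda>s. S s \<omega>) \<longlongrightarrow> S r \<omega>) (at_right r)) \<and>
     (\<forall>r\<ge>0. \<forall>s\<ge>r. distr M borel (\<lambda>\<omega>. S s \<omega> - S r \<omega>) = distr M borel (S (s - r))) \<and>
     (\<forall>r\<ge>0. \<forall>s\<ge>r. prob_space.indep_set M
        (sets (sigma_of_process M borel S {0..r}))
        (sets (sigma_of_process M borel (\<lambda>_ \<omega>. S s \<omega> - S r \<omega>) (UNIV :: unit set)))) \<and>
     (\<forall>r>0. \<forall>k>0. ln (LINT \<omega>|M. exp (- k * S r \<omega>)) =
        r * (LINT s:{0<..}|lborel. (exp (- k * s) - 1) * \<nu> s))"

definition independent_processes ::
    "'w measure \<Rightarrow> 'b measure \<Rightarrow> (real \<Rightarrow> 'w \<Rightarrow> 'b) \<Rightarrow> 'c measure \<Rightarrow> (real \<Rightarrow> 'w \<Rightarrow> 'c) \<Rightarrow> bool" where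
  "independent_processes M N X N' Y \<longleftrightarrow>
     prob_space.indep_set M (sets (sigma_of_process M N X {0..})) (sets (sigma_of_process M N' Y {0..}))"

text \<open>The infimum of the empty set is \<open>\<infinity>\<close>; in particular the value at \<open>t = \<infinity>\<close> is \<open>\<infinity>\<close>.\<close>

definition passage_time :: "(real \<Rightarrow> 'w \<Rightarrow> real) \<Rightarrow> ereal \<Rightarrow> 'w \<Rightarrow> ereal" where
  "passage_time S t \<omega> = Inf (ereal ` {r. 0 < r \<and> t < ereal (S r \<omega>)})"

definition life_time :: "'a set \<Rightarrow> (real \<Rightarrow> 'w \<Rightarrow> 'a option) \<Rightarrow> 'w \<Rightarrow> ereal" where
  "life_time \<Omega> B \<omega> = Inf (ereal ` {s. 0 < s \<and> B s \<omega> \<notin> Some ` \<Omega>})"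

definition subordinator_density :: "'w measure \<Rightarrow> (real \<Rightarrow> 'w \<Rightarrow> real) \<Rightarrow> real \<Rightarrow> real \<Rightarrow> real" where
  "subordinator_density M S r s = enn2real (RN_deriv lborel (distr M borel (S r)) s)"

section \<open>The subordinated semigroups\<close>

text \<open>In both definitions \<open>p r\<close> is the density of the subordinator at time \<open>r\<close>.\<close>

definition space_semigroup ::
    "(real \<Rightarrow> ('a \<Rightarrow> real) \<Rightarrow> 'a \<Rightarrow> real) \<Rightarrow> (real \<Rightarrow> real \<Rightarrow> real) \<Rightarrow>
     real \<Rightarrow> ('a \<Rightarrow> real) \<Rightarrow> 'a \<Rightarrow> real" where
  "space_semigroup P p r v x =
     (if r = 0 then v x else (LBINT s=0..\<infinity>. P s v x * p r s))"

definition time_space_semigroup ::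
    "real \<Rightarrow> (real \<Rightarrow> ('a \<Rightarrow> real) \<Rightarrow> 'a \<Rightarrow> real) \<Rightarrow> (real \<Rightarrow> real \<Rightarrow> real) \<Rightarrow>
     real \<Rightarrow> (real \<times> 'a \<Rightarrow> real) \<Rightarrow> real \<times> 'a \<Rightarrow> real" where
  "time_space_semigroup T P p r u = (\<lambda>(t, x).
     if r = 0 then u (t, x)
     else if t \<in> {0..T} then
       (LBINT s=0..ereal t. P s (\<lambda>y. u (t - s, y)) x * p r s) +
       (LBINT s=ereal t..\<infinity>. P s (\<lambda>y. u (0, y)) x * p r s)
     else 0)"

section \<open>Solutions\<close>

definition domain_solution ::
    "real \<Rightarrow> 'a::euclidean_space set \<Rightarrow> (real \<Rightarrow> ('a \<Rightarrow> real) \<Rightarrow> 'a \<Rightarrow> real) \<Rightarrow>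
     (real \<Rightarrow> real \<Rightarrow> real) \<Rightarrow> (real \<times> 'a \<Rightarrow> real) \<Rightarrow> ('a \<Rightarrow> real) \<Rightarrow> (real \<times> 'a \<Rightarrow> real) \<Rightarrow> bool" where
  "domain_solution T \<Omega> P p g \<phi>\<^sub>0 u \<longleftrightarrow>
     u \<in> generator_dom ({0..T} \<times> \<Omega>) (time_space_semigroup T P p) \<and>
     (\<forall>z\<in>{0<..T} \<times> \<Omega>. generator ({0..T} \<times> \<Omega>) (time_space_semigroup T P p) u z = - g z) \<and>
     (\<forall>x\<in>\<Omega>. u (0, x) = \<phi>\<^sub>0 x)"

definition L_infty :: "'a::euclidean_space set \<Rightarrow> ('a \<Rightarrow> real) \<Rightarrow> bool" where
  "L_infty A g \<longleftrightarrow> g \<in> borel_measurable borel \<and>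
     (\<exists>C. AE z in lborel. z \<in> A \<longrightarrow> \<bar>g z\<bar> \<le> C)"

text \<open>
  The approximating solutions vanish outside \<open>[0,T] \<times> \<Omega>\<close> by the normalisation in \<open>C_infty\<close>, so
  pointwise convergence at all points is convergence on \<open>[0,T] \<times> \<Omega>\<close> together with the same
  normalisation of \<open>u\<close>.
\<close>

definition generalised_solution ::
    "real \<Rightarrow> 'a::euclidean_space set \<Rightarrow> (real \<Rightarrow> ('a \<Rightarrow> real) \<Rightarrow> 'a \<Rightarrow> real) \<Rightarrow>
     (real \<Rightarrow> real \<Rightarrow> real) \<Rightarrow> (real \<times> 'a \<Rightarrow> real) \<Rightarrow> ('a \<Rightarrow> real) \<Rightarrow> (real \<times> 'a \<Rightarrow> real) \<Rightarrow> bool" where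
  "generalised_solution T \<Omega> P p g \<phi>\<^sub>0 u \<longleftrightarrow> (\<exists>gs us.
     (\<forall>n::nat. gs n \<in> C_infty ({0..T} \<times> \<Omega>)) \<and>
     (\<forall>n. \<forall>x\<in>\<Omega>. gs n (0, x) = - generator \<Omega> (space_semigroup P p) \<phi>\<^sub>0 x) \<and>
     (AE z in lborel. z \<in> {0<..<T} \<times> \<Omega> \<longrightarrow> (\<lambda>n. gs n z) \<longlonglongrightarrow> g z) \<and>
     (\<exists>C. \<forall>n. sup_norm ({0..T} \<times> \<Omega>) (gs n) \<le> C) \<and>
     (\<forall>n. domain_solution T \<Omega> P p (gs n) \<phi>\<^sub>0 (us n)) \<and>
     (\<forall>z. (\<lambda>n. us n z) \<longlonglongrightarrow> u z))"

text \<open>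
  The integrand \<open>g\<close> is set to zero at the cemetery. \<open>real_of_ereal\<close> is harmless, since the
  passage time over a finite level is almost surely finite.
\<close>

definition stochastic_representation ::
    "'w measure \<Rightarrow> 'a set \<Rightarrow> (real \<Rightarrow> 'w \<Rightarrow> 'a option) \<Rightarrow> (real \<Rightarrow> 'w \<Rightarrow> real) \<Rightarrow>
     (real \<times> 'a \<Rightarrow> real) \<Rightarrow> ('a \<Rightarrow> real) \<Rightarrow> real \<Rightarrow> real" where
  "stochastic_representation M \<Omega> B S g \<phi>\<^sub>0 t =
     (LINT \<omega>|M. at_cemetery_zero \<phi>\<^sub>0 (B (S (real_of_ereal (passage_time S (ereal t) \<omega>)) \<omega>) \<omega>) *
        indicator {\<omega>. passage_time S (ereal t) \<omega> < passage_time S (life_time \<Omega> B \<omega>) \<omega>} \<omega>) +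
     (LINT \<omega>|M. LBINT r=0..min (passage_time S (ereal t) \<omega>) (passage_time S (life_time \<Omega> B \<omega>) \<omega>).
        at_cemetery_zero (\<lambda>y. g (t - S r \<omega>, y)) (B (S r \<omega>) \<omega>))"

end

theory Submission
  imports Defs
begin

text \<open>
  With \<open>K s u (t, x) = P s (\<lambda>y. u (max 0 (t - s), y)) x\<close>, the two semigroups of the statement are the
  subordinations \<open>E (K (S r))\<close> and \<open>E (P (S r))\<close>. If \<open>u\<close> is in the domain of the generator, Dynkin's
  formula for the function \<open>\<lambda>s. K s u (t, x)\<close> of the subordinator, up to its first passage over \<open>t\<close>,
  expresses \<open>u (t, x)\<close> through \<open>u (0, \<cdot>)\<close> and the forcing term; this gives uniqueness, and the stochastic
  representation once \<open>B\<close> is averaged out by independence. Conversely the constant extension of \<open>\<phi>\<^sub>0\<close>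
  plus the potential of a forcing term vanishing at time \<open>0\<close>, which \<open>K\<close> kills after time \<open>T\<close>, is a
  solution. The representation survives bounded almost everywhere limits because \<open>(t - S r, B (S r))\<close>
  has an absolutely continuous law for \<open>r > 0\<close>: \<open>B s\<close> has a density by (H1), and the law \<open>\<mu>\<close> of
  \<open>S r\<close> has one since \<open>s \<mu>(ds)\<close> is the convolution of \<open>r s \<nu>(s) ds\<close> with \<open>\<mu>\<close>.
\<close>

section \<open>Functions vanishing at infinity\<close>

text \<open>Time runs backwards and is absorbed at 0, where the time-space semigroup acts as the
  subordinate spatial one. Generators take values in \<open>C_infty\<close>, so the equation imposed
  for t > 0 extends to t = 0 by continuity and forces the forcing term to equal minus the spatial
  generator of the initial value there. This is the origin of the condition on g_n(0, .). It also
  explains the constant extension: once it is split off, the remaining forcing term is 0 on the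
  absorbing boundary, and cutting its potential off at S r \<le> T loses nothing. Dynkin's formula
  comes from one integral of difference quotients evaluated in two orders. With the expectation
  inside, an increment of S independent of S r produces the generator; with the time integral
  inside, the quotients telescope along each path and right continuity gives the values at both
  ends. The region {S r \<le> t} depends on S r alone, so each increment is taken after a fixed
  time. A domain solution is thus an explicit functional of its forcing term, stable under bounded
  a.e. limits, and all approximating sequences share one limit at every point.\<close>

lemma C_infty_iff:
  fixes f :: "'a::metric_space \<Rightarrow> real"
  shows "f \<in> C_infty E \<longleftrightarrow> (\<forall>x. x \<notin> E \<longrightarrow> f x = 0) \<and> continuous_on E f \<and>
           (\<forall>e>0. compact {x\<in>E. e \<le> \<bar>f x\<bar>})"
    (is "?L \<longleftrightarrow> ?R")
proof
  assume L: ?L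
  let ?X = "Alexandroff_compactification (top_of_set E)"
  have cm: "continuous_map ?X euclideanreal (at_cemetery_zero f)"
    and off: "\<forall>x. x \<notin> E \<longrightarrow> f x = 0"
    using L by (auto simp: C_infty_def)
  have "continuous_map (top_of_set E) euclideanreal (at_cemetery_zero f \<circ> Some)"
    by (rule continuous_map_compose[OF continuous_map_Some cm])
  moreover have "at_cemetery_zero f \<circ> Some = f"
    by (auto simp: at_cemetery_zero_def)
  ultimately have "continuous_on E f" by simp
  moreover have "compact {x\<in>E. e \<le> \<bar>f x\<bar>}" if "e > 0" for e
  proof -
    have "closedin ?X {z\<in>topspace ?X. at_cemetery_zero f z \<in> {y. e \<le> \<bar>y\<bar>}}"
      by (rule closedin_continuous_map_preimage[OF cm])
         (auto intro!: closed_Collect_le continuous_intros)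
    moreover have "{z\<in>topspace ?X. at_cemetery_zero f z \<in> {y. e \<le> \<bar>y\<bar>}} = Some ` {x\<in>E. e \<le> \<bar>f x\<bar>}"
      using that by (auto simp: at_cemetery_zero_def image_iff)
    ultimately show ?thesis
      by (simp add: compactin_subtopology)
  qed
  ultimately show ?R using off by blast
next
  assume R: ?R
  let ?X = "Alexandroff_compactification (top_of_set E)"
  \<comment> \<open>The preimage contains the cemetery exactly when 0 \<in> C. If it does, its
    complement has to come from an open subset of E; if not, C keeps a distance e from 0 and the
    preimage is a closed part of a compact level set.\<close>
  have "closedin ?X {z\<in>topspace ?X. at_cemetery_zero f z \<in> C}" if C: "closed C" for C
  proof (cases "0 \<in> C")
    case True
    have "openin (top_of_set E) (E \<inter> f -` (- C))"
      using R C by (intro continuous_openin_preimage_gen) (auto simp: open_Compl)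
    moreover have "{z\<in>topspace ?X. at_cemetery_zero f z \<in> C} = topspace ?X - Some ` (E \<inter> f -` (- C))"
      using True by (auto simp: at_cemetery_zero_def)
    ultimately show ?thesis
      by (auto simp: closedin_Alexandroff_compactification)
  next
    case False
    then obtain e where e: "e > 0" "\<And>y. y \<in> C \<Longrightarrow> e \<le> \<bar>y\<bar>"
      using C open_Compl[of C] unfolding open_dist
      by (metis ComplD ComplI diff_zero dist_real_def not_less)
    have cl: "closedin (top_of_set E) {x\<in>E. f x \<in> C}"
      using continuous_closedin_preimage[of E f C] R C by (simp add: vimage_def Int_def)
    have "{x\<in>E. f x \<in> C} \<subseteq> {x\<in>E. e \<le> \<bar>f x\<bar>}" using e by auto
    moreover have "compact {x\<in>E. e \<le> \<bar>f x\<bar>}" using R e by blast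
    moreover have "closedin (top_of_set {x\<in>E. e \<le> \<bar>f x\<bar>}) {x\<in>E. f x \<in> C}"
      by (rule closedin_subset_trans[OF cl]) (use e in auto)
    ultimately have "compact {x\<in>E. f x \<in> C}"
      using closedin_compact by blast
    then have "closedin ?X (Some ` {x\<in>E. f x \<in> C})"
      using cl by (auto simp: compactin_subtopology)
    moreover have "{z\<in>topspace ?X. at_cemetery_zero f z \<in> C} = Some ` {x\<in>E. f x \<in> C}"
      using False by (auto simp: at_cemetery_zero_def image_iff)
    ultimately show ?thesis by simp
  qed
  then have "continuous_map ?X euclideanreal (at_cemetery_zero f)"
    by (auto simp: continuous_map_closedin)
  with R show ?L by (auto simp: C_infty_def)
qed

lemma C_infty_off: "f \<in> C_infty E \<Longrightarrow> x \<notin> E \<Longrightarrow> f x = 0"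
  by (simp add: C_infty_def)

lemma C_infty_continuous_on:
  fixes f :: "'a::metric_space \<Rightarrow> real"
  shows "f \<in> C_infty E \<Longrightarrow> continuous_on E f"
  by (simp add: C_infty_iff)

text \<open>Any compact set outside which f is small will do; the exact level set is then closed
  inside it and hence compact. This is the working introduction rule for concrete members of
  \<open>C_infty\<close>.\<close>

lemma C_infty_compact_exhaustion:
  fixes f :: "'a::metric_space \<Rightarrow> real"
  assumes off: "\<And>x. x \<notin> E \<Longrightarrow> f x = 0" and cont: "continuous_on E f"
    and K: "\<And>e. e > 0 \<Longrightarrow> \<exists>K. compact K \<and> K \<subseteq> E \<and> (\<forall>x\<in>E - K. \<bar>f x\<bar> < e)"
  shows "f \<in> C_infty E"
proof -
  have "compact {x\<in>E. e \<le> \<bar>f x\<bar>}" if e: "e > 0" for e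
  proof -
    obtain K where K: "compact K" "K \<subseteq> E" "\<forall>x\<in>E - K. \<bar>f x\<bar> < e" using K[OF e] by blast
    have "continuous_on K f" using cont K continuous_on_subset by blast
    then have "closedin (top_of_set K) (K \<inter> f -` {y. e \<le> \<bar>y\<bar>})"
      by (intro continuous_closedin_preimage) (auto intro!: closed_Collect_le continuous_intros)
    moreover have "K \<inter> f -` {y. e \<le> \<bar>y\<bar>} = {x\<in>E. e \<le> \<bar>f x\<bar>}"
      using K by (auto simp: not_le[symmetric])
    ultimately show ?thesis using closedin_compact[OF K(1)] by simp
  qed
  with off cont show ?thesis by (auto simp: C_infty_iff)
qed

lemma C_infty_compact:
  fixes f :: "'a::metric_space \<Rightarrow> real"
  shows "f \<in> C_infty E \<Longrightarrow> e > 0 \<Longrightarrow> compact {x\<in>E. e \<le> \<bar>f x\<bar>}"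
  by (simp add: C_infty_iff)

lemma C_infty_bounded:
  fixes f :: "'a::metric_space \<Rightarrow> real"
  assumes f: "f \<in> C_infty E"
  obtains C where "C > 0" "\<And>x. \<bar>f x\<bar> \<le> C"
proof -
  let ?K = "{x\<in>E. 1 \<le> \<bar>f x\<bar>}"
  have "compact (f ` ?K)"
    using C_infty_compact[OF f, of 1] C_infty_continuous_on[OF f]
    by (intro compact_continuous_image) (auto intro: continuous_on_subset)
  then have "bounded (f ` ?K)" by (rule compact_imp_bounded)
  then obtain B where B: "\<And>x. x \<in> ?K \<Longrightarrow> \<bar>f x\<bar> \<le> B" unfolding bounded_iff by auto
  have "\<bar>f x\<bar> \<le> max 1 B" for x
    using B[of x] C_infty_off[OF f, of x] by (cases "x \<in> E") force+
  then show thesis using that[of "max 1 B"] by auto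
qed

text \<open>Closedness under the sup norm. Asking for one approximant per e suits Riemann sums,
  which are produced for one accuracy at a time.\<close>

lemma C_infty_uniform_limit:
  fixes f :: "'a::metric_space \<Rightarrow> real"
  assumes off: "\<And>x. x \<notin> E \<Longrightarrow> f x = 0"
    and ap: "\<And>e. e > 0 \<Longrightarrow> \<exists>h\<in>C_infty E. \<forall>x\<in>E. \<bar>f x - h x\<bar> \<le> e"
  shows "f \<in> C_infty E"
proof (rule C_infty_compact_exhaustion[OF off])
  have "\<exists>h. \<forall>n. h n \<in> C_infty E \<and> (\<forall>x\<in>E. \<bar>f x - h n x\<bar> \<le> 1 / (Suc n))"
    by (rule choice) (use ap in \<open>auto simp: Bex_def\<close>)
  then obtain h where h: "\<And>n. h n \<in> C_infty E" "\<And>n x. x \<in> E \<Longrightarrow> \<bar>f x - h n x\<bar> \<le> 1 / (Suc n)"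
    by blast
  have "uniform_limit E h f sequentially"
  proof (rule uniform_limitI)
    fix e :: real assume "e > 0"
    then obtain N where N: "1 / real (Suc N) < e" using nat_approx_posE by blast
    have "\<bar>f x - h n x\<bar> < e" if "n \<ge> N" "x \<in> E" for n x
    proof -
      have "1 / real (Suc n) \<le> 1 / real (Suc N)" using that by (simp add: frac_le)
      then show ?thesis using h(2)[OF that(2), of n] N by linarith
    qed
    then show "\<forall>\<^sub>F n in sequentially. \<forall>x\<in>E. dist (h n x) (f x) < e"
      unfolding eventually_sequentially by (auto simp: dist_real_def abs_minus_commute)
  qed
  then show "continuous_on E f"
    by (rule uniform_limit_theorem[rotated]) (auto intro!: always_eventually C_infty_continuous_on h)
next
  fix e :: real assume e: "e > 0"
  then obtain h where h: "h \<in> C_infty E" "\<And>x. x \<in> E \<Longrightarrow> \<bar>f x - h x\<bar> \<le> e / 2"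
    using ap[of "e/2"] by auto
  show "\<exists>K. compact K \<and> K \<subseteq> E \<and> (\<forall>x\<in>E - K. \<bar>f x\<bar> < e)"
  proof (intro exI conjI ballI)
    show "compact {x\<in>E. e / 2 \<le> \<bar>h x\<bar>}" using C_infty_compact[OF h(1), of "e / 2"] e by simp
    fix x assume "x \<in> E - {x \<in> E. e / 2 \<le> \<bar>h x\<bar>}"
    then have "\<bar>h x\<bar> < e / 2" "\<bar>f x - h x\<bar> \<le> e / 2" using h by auto
    then show "\<bar>f x\<bar> < e" by linarith
  qed auto
qed

lemma C_infty_lincomb:
  fixes f :: "'a::metric_space \<Rightarrow> real"
  assumes f: "f \<in> C_infty E" and h: "h \<in> C_infty E"
  shows "(\<lambda>x. a * f x + b * h x) \<in> C_infty E"
proof (rule C_infty_compact_exhaustion)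
  fix e :: real assume e: "e > 0"
  \<comment> \<open>The summand 1 keeps the denominator positive for a = b = 0, and the factor 2
    leaves room for a strict inequality.\<close>
  define d where "d = e / (2 * (1 + \<bar>a\<bar> + \<bar>b\<bar>))"
  have d: "d > 0" using e by (simp add: d_def add_pos_nonneg)
  have "(\<bar>a\<bar> + \<bar>b\<bar>) * d < e"
  proof -
    have "(\<bar>a\<bar> + \<bar>b\<bar>) * d \<le> (1 + \<bar>a\<bar> + \<bar>b\<bar>) * d" using d by (intro mult_right_mono) auto
    also have "\<dots> = e / 2" by (simp add: d_def divide_simps)
    finally show ?thesis using e by simp
  qed
  then show "\<exists>K. compact K \<and> K \<subseteq> E \<and> (\<forall>x\<in>E - K. \<bar>a * f x + b * h x\<bar> < e)"
  proof (intro exI conjI ballI)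
    show "compact ({x\<in>E. d \<le> \<bar>f x\<bar>} \<union> {x\<in>E. d \<le> \<bar>h x\<bar>})"
      using f h d by (intro compact_Un) (auto simp: C_infty_compact)
    fix x assume "x \<in> E - ({x\<in>E. d \<le> \<bar>f x\<bar>} \<union> {x\<in>E. d \<le> \<bar>h x\<bar>})"
    then have "\<bar>f x\<bar> \<le> d" "\<bar>h x\<bar> \<le> d" by auto
    then have "\<bar>a * f x + b * h x\<bar> \<le> \<bar>a\<bar> * d + \<bar>b\<bar> * d"
      by (intro order_trans[OF abs_triangle_ineq] add_mono) (auto simp: abs_mult mult_left_mono)
    then show "\<bar>a * f x + b * h x\<bar> < e"
      using \<open>(\<bar>a\<bar> + \<bar>b\<bar>) * d < e\<close> by (simp add: distrib_right)
  qed auto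
qed (use f h in \<open>auto simp: C_infty_off intro!: continuous_on_add continuous_on_mult_left dest: C_infty_continuous_on\<close>)

lemma C_infty_zero: "(\<lambda>x. 0) \<in> C_infty (E :: 'a::metric_space set)"
  by (rule C_infty_compact_exhaustion) (auto intro!: exI[of _ "{}"])

lemma C_infty_sum:
  fixes f :: "'i \<Rightarrow> 'a::metric_space \<Rightarrow> real"
  assumes "\<And>i. i \<in> I \<Longrightarrow> f i \<in> C_infty E"
  shows "(\<lambda>x. \<Sum>i\<in>I. c i * f i x) \<in> C_infty E"
  using assms
proof (induction I rule: infinite_finite_induct)
  case (insert i I)
  have "(\<lambda>x. c i * f i x + 1 * (\<Sum>i\<in>I. c i * f i x)) \<in> C_infty E"
    by (rule C_infty_lincomb) (use insert in auto)
  then show ?case using insert by simp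
qed (auto simp: C_infty_zero)

lemma C_infty_mult_bounded:
  fixes f :: "'a::metric_space \<Rightarrow> real"
  assumes f: "f \<in> C_infty E" and c: "continuous_on E c" and b: "\<And>x. x \<in> E \<Longrightarrow> \<bar>c x\<bar> \<le> C"
  shows "(\<lambda>x. c x * f x) \<in> C_infty E"
proof (rule C_infty_compact_exhaustion)
  fix e :: real assume e: "e > 0"
  define d where "d = e / (1 + \<bar>C\<bar>)"
  have d: "d > 0" using e by (simp add: d_def add_pos_nonneg)
  show "\<exists>K. compact K \<and> K \<subseteq> E \<and> (\<forall>x\<in>E - K. \<bar>c x * f x\<bar> < e)"
  proof (intro exI conjI ballI)
    show "compact {x\<in>E. d \<le> \<bar>f x\<bar>}" using f d by (simp add: C_infty_compact)
    fix x assume x: "x \<in> E - {x\<in>E. d \<le> \<bar>f x\<bar>}"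
    have "\<bar>c x * f x\<bar> \<le> (1 + \<bar>C\<bar>) * \<bar>f x\<bar>"
      unfolding abs_mult using b[of x] x by (intro mult_right_mono) auto
    also have "\<dots> < (1 + \<bar>C\<bar>) * d" using x by (intro mult_strict_left_mono) auto
    also have "\<dots> = e" by (simp add: d_def add_nonneg_eq_0_iff)
    finally show "\<bar>c x * f x\<bar> < e" .
  qed auto
qed (use f c in \<open>auto simp: C_infty_off intro!: continuous_on_mult dest: C_infty_continuous_on\<close>)

lemma C_infty_borel_measurable:
  fixes f :: "'a::metric_space \<Rightarrow> real"
  assumes f: "f \<in> C_infty E" and [measurable]: "E \<in> sets borel"
  shows "f \<in> borel_measurable borel"
proof -
  have "(\<lambda>x. if x \<in> E then f x else 0) \<in> borel_measurable borel"
    by (rule borel_measurable_continuous_on_if) (auto intro: C_infty_continuous_on f)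
  moreover have "(\<lambda>x. if x \<in> E then f x else 0) = f" using C_infty_off[OF f] by auto
  ultimately show ?thesis by simp
qed

lemma sup_norm_le_iff:
  fixes f :: "'a::metric_space \<Rightarrow> real"
  assumes "f \<in> C_infty E" "E \<noteq> {}"
  shows "sup_norm E f \<le> c \<longleftrightarrow> (\<forall>x\<in>E. \<bar>f x\<bar> \<le> c)"
proof -
  obtain C where "\<And>x. \<bar>f x\<bar> \<le> C" using C_infty_bounded[OF assms(1)] by blast
  then have "bdd_above ((\<lambda>x. \<bar>f x\<bar>) ` E)" by (auto intro!: bdd_aboveI2)
  then show ?thesis unfolding sup_norm_def using assms(2) by (simp add: cSUP_le_iff)
qed

section \<open>Integrals of contraction semigroups in time\<close>

text \<open>Common interface of the spatial and the time-space semigroup. The norm bound and strong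
  continuity are pointwise over the whole type, so no supremum has to be shown finite or taken over
  a nonempty set.\<close>

locale contraction_semigroup =
  fixes E :: "'a::metric_space set" and K :: "real \<Rightarrow> ('a \<Rightarrow> real) \<Rightarrow> 'a \<Rightarrow> real"
  assumes maps: "\<And>s f. 0 \<le> s \<Longrightarrow> f \<in> C_infty E \<Longrightarrow> K s f \<in> C_infty E"
    and lincomb: "\<And>s f h a b. 0 \<le> s \<Longrightarrow> f \<in> C_infty E \<Longrightarrow> h \<in> C_infty E \<Longrightarrow>
      K s (\<lambda>x. a * f x + b * h x) = (\<lambda>x. a * K s f x + b * K s h x)"
    and at_0: "\<And>f. f \<in> C_infty E \<Longrightarrow> K 0 f = f"
    and semigroup: "\<And>r s f. 0 \<le> r \<Longrightarrow> 0 \<le> s \<Longrightarrow> f \<in> C_infty E \<Longrightarrow> K (r + s) f = K r (K s f)"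
    and contraction: "\<And>s f c x. 0 \<le> s \<Longrightarrow> f \<in> C_infty E \<Longrightarrow> (\<And>y. \<bar>f y\<bar> \<le> c) \<Longrightarrow> \<bar>K s f x\<bar> \<le> c"
    and strong: "\<And>f e. f \<in> C_infty E \<Longrightarrow> e > 0 \<Longrightarrow>
      \<exists>d>0. \<forall>s x. 0 \<le> s \<and> s < d \<longrightarrow> \<bar>K s f x - f x\<bar> \<le> e"
begin

lemma diff:
  assumes "0 \<le> s" "f \<in> C_infty E" "h \<in> C_infty E"
  shows "K s (\<lambda>x. f x - h x) x = K s f x - K s h x"
  using fun_cong[OF lincomb[OF assms, of 1 "-1"], of x] by simp

lemma diff_bound:
  assumes "0 \<le> s" "f \<in> C_infty E" "h \<in> C_infty E" "\<And>x. \<bar>f x - h x\<bar> \<le> c"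
  shows "\<bar>K s f x - K s h x\<bar> \<le> c"
  unfolding diff[OF assms(1-3), symmetric]
  by (rule contraction) (use assms C_infty_lincomb[OF assms(2,3), of 1 "-1"] in auto)

text \<open>Strong continuity at 0 carries over to all times with the same modulus: for s \<le> s',
  K s' f - K s f = K s (K (s' - s) f - f), and K s is a contraction.\<close>

lemma strong_uniform:
  assumes f: "f \<in> C_infty E" and e: "e > 0"
  obtains d where "d > 0" "\<And>s s' x. 0 \<le> s \<Longrightarrow> 0 \<le> s' \<Longrightarrow> \<bar>s - s'\<bar> < d \<Longrightarrow> \<bar>K s f x - K s' f x\<bar> \<le> e"
proof -
  obtain d where d: "d > 0" "\<And>s x. 0 \<le> s \<Longrightarrow> s < d \<Longrightarrow> \<bar>K s f x - f x\<bar> \<le> e"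
    using strong[OF f e] by blast
  have *: "\<bar>K s' f x - K s f x\<bar> \<le> e" if "0 \<le> s" "s \<le> s'" "s' - s < d" for s s' x
  proof -
    have "K s' f = K s (K (s' - s) f)" using semigroup[of s "s' - s" f] that f by simp
    moreover have "\<bar>K s (K (s' - s) f) x - K s f x\<bar> \<le> e"
      by (rule diff_bound) (use that f d in \<open>auto intro: maps\<close>)
    ultimately show ?thesis by simp
  qed
  have "\<bar>K s f x - K s' f x\<bar> \<le> e" if "0 \<le> s" "0 \<le> s'" "\<bar>s - s'\<bar> < d" for s s' x
    using *[of s s' x] *[of s' s x] that by (cases "s \<le> s'") (auto simp: abs_minus_commute)
  then show thesis using that d(1) by blast
qed

lemma continuous_on_time:
  assumes f: "f \<in> C_infty E"
  shows "continuous_on {0..} (\<lambda>s. K s f x)"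
  unfolding continuous_on_iff
proof (intro ballI allI impI)
  fix s e :: real assume s: "s \<in> {0..}" and e: "e > 0"
  obtain d where "d > 0" "\<And>s s' x. 0 \<le> s \<Longrightarrow> 0 \<le> s' \<Longrightarrow> \<bar>s - s'\<bar> < d \<Longrightarrow> \<bar>K s f x - K s' f x\<bar> \<le> e / 2"
    using strong_uniform[OF f, of "e/2"] e by auto
  note d = this
  have "dist (K s' f x) (K s f x) < e" if "s' \<in> {0..}" "dist s' s < d" for s'
    using d(2)[of s' s x] that s e by (auto simp: dist_real_def)
  then show "\<exists>d>0. \<forall>s'\<in>{0..}. dist s' s < d \<longrightarrow> dist (K s' f x) (K s f x) < e"
    using d(1) by blast
qed

lemma measurable_time:
  assumes f: "f \<in> C_infty E" and X: "X \<in> borel_measurable m" "\<And>a. a \<in> space m \<Longrightarrow> 0 \<le> X a"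
  shows "(\<lambda>a. K (X a) f x) \<in> borel_measurable m"
proof -
  \<comment> \<open>\<open>max 0\<close> extends the path of K from the half line to a continuous
    function on the reals, whose composition with X is measurable.\<close>
  have "continuous_on UNIV (\<lambda>s. K (max 0 s) f x)"
    by (rule continuous_on_compose2[OF continuous_on_time[OF f]]) (auto intro!: continuous_intros)
  then have "(\<lambda>s. K (max 0 s) f x) \<in> borel_measurable borel"
    by (rule borel_measurable_continuous_onI)
  then have "(\<lambda>a. K (max 0 (X a)) f x) \<in> borel_measurable m"
    using X(1) by measurable
  then show ?thesis
    by (rule subst[of _ _ "\<lambda>x. x", OF measurable_cong, rotated]) (use X(2) in \<open>auto simp: max_def\<close>)
qed

lemma integrable_time:
  assumes f: "f \<in> C_infty E" and X: "X \<in> borel_measurable m" "\<And>a. a \<in> space m \<Longrightarrow> 0 \<le> X a"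
    and m: "finite_measure m"
  shows "integrable m (\<lambda>a. K (X a) f x)"
proof -
  interpret finite_measure m by fact
  obtain C where "C > 0" "\<And>x. \<bar>f x\<bar> \<le> C" using C_infty_bounded[OF f] by blast
  then show ?thesis
    by (intro integrable_const_bound[of _ C] measurable_time[OF f X])
       (use contraction[OF X(2) f] in auto)
qed

text \<open>The weights and nodes of the Riemann sum do not depend on \<open>f\<close> and \<open>h\<close> separately, so that
  bounded operators can be moved past the integral.\<close>

lemma riemann_sum:
  assumes f: "f \<in> C_infty E" and h: "h \<in> C_infty E" and e: "e > 0"
    and X: "X \<in> borel_measurable m" "\<And>a. a \<in> space m \<Longrightarrow> 0 \<le> X a" and m: "finite_measure m"
  shows "\<exists>(N::nat) w \<sigma>. (\<forall>k. 0 \<le> \<sigma> k) \<and>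
    (\<forall>x. \<bar>(\<integral>a. K (X a) f x \<partial>m) - (\<Sum>k<N. w k * K (\<sigma> k) f x)\<bar> \<le> e) \<and>
    (\<forall>x. \<bar>(\<integral>a. K (X a) h x \<partial>m) - (\<Sum>k<N. w k * K (\<sigma> k) h x)\<bar> \<le> e)"
proof -
  interpret finite_measure m by fact
  define \<mu> where "\<mu> = measure m (space m)"
  have \<mu>: "0 \<le> \<mu>" by (simp add: \<mu>_def)
  \<comment> \<open>Replacing X a by its node costs at most e' on a set of mass at most \<mu>; the
    summand 1 covers \<mu> = 0. The other e/2 is spent on the tail.\<close>
  define e' where "e' = e / (2 * (\<mu> + 1))"
  have e': "e' > 0" using e \<mu> by (simp add: e'_def)
  obtain d1 where d1: "d1 > 0" "\<And>s s' x. 0 \<le> s \<Longrightarrow> 0 \<le> s' \<Longrightarrow> \<bar>s - s'\<bar> < d1 \<Longrightarrow> \<bar>K s f x - K s' f x\<bar> \<le> e'"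
    using strong_uniform[OF f e'] by blast
  obtain d2 where d2: "d2 > 0" "\<And>s s' x. 0 \<le> s \<Longrightarrow> 0 \<le> s' \<Longrightarrow> \<bar>s - s'\<bar> < d2 \<Longrightarrow> \<bar>K s h x - K s' h x\<bar> \<le> e'"
    using strong_uniform[OF h e'] by blast
  \<comment> \<open>The half makes a distance of at most d strictly smaller than d1 and d2.\<close>
  define d where "d = min d1 d2 / 2"
  have d: "d > 0" "d < d1" "d < d2" using d1(1) d2(1) by (auto simp: d_def)
  obtain C1 where C1: "C1 > 0" "\<And>x. \<bar>f x\<bar> \<le> C1" using C_infty_bounded[OF f] by blast
  obtain C2 where C2: "C2 > 0" "\<And>x. \<bar>h x\<bar> \<le> C2" using C_infty_bounded[OF h] by blast
  define C where "C = max C1 C2"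
  have C: "C > 0" "\<And>x. \<bar>f x\<bar> \<le> C" "\<And>x. \<bar>h x\<bar> \<le> C"
    using C1 C2 by (auto simp: C_def le_max_iff_disj)
  note [measurable] = X(1)
  \<comment> \<open>Cells of width d cover only [0, N d). N is chosen so that the remaining mass
    times the bound C is at most e/2.\<close>
  have "(\<lambda>N. measure m {a\<in>space m. real N * d \<le> X a}) \<longlonglongrightarrow> measure m (\<Inter>N. {a\<in>space m. real N * d \<le> X a})"
    by (rule finite_Lim_measure_decseq)
       (use d(1) in \<open>auto simp: decseq_def intro: order_trans[rotated] mult_right_mono\<close>)
  also have "(\<Inter>N. {a\<in>space m. real N * d \<le> X a}) = {}"
  proof -
    have False if "a \<in> (\<Inter>N. {a\<in>space m. real N * d \<le> X a})" for a
    proof -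
      obtain N where "X a / d < real N" using reals_Archimedean2 by blast
      moreover have "real N * d \<le> X a" using that by blast
      ultimately show False using d(1) by (simp add: field_simps)
    qed
    then show ?thesis by blast
  qed
  finally have "(\<lambda>N. measure m {a\<in>space m. real N * d \<le> X a}) \<longlonglongrightarrow> 0" by simp
  then have "\<forall>\<^sub>F N in sequentially. measure m {a\<in>space m. real N * d \<le> X a} < e / (2 * C)"
    by (rule order_tendstoD) (use e C in auto)
  then obtain N where N: "measure m {a\<in>space m. real N * d \<le> X a} < e / (2 * C)"
    by (auto dest: eventually_happens)
  define A where "A k = {a\<in>space m. real k * d \<le> X a \<and> X a < real (Suc k) * d}" for k
  have [measurable]: "A k \<in> sets m" for k unfolding A_def by measurable
  have ind [simp]: "integrable m (indicat_real B)" if "B \<in> sets m" for B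
    using that by (intro integrable_real_indicator) (auto simp: less_top[symmetric])
  have main: "\<bar>(\<integral>a. K (X a) u x \<partial>m) - (\<Sum>k<N. measure m (A k) * K (real k * d) u x)\<bar> \<le> e"
    if u: "u \<in> C_infty E" and uC: "\<And>x. \<bar>u x\<bar> \<le> C"
      and ud: "\<And>s s' x. 0 \<le> s \<Longrightarrow> 0 \<le> s' \<Longrightarrow> \<bar>s - s'\<bar> \<le> d \<Longrightarrow> \<bar>K s u x - K s' u x\<bar> \<le> e'" for u x
  proof -
    let ?S = "\<lambda>a. \<Sum>k<N. indicator (A k) a * K (real k * d) u x"
    have iS: "integrable m ?S" by (intro Bochner_Integration.integrable_sum integrable_mult_left) simp
    have "(\<integral>a. ?S a \<partial>m) = (\<Sum>k<N. measure m (A k) * K (real k * d) u x)"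
      by (subst Bochner_Integration.integral_sum) (auto simp: A_def Int_absorb2)
    then have "\<bar>(\<integral>a. K (X a) u x \<partial>m) - (\<Sum>k<N. measure m (A k) * K (real k * d) u x)\<bar>
        = \<bar>\<integral>a. K (X a) u x - ?S a \<partial>m\<bar>"
      using iS integrable_time[OF u X m] by simp
    also have "\<dots> \<le> (\<integral>a. e' + C * indicator {a\<in>space m. real N * d \<le> X a} a \<partial>m)"
    proof (rule integral_abs_bound[THEN order_trans], rule integral_mono)
      show "integrable m (\<lambda>a. \<bar>K (X a) u x - ?S a\<bar>)"
        using iS integrable_time[OF u X m] by simp
      fix a assume a: "a \<in> space m"
      show "\<bar>K (X a) u x - ?S a\<bar> \<le> e' + C * indicator {a\<in>space m. real N * d \<le> X a} a"
      proof (cases "X a < real N * d")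
        case True
        \<comment> \<open>Index of the only cell that contains X a, so that the sum collapses to a
          single term.\<close>
        define k0 where "k0 = nat \<lfloor>X a / d\<rfloor>"
        have fl: "0 \<le> \<lfloor>X a / d\<rfloor>" using X(2)[OF a] d by simp
        have "a \<in> A k \<longleftrightarrow> k = k0" for k
        proof -
          have "a \<in> A k \<longleftrightarrow> real_of_int (int k) \<le> X a / d \<and> X a / d < real_of_int (int k) + 1"
            using a d by (simp add: A_def field_simps)
          also have "\<dots> \<longleftrightarrow> \<lfloor>X a / d\<rfloor> = int k" by (simp add: floor_eq_iff)
          also have "\<dots> \<longleftrightarrow> k = k0" using fl by (auto simp: k0_def)
          finally show ?thesis .
        qed
        note k0 = this
        have ink: "real k0 * d \<le> X a" "X a < real (Suc k0) * d" using k0[of k0] by (auto simp: A_def)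
        have "real k0 * d < real N * d" using ink True by linarith
        then have k0N: "k0 < N" using d by simp
        have "?S a = (\<Sum>k<N. if k = k0 then K (real k * d) u x else 0)"
          by (intro sum.cong) (auto simp: indicator_def k0)
        also have "\<dots> = K (real k0 * d) u x" using k0N by simp
        finally have "?S a = K (real k0 * d) u x" .
        moreover have "\<bar>K (X a) u x - K (real k0 * d) u x\<bar> \<le> e'"
          by (rule ud) (use X(2)[OF a] d ink in \<open>auto simp: algebra_simps\<close>)
        ultimately show ?thesis using C by (simp add: indicator_def)
      next
        case False
        have "a \<notin> A k" if "k < N" for k
        proof -
          have "real (Suc k) * d \<le> real N * d" using that d by (intro mult_right_mono) auto
          then show ?thesis using False by (auto simp: A_def)
        qed
        then have "?S a = 0" by (intro sum.neutral) auto
        then show ?thesis using False a contraction[OF X(2)[OF a] u uC, of x] e' by simp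
      qed
    qed (auto intro!: Bochner_Integration.integrable_add integrable_mult_right)
    also have "\<dots> = \<mu> * e' + C * measure m {a\<in>space m. real N * d \<le> X a}"
      by (subst Bochner_Integration.integral_add) (auto simp: \<mu>_def Int_absorb2)
    also have "\<dots> \<le> e / 2 + C * (e / (2 * C))"
    proof (intro add_mono mult_left_mono)
      show "\<mu> * e' \<le> e / 2" using e \<mu> by (simp add: e'_def field_simps)
    qed (use N C in auto)
    also have "\<dots> = e" using C by simp
    finally show ?thesis .
  qed
  show ?thesis
    by (rule exI[of _ N], rule exI[of _ "\<lambda>k. measure m (A k)"], rule exI[of _ "\<lambda>k. real k * d"])
       (use d C in \<open>auto intro!: main f h d1(2) d2(2)\<close>)
qed

text \<open>The approximating Riemann sums are finite linear combinations of functions K \<sigma> f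
  and converge uniformly.\<close>

lemma time_integral_C_infty:
  assumes f: "f \<in> C_infty E"
    and X: "X \<in> borel_measurable m" "\<And>a. a \<in> space m \<Longrightarrow> 0 \<le> X a" and m: "finite_measure m"
  shows "(\<lambda>x. \<integral>a. K (X a) f x \<partial>m) \<in> C_infty E"
proof (rule C_infty_uniform_limit)
  fix x assume "x \<notin> E"
  then have "(\<integral>a. K (X a) f x \<partial>m) = (\<integral>a. 0 \<partial>m)"
    by (intro Bochner_Integration.integral_cong refl C_infty_off[OF maps[OF X(2) f]])
  then show "(\<integral>a. K (X a) f x \<partial>m) = 0" by simp
next
  fix e :: real assume "e > 0"
  from riemann_sum[OF f f this X m] obtain N w \<sigma> where
    "\<forall>k. 0 \<le> \<sigma> k" "\<forall>x. \<bar>(\<integral>a. K (X a) f x \<partial>m) - (\<Sum>k<N::nat. w k * K (\<sigma> k) f x)\<bar> \<le> e" by blast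
  then show "\<exists>h\<in>C_infty E. \<forall>x\<in>E. \<bar>(\<integral>a. K (X a) f x \<partial>m) - h x\<bar> \<le> e"
    by (intro bexI[of _ "\<lambda>x. \<Sum>k<N. w k * K (\<sigma> k) f x"]) (auto intro!: C_infty_sum maps f)
qed

lemma sum:
  assumes "0 \<le> s" "\<And>i. i \<in> I \<Longrightarrow> f i \<in> C_infty E"
  shows "K s (\<lambda>x. \<Sum>i\<in>I. c i * f i x) = (\<lambda>x. \<Sum>i\<in>I. c i * K s (f i) x)"
  using assms(2)
proof (induction I rule: infinite_finite_induct)
  case (insert i I)
  have "K s (\<lambda>x. c i * f i x + 1 * (\<Sum>i\<in>I. c i * f i x)) = (\<lambda>x. c i * K s (f i) x + 1 * K s (\<lambda>x. \<Sum>i\<in>I. c i * f i x) x)"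
    by (rule lincomb) (use assms(1) insert in \<open>auto intro!: C_infty_sum\<close>)
  then show ?case using insert by simp
next
  case (infinite I)
  then show ?case using lincomb[OF assms(1) C_infty_zero C_infty_zero, of 0 0] by simp
next
  case empty
  then show ?case using lincomb[OF assms(1) C_infty_zero C_infty_zero, of 0 0] by simp
qed

lemma time_integral_commute:
  assumes f: "f \<in> C_infty E" and b: "0 \<le> b"
    and X: "X \<in> borel_measurable m" "\<And>a. a \<in> space m \<Longrightarrow> 0 \<le> X a" and m: "finite_measure m"
  shows "K b (\<lambda>x. \<integral>a. K (X a) f x \<partial>m) x = (\<integral>a. K (b + X a) f x \<partial>m)"
proof -
  let ?I = "\<lambda>x. \<integral>a. K (X a) f x \<partial>m"
  have eq: "K (X a) (K b f) = K (b + X a) f" if "a \<in> space m" for a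
    using semigroup[OF X(2)[OF that] b f] by (simp add: add.commute)
  have J: "(\<integral>a. K (b + X a) f x \<partial>m) = (\<integral>a. K (X a) (K b f) x \<partial>m)"
    by (rule Bochner_Integration.integral_cong) (auto simp: eq)
  have "\<bar>K b ?I x - (\<integral>a. K (b + X a) f x \<partial>m)\<bar> \<le> e" if e: "e > 0" for e
  proof -
    have "e / 2 > 0" using e by simp
    \<comment> \<open>The pair f, \<open>K b f\<close> shares nodes and weights, so
      \<open>K b\<close> carries the first Riemann sum exactly to the second.\<close>
    from riemann_sum[OF f maps[OF b f] this X m] obtain N w \<sigma> where
      s: "\<forall>k. 0 \<le> \<sigma> k" and 1: "\<And>x. \<bar>?I x - (\<Sum>k<N::nat. w k * K (\<sigma> k) f x)\<bar> \<le> e / 2"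
      and 2: "\<And>x. \<bar>(\<integral>a. K (X a) (K b f) x \<partial>m) - (\<Sum>k<N::nat. w k * K (\<sigma> k) (K b f) x)\<bar> \<le> e / 2" by blast
    have "\<bar>K b ?I x - K b (\<lambda>x. \<Sum>k<N::nat. w k * K (\<sigma> k) f x) x\<bar> \<le> e / 2"
      by (rule diff_bound[OF b]) (use 1 s in \<open>auto intro!: C_infty_sum maps f time_integral_C_infty X m\<close>)
    moreover have "K b (\<lambda>x. \<Sum>k<N::nat. w k * K (\<sigma> k) f x) x = (\<Sum>k<N::nat. w k * K (\<sigma> k) (K b f) x)"
    proof -
      have "K b (K (\<sigma> k) f) = K (\<sigma> k) (K b f)" for k
        using semigroup[OF b spec[OF s, of k] f] semigroup[OF spec[OF s, of k] b f] by (simp add: add.commute)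
      then show ?thesis
        by (subst sum) (use b s in \<open>auto intro!: maps f\<close>)
    qed
    ultimately show ?thesis using 2[of x] unfolding J by linarith
  qed
  then have "\<bar>K b ?I x - (\<integral>a. K (b + X a) f x \<partial>m)\<bar> \<le> 0"
    by (rule field_le_epsilon[of _ 0, simplified])
  then show ?thesis by simp
qed

end

lemma feller_semigroup_contraction_semigroup:
  fixes E :: "'a::metric_space set"
  assumes F: "feller_semigroup E P"
  shows "contraction_semigroup E P"
proof
  fix s c x f assume s: "0 \<le> (s::real)" and f: "f \<in> C_infty E" and c: "\<And>y. \<bar>f y\<bar> \<le> c"
  have Pf: "P s f \<in> C_infty E" using F s f by (auto simp: feller_semigroup_def)
  show "\<bar>P s f x\<bar> \<le> c"
  \<comment> \<open>\<open>sup_norm\<close> is informative only for nonempty E, which x \<in> E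
    guarantees; elsewhere P s f vanishes.\<close>
  proof (cases "x \<in> E")
    case True
    then have "E \<noteq> {}" by auto
    have "sup_norm E (P s f) \<le> sup_norm E f" using F s f by (auto simp: feller_semigroup_def)
    also have "\<dots> \<le> c" using sup_norm_le_iff[OF f \<open>E \<noteq> {}\<close>] c by blast
    finally show ?thesis using sup_norm_le_iff[OF Pf \<open>E \<noteq> {}\<close>] True by blast
  qed (use C_infty_off[OF Pf] c[of x] in auto)
next
  fix f and e :: real assume f: "f \<in> C_infty E" and e: "e > 0"
  have "uniform_limit E (\<lambda>r. P r f) f (at_right 0)" using F f by (auto simp: feller_semigroup_def)
  then have "\<forall>\<^sub>F r in at_right 0. \<forall>x\<in>E. dist (P r f x) (f x) < e" using e by (rule uniform_limitD)
  then obtain d where d: "d > 0" "\<And>r x. 0 < r \<Longrightarrow> r < d \<Longrightarrow> x \<in> E \<Longrightarrow> dist (P r f x) (f x) < e"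
    unfolding eventually_at_right_field by auto
  have "\<bar>P s f x - f x\<bar> \<le> e" if "0 \<le> s" "s < d" for s x
  \<comment> \<open>The limit at 0 from the right says nothing about s = 0, which is settled by P 0
    f = f.\<close>
  proof (cases "s = 0 \<or> x \<notin> E")
    case True
    moreover have "P s f \<in> C_infty E" "P 0 f = f" using F f that by (auto simp: feller_semigroup_def)
    ultimately show ?thesis using f e by (auto simp: C_infty_off)
  qed (use d(2)[of s x] that in \<open>auto simp: dist_real_def\<close>)
  then show "\<exists>d>0. \<forall>s x. 0 \<le> s \<and> s < d \<longrightarrow> \<bar>P s f x - f x\<bar> \<le> e" using d(1) by blast
qed (use F in \<open>simp_all add: feller_semigroup_def\<close>)

section \<open>The time-space shift semigroup\<close>

lemma C_infty_slice:
  fixes u :: "real \<times> 'a::metric_space \<Rightarrow> real"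
  assumes u: "u \<in> C_infty ({0..T} \<times> \<Omega>)"
  shows "(\<lambda>y. u (t, y)) \<in> C_infty \<Omega>"
  unfolding C_infty_iff
proof (intro conjI allI impI)
  fix y assume "y \<notin> \<Omega>"
  then show "u (t, y) = 0" by (intro C_infty_off[OF u]) auto
next
  show "continuous_on \<Omega> (\<lambda>y. u (t, y))"
  proof (cases "t \<in> {0..T}")
    case True
    then show ?thesis
      by (intro continuous_on_compose2[OF C_infty_continuous_on[OF u]]) (auto intro!: continuous_intros)
  next
    case False
    then have "(\<lambda>y. u (t, y)) = (\<lambda>y. 0)" by (auto intro!: C_infty_off[OF u])
    then show ?thesis by (simp only: continuous_on_const)
  qed
next
  fix e :: real assume e: "e > 0"
  have "compact ({z\<in>{0..T} \<times> \<Omega>. e \<le> \<bar>u z\<bar>} \<inter> {t} \<times> UNIV)"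
    by (intro compact_Int_closed C_infty_compact[OF u e] closed_Times) auto
  then have "compact (snd ` ({z\<in>{0..T} \<times> \<Omega>. e \<le> \<bar>u z\<bar>} \<inter> {t} \<times> UNIV))"
    by (intro compact_continuous_image) (auto intro!: continuous_intros)
  moreover have "snd ` ({z\<in>{0..T} \<times> \<Omega>. e \<le> \<bar>u z\<bar>} \<inter> {t} \<times> UNIV) = {y\<in>\<Omega>. e \<le> \<bar>u (t, y)\<bar>}"
  proof -
    have "y \<in> snd ` ({z\<in>{0..T} \<times> \<Omega>. e \<le> \<bar>u z\<bar>} \<inter> {t} \<times> UNIV)" if "y \<in> \<Omega>" "e \<le> \<bar>u (t, y)\<bar>" for y
    proof (rule image_eqI[of _ _ "(t, y)"])
      have "(t, y) \<in> {0..T} \<times> \<Omega>"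
        using C_infty_off[OF u, of "(t, y)"] that e by (cases "(t, y) \<in> {0..T} \<times> \<Omega>") auto
      then show "(t, y) \<in> {z\<in>{0..T} \<times> \<Omega>. e \<le> \<bar>u z\<bar>} \<inter> {t} \<times> UNIV" using that by auto
    qed simp
    then show ?thesis by auto
  qed
  ultimately show "compact {y\<in>\<Omega>. e \<le> \<bar>u (t, y)\<bar>}" by simp
qed

text \<open>Uniform continuity is available on [0,T] \<times> C, where C is the projection of the
  compact set {|u| \<ge> e/2}. For x outside C both values are below e/2 at all times.\<close>

lemma C_infty_uniform_in_time:
  fixes u :: "real \<times> 'a::metric_space \<Rightarrow> real"
  assumes u: "u \<in> C_infty ({0..T} \<times> \<Omega>)" and e: "e > 0"
  obtains d where "d > 0"
    "\<And>t t' x. t \<in> {0..T} \<Longrightarrow> t' \<in> {0..T} \<Longrightarrow> \<bar>t - t'\<bar> < d \<Longrightarrow> \<bar>u (t, x) - u (t', x)\<bar> \<le> e"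
proof -
  define C where "C = snd ` {z\<in>{0..T} \<times> \<Omega>. e / 2 \<le> \<bar>u z\<bar>}"
  have "compact {z\<in>{0..T} \<times> \<Omega>. e / 2 \<le> \<bar>u z\<bar>}" using C_infty_compact[OF u, of "e/2"] e by simp
  then have "compact C" unfolding C_def
    by (intro compact_continuous_image) (auto intro!: continuous_intros)
  then have "compact ({0..T} \<times> C)" by (intro compact_Times) auto
  moreover have "C \<subseteq> \<Omega>" by (auto simp: C_def)
  then have "continuous_on ({0..T} \<times> C) u"
    by (intro continuous_on_subset[OF C_infty_continuous_on[OF u]]) auto
  ultimately have "uniformly_continuous_on ({0..T} \<times> C) u"
    by (intro compact_uniformly_continuous)
  then obtain d where d: "d > 0"
    "\<And>z z'. z \<in> {0..T} \<times> C \<Longrightarrow> z' \<in> {0..T} \<times> C \<Longrightarrow> dist z' z < d \<Longrightarrow> dist (u z') (u z) < e"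
    unfolding uniformly_continuous_on_def using e by blast
  have "\<bar>u (t, x) - u (t', x)\<bar> \<le> e" if t: "t \<in> {0..T}" "t' \<in> {0..T}" "\<bar>t - t'\<bar> < d" for t t' x
  proof (cases "x \<in> C")
    case True
    then show ?thesis using d(2)[of "(t', x)" "(t, x)"] t by (auto simp: dist_Pair_Pair dist_real_def)
  next
    case False
    have *: "\<bar>u (s, x)\<bar> < e / 2" if "s \<in> {0..T}" for s
    proof (rule ccontr)
      assume a: "\<not> \<bar>u (s, x)\<bar> < e / 2"
      then have "x \<in> \<Omega>" using C_infty_off[OF u, of "(s, x)"] e by (cases "x \<in> \<Omega>") auto
      then have "(s, x) \<in> {z\<in>{0..T} \<times> \<Omega>. e / 2 \<le> \<bar>u z\<bar>}" using a that by auto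
      then show False using False unfolding C_def by force
    qed
    then show ?thesis using *[OF t(1)] *[OF t(2)] by linarith
  qed
  then show thesis using that d(1) by blast
qed

text \<open>Equicontinuity in time reduces vanishing at infinity to a finite net of times: the union
  of the compact level sets of the slices in the net controls all other slices up to e/2.\<close>

lemma C_infty_glue_slices:
  fixes v :: "real \<times> 'a::metric_space \<Rightarrow> real"
  assumes off: "\<And>z. z \<notin> {0..T} \<times> \<Omega> \<Longrightarrow> v z = 0"
    and sl: "\<And>t. t \<in> {0..T} \<Longrightarrow> (\<lambda>y. v (t, y)) \<in> C_infty \<Omega>"
    and eq: "\<And>e. e > 0 \<Longrightarrow> \<exists>d>0. \<forall>t\<in>{0..T}. \<forall>t'\<in>{0..T}. \<bar>t - t'\<bar> < d \<longrightarrow>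
      (\<forall>x\<in>\<Omega>. \<bar>v (t, x) - v (t', x)\<bar> \<le> e)"
  shows "v \<in> C_infty ({0..T} \<times> \<Omega>)"
proof (rule C_infty_compact_exhaustion[OF off])
  show "continuous_on ({0..T} \<times> \<Omega>) v"
    unfolding continuous_on_iff
  proof (intro ballI allI impI)
    fix z and e :: real assume z: "z \<in> {0..T} \<times> \<Omega>" and e: "e > 0"
    obtain t x where tx: "z = (t, x)" "t \<in> {0..T}" "x \<in> \<Omega>" using z by auto
    obtain d1 where d1: "d1 > 0" "\<And>t' x. t' \<in> {0..T} \<Longrightarrow> \<bar>t - t'\<bar> < d1 \<Longrightarrow> x \<in> \<Omega> \<Longrightarrow> \<bar>v (t, x) - v (t', x)\<bar> \<le> e/3"
      using eq[of "e/3"] e tx by auto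
    obtain d2 where d2: "d2 > 0" "\<And>x'. x' \<in> \<Omega> \<Longrightarrow> dist x' x < d2 \<Longrightarrow> dist (v (t, x')) (v (t, x)) < e/3"
      using C_infty_continuous_on[OF sl[OF tx(2)], unfolded continuous_on_iff, rule_format, OF tx(3), of "e/3"] e
      by auto
    have "dist (v z') (v z) < e" if z': "z' \<in> {0..T} \<times> \<Omega>" "dist z' z < min d1 d2" for z'
    proof -
      obtain t' x' where tx': "z' = (t', x')" "t' \<in> {0..T}" "x' \<in> \<Omega>" using z' by auto
      have "dist t' t < d1" "dist x' x < d2"
        using z'(2) dist_fst_le[of z' z] dist_snd_le[of z' z] by (auto simp: tx tx')
      then show ?thesis
        using d1(2)[OF tx'(2) _ tx'(3)] d2(2)[OF tx'(3)] e unfolding dist_real_def tx(1) tx'(1) by linarith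
    qed
    then show "\<exists>d>0. \<forall>z'\<in>{0..T} \<times> \<Omega>. dist z' z < d \<longrightarrow> dist (v z') (v z) < e"
      using d1(1) d2(1) by (intro exI[of _ "min d1 d2"]) auto
  qed
next
  fix e :: real assume e: "e > 0"
  then obtain d where d: "d > 0" "\<And>t t' x. t \<in> {0..T} \<Longrightarrow> t' \<in> {0..T} \<Longrightarrow> \<bar>t - t'\<bar> < d \<Longrightarrow> x \<in> \<Omega> \<Longrightarrow>
      \<bar>v (t, x) - v (t', x)\<bar> \<le> e / 2"
    using eq[of "e/2"] by auto
  have "seq_compact {0..T}" using compact_Icc compact_imp_seq_compact by blast
  then obtain F where F': "finite F \<and> F \<subseteq> {0..T} \<and> {0..T} \<subseteq> (\<Union>t\<in>F. ball t d)"
    by (rule exE[OF seq_compact_imp_totally_bounded[THEN spec, THEN mp, OF _ d(1)]])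
  note F = conjunct1[OF F'] conjunct1[OF conjunct2[OF F']] conjunct2[OF conjunct2[OF F']]
  define C where "C = (\<Union>t\<in>F. {y\<in>\<Omega>. e / 2 \<le> \<bar>v (t, y)\<bar>})"
  have "compact C" unfolding C_def
  proof (rule compact_UN[OF F(1)])
    fix t assume "t \<in> F"
    then have "t \<in> {0..T}" using F(2) by blast
    then show "compact {y\<in>\<Omega>. e / 2 \<le> \<bar>v (t, y)\<bar>}" using C_infty_compact[OF sl, of t "e/2"] e by simp
  qed
  have "\<bar>v z\<bar> < e" if z: "z \<in> {0..T} \<times> \<Omega> - {0..T} \<times> C" for z
  proof -
    obtain t x where tx: "z = (t, x)" "t \<in> {0..T}" "x \<in> \<Omega>" "x \<notin> C" using z by blast
    have "t \<in> (\<Union>t\<in>F. ball t d)" using F(3) tx(2) by (rule subsetD)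
    then obtain t' where t': "t' \<in> F" "\<bar>t - t'\<bar> < d"
      by (elim UN_E) (simp add: dist_real_def abs_minus_commute)
    have "\<bar>v (t', x)\<bar> < e / 2" using tx t' by (auto simp: C_def)
    moreover have "\<bar>v (t, x) - v (t', x)\<bar> \<le> e / 2"
      using d(2)[OF tx(2) subsetD[OF F(2) t'(1)] t'(2) tx(3)] .
    ultimately show ?thesis unfolding tx(1) by linarith
  qed
  moreover have "{0..T} \<times> C \<subseteq> {0..T} \<times> \<Omega>" by (auto simp: C_def)
  ultimately show "\<exists>K. compact K \<and> K \<subseteq> {0..T} \<times> \<Omega> \<and> (\<forall>z\<in>{0..T} \<times> \<Omega> - K. \<bar>v z\<bar> < e)"
    using compact_Times[OF compact_Icc \<open>compact C\<close>, of 0 T] by blast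
qed

text \<open>\<open>max 0\<close> absorbs the time coordinate at 0, which merges the two integrals of
  \<open>time_space_semigroup\<close> into one expectation. The value 0 for t outside [0,T] is the
  normalisation of \<open>C_infty\<close>.\<close>

definition shift_semigroup ::
    "real \<Rightarrow> (real \<Rightarrow> ('a \<Rightarrow> real) \<Rightarrow> 'a \<Rightarrow> real) \<Rightarrow> real \<Rightarrow> (real \<times> 'a \<Rightarrow> real) \<Rightarrow> real \<times> 'a \<Rightarrow> real" where
  "shift_semigroup T P s u = (\<lambda>(t, x). if t \<in> {0..T} then P s (\<lambda>y. u (max 0 (t - s), y)) x else 0)"

lemma shift_semigroup_apply:
  "t \<in> {0..T} \<Longrightarrow> shift_semigroup T P s u (t, x) = P s (\<lambda>y. u (max 0 (t - s), y)) x"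
  by (simp add: shift_semigroup_def)

lemma shift_semigroup_off:
  "t \<notin> {0..T} \<Longrightarrow> shift_semigroup T P s u (t, x) = 0"
  unfolding shift_semigroup_def by (simp only: prod.case if_False)

text \<open>P contracts differences of slices, so it preserves the modulus of continuity of u in
  time; membership in \<open>C_infty\<close> then follows by gluing slices.\<close>

lemma contraction_semigroup_shift:
  fixes \<Omega> :: "'a::metric_space set"
  assumes P: "contraction_semigroup \<Omega> P"
  shows "contraction_semigroup ({0..T} \<times> \<Omega>) (shift_semigroup T P)"
proof -
  interpret contraction_semigroup \<Omega> P by fact
  let ?K = "shift_semigroup T P" and ?E = "{0..T} \<times> \<Omega>"
  note sl = C_infty_slice[where T = T and \<Omega> = \<Omega>]
  have mem: "max 0 (t - s) \<in> {0..T}" if "t \<in> {0..T}" "0 \<le> s" for t s using that by auto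
  have maps': "?K s u \<in> C_infty ?E" if s: "0 \<le> s" and u: "u \<in> C_infty ?E" for s u
  proof (rule C_infty_glue_slices)
    fix z assume z: "z \<notin> ?E"
    obtain t x where "z = (t, x)" by (cases z)
    then show "?K s u z = 0"
      using z C_infty_off[OF maps[OF s sl[OF u, of "max 0 (t - s)"]], of x] by (auto simp: shift_semigroup_def)
  next
    fix t assume "t \<in> {0..T}"
    then show "(\<lambda>y. ?K s u (t, y)) \<in> C_infty \<Omega>" using maps[OF s sl[OF u]] by (simp add: shift_semigroup_apply)
  next
    fix e :: real assume e: "e > 0"
    obtain d where d: "d > 0" "\<And>t t' x. t \<in> {0..T} \<Longrightarrow> t' \<in> {0..T} \<Longrightarrow> \<bar>t - t'\<bar> < d \<Longrightarrow> \<bar>u (t, x) - u (t', x)\<bar> \<le> e"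
      using C_infty_uniform_in_time[OF u e] by blast
    have "\<bar>?K s u (t, x) - ?K s u (t', x)\<bar> \<le> e" if t: "t \<in> {0..T}" "t' \<in> {0..T}" "\<bar>t - t'\<bar> < d" for t t' x
      unfolding shift_semigroup_apply[OF t(1)] shift_semigroup_apply[OF t(2)]
      using mem[OF t(1) s] mem[OF t(2) s] t(3) by (intro diff_bound[OF s sl[OF u] sl[OF u]] d(2)) auto
    then show "\<exists>d>0. \<forall>t\<in>{0..T}. \<forall>t'\<in>{0..T}. \<bar>t - t'\<bar> < d \<longrightarrow> (\<forall>x\<in>\<Omega>. \<bar>?K s u (t, x) - ?K s u (t', x)\<bar> \<le> e)"
      using d(1) by blast
  qed
  show ?thesis
  proof
    fix s u assume "0 \<le> (s::real)" "u \<in> C_infty ?E"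
    then show "?K s u \<in> C_infty ?E" by (rule maps')
  next
    fix s a b :: real and u w assume s: "0 \<le> s" and u: "u \<in> C_infty ?E" and w: "w \<in> C_infty ?E"
    show "?K s (\<lambda>x. a * u x + b * w x) = (\<lambda>x. a * ?K s u x + b * ?K s w x)"
    proof (rule ext, clarify)
      fix t x
      show "?K s (\<lambda>x. a * u x + b * w x) (t, x) = a * ?K s u (t, x) + b * ?K s w (t, x)"
        by (cases "t \<in> {0..T}")
           (simp_all only: shift_semigroup_apply shift_semigroup_off lincomb[OF s sl[OF u] sl[OF w]]
              mult_zero_right add_0_left simp_thms)
    qed
  next
    fix u assume u: "u \<in> C_infty ?E"
    have "?K 0 u z = u z" for z
    proof (cases z)
      case (Pair t x)
      have "(\<lambda>y. u (max 0 t, y)) = (\<lambda>y. u (t, y))" if "t \<in> {0..T}" using that by (simp add: max_def)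
      then show ?thesis
        using C_infty_off[OF u, of z] fun_cong[OF at_0[OF sl[OF u, of t]], of x]
        unfolding Pair shift_semigroup_def by auto
    qed
    then show "?K 0 u = u" by blast
  next
    fix r s u assume r: "0 \<le> (r::real)" and s: "0 \<le> (s::real)" and u: "u \<in> C_infty ?E"
    have "?K (r + s) u (t, x) = ?K r (?K s u) (t, x)" for t x
    proof (cases "t \<in> {0..T}")
      case True
      have "?K r (?K s u) (t, x) = P r (\<lambda>y. P s (\<lambda>y. u (max 0 (max 0 (t - r) - s), y)) y) x"
        by (simp only: shift_semigroup_apply[OF True] shift_semigroup_apply[OF mem[OF True r]])
      also have "\<dots> = P r (P s (\<lambda>y. u (max 0 (t - (r + s)), y))) x"
      proof -
        have "max 0 (max 0 (t - r) - s) = max 0 (t - (r + s))" using r s by auto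
        then show ?thesis by simp
      qed
      also have "\<dots> = ?K (r + s) u (t, x)"
        by (simp only: shift_semigroup_apply[OF True] semigroup[OF r s sl[OF u]])
      finally show ?thesis by simp
    qed (simp only: shift_semigroup_off not_False_eq_True)
    then show "?K (r + s) u = ?K r (?K s u)" by auto
  next
    fix s c u z assume s: "0 \<le> (s::real)" and u: "u \<in> C_infty ?E" and c: "\<And>y. \<bar>u y\<bar> \<le> c"
    have "0 \<le> c" using c[of z] by linarith
    then show "\<bar>?K s u z\<bar> \<le> c"
      by (auto simp: shift_semigroup_def split: prod.splits intro!: contraction[OF s sl[OF u]] c)
  next
    fix u and e :: real assume u: "u \<in> C_infty ?E" and e: "e > 0"
    \<comment> \<open>Strong continuity of P holds slice by slice and becomes uniform through a
      finite net of times. Each quarter of e pays for one move: from the shifted slice to that at t,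
      from there to the net point t' under P, the action of P on the slice at t', and the way back
      from t' to t.\<close>
    then have e4: "e / 4 > 0" by simp
    obtain d1 where d1: "d1 > 0" "\<And>t t' x. t \<in> {0..T} \<Longrightarrow> t' \<in> {0..T} \<Longrightarrow> \<bar>t - t'\<bar> < d1 \<Longrightarrow> \<bar>u (t, x) - u (t', x)\<bar> \<le> e / 4"
      using C_infty_uniform_in_time[OF u e4] by blast
    have "seq_compact {0..T}" using compact_Icc compact_imp_seq_compact by blast
    then obtain F where F': "finite F \<and> F \<subseteq> {0..T} \<and> {0..T} \<subseteq> (\<Union>t\<in>F. ball t d1)"
      by (rule exE[OF seq_compact_imp_totally_bounded[THEN spec, THEN mp, OF _ d1(1)]])
  note F = conjunct1[OF F'] conjunct1[OF conjunct2[OF F']] conjunct2[OF conjunct2[OF F']]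
    have "\<exists>d>0. \<forall>s x. 0 \<le> s \<and> s < d \<longrightarrow> \<bar>P s (\<lambda>y. u (t, y)) x - u (t, x)\<bar> \<le> e / 4" for t
      by (rule strong[OF sl[OF u] e4])
    then obtain D where D: "\<And>t. D t > 0"
      "\<And>t s x. 0 \<le> s \<Longrightarrow> s < D t \<Longrightarrow> \<bar>P s (\<lambda>y. u (t, y)) x - u (t, x)\<bar> \<le> e / 4" by metis
    define d where "d = Min (insert d1 (D ` F))"
    have d: "d > 0" "d \<le> d1" "\<And>t. t \<in> F \<Longrightarrow> d \<le> D t" using F(1) D(1) d1(1) by (auto simp: d_def)
    have "\<bar>?K s u (t, x) - u (t, x)\<bar> \<le> e" if s: "0 \<le> s" "s < d" for s t x
    proof (cases "t \<in> {0..T}")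
      case True
      have "t \<in> (\<Union>t\<in>F. ball t d1)" using F(3) True by (rule subsetD)
      then obtain t' where t': "t' \<in> F" "\<bar>t - t'\<bar> < d1"
        by (elim UN_E) (simp add: dist_real_def abs_minus_commute)
      note t' = t' subsetD[OF F(2) t'(1)]
      have "\<bar>P s (\<lambda>y. u (max 0 (t - s), y)) x - P s (\<lambda>y. u (t, y)) x\<bar> \<le> e / 4"
        using mem[OF True s(1)] True s d(2) by (intro diff_bound[OF s(1) sl[OF u] sl[OF u]] d1(2)) auto
      moreover have "\<bar>P s (\<lambda>y. u (t, y)) x - P s (\<lambda>y. u (t', y)) x\<bar> \<le> e / 4"
        by (rule diff_bound[OF s(1) sl[OF u] sl[OF u]], rule d1(2)) (use True t' in auto)
      moreover have "\<bar>P s (\<lambda>y. u (t', y)) x - u (t', x)\<bar> \<le> e / 4"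
        by (rule D(2)) (use s d(3)[OF t'(1)] in auto)
      moreover have "\<bar>u (t, x) - u (t', x)\<bar> \<le> e / 4" by (rule d1(2)) (use True t' in auto)
      ultimately show ?thesis unfolding shift_semigroup_apply[OF True] by linarith
    qed (use e in \<open>auto simp: shift_semigroup_def C_infty_off[OF u]\<close>)
    then show "\<exists>d>0. \<forall>s z. 0 \<le> s \<and> s < d \<longrightarrow> \<bar>?K s u z - u z\<bar> \<le> e"
      using d(1) by (intro exI[of _ d]) auto
  qed
qed

lemma C_infty_constant_in_time:
  fixes v :: "'a::metric_space \<Rightarrow> real" and T :: real
  assumes v: "v \<in> C_infty \<Omega>"
  shows "(\<lambda>(t, x). if t \<in> {0..T} then v x else 0) \<in> C_infty ({0..T} \<times> \<Omega>)"
proof (rule C_infty_glue_slices)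
  fix z assume "z \<notin> {0..T} \<times> \<Omega>"
  then have "\<not> (fst z \<in> {0..T} \<and> snd z \<in> \<Omega>)" by (auto simp: mem_Times_iff)
  then show "(case z of (t, x) \<Rightarrow> if t \<in> {0..T} then v x else 0) = 0"
    using C_infty_off[OF v, of "snd z"] by (auto split: prod.splits)
next
  fix e :: real assume "e > 0"
  then show "\<exists>d>0. \<forall>t\<in>{0..T}. \<forall>t'\<in>{0..T}. \<bar>t - t'\<bar> < d \<longrightarrow> (\<forall>x\<in>\<Omega>.
      \<bar>(case (t, x) of (t, x) \<Rightarrow> if t \<in> {0..T} then v x else 0) -
       (case (t', x) of (t, x) \<Rightarrow> if t \<in> {0..T} then v x else 0)\<bar> \<le> e)"
    by (intro exI[of _ 1]) auto
qed (use v in simp)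

section \<open>Absolute continuity of the law of a subordinator\<close>

text \<open>Under the map sending s to exp (- s) the measures move to [0,1], and the sampled
  transforms become moments. Moments of a measure on [0,1] determine its characteristic function
  through the exponential series, so Levy's uniqueness theorem applies, and - ln transports the
  equality back.\<close>

lemma laplace_transform_unique_prob:
  assumes M: "real_distribution M" "AE s in M. 0 \<le> s"
    and N: "real_distribution N" "AE s in N. 0 \<le> s"
    and eq: "\<And>k::nat. (\<integral>s. exp (- real k * s) \<partial>M) = (\<integral>s. exp (- real k * s) \<partial>N)"
  shows "M = N"
proof -
  \<comment> \<open>\<open>max 0\<close> bounds the map by 1 also at negative s, a null set;
    composing with - ln gives \<open>max 0\<close>, which is almost everywhere the identity.\<close>
  let ?\<phi> = "\<lambda>s::real. exp (- max 0 s)" and ?\<psi> = "\<lambda>y::real. - ln y"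
  have main: "real_distribution (distr R borel ?\<phi>)"
    "\<And>n. integrable (distr R borel ?\<phi>) (\<lambda>y. y ^ n)"
    "\<And>n. (\<integral>y. y ^ n \<partial>distr R borel ?\<phi>) = (\<integral>s. exp (- real n * s) \<partial>R)"
    "\<And>n. (\<integral>y. \<bar>y\<bar> ^ n \<partial>distr R borel ?\<phi>) \<le> 1"
    "distr (distr R borel ?\<phi>) borel ?\<psi> = R"
    if R: "real_distribution R" "AE s in R. 0 \<le> s" for R
  proof -
    interpret real_distribution R by fact
    show rd: "real_distribution (distr R borel ?\<phi>)" by (rule real_distribution_distr) simp
    show "integrable (distr R borel ?\<phi>) (\<lambda>y. y ^ n)" for n
      by (subst integrable_distr_eq) (auto intro!: integrable_const_bound[of _ 1] AE_I2 power_le_one)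
    have "(\<integral>y. y ^ n \<partial>distr R borel ?\<phi>) = (\<integral>s. ?\<phi> s ^ n \<partial>R)" for n
      by (rule integral_distr) auto
    also have "\<dots> n = (\<integral>s. exp (- real n * s) \<partial>R)" for n
      by (rule integral_cong_AE) (use R(2) in \<open>auto simp: max_def exp_of_nat_mult[symmetric] elim!: eventually_mono\<close>)
    finally show "(\<integral>y. y ^ n \<partial>distr R borel ?\<phi>) = (\<integral>s. exp (- real n * s) \<partial>R)" for n .
    have "(\<integral>y. \<bar>y\<bar> ^ n \<partial>distr R borel ?\<phi>) = (\<integral>s. \<bar>?\<phi> s\<bar> ^ n \<partial>R)" for n
      by (rule integral_distr) auto
    also have "\<dots> n \<le> (\<integral>s. 1 \<partial>R)" for n
      by (intro integral_mono integrable_const_bound[of _ 1]) (auto intro!: AE_I2 power_le_one)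
    finally show "(\<integral>y. \<bar>y\<bar> ^ n \<partial>distr R borel ?\<phi>) \<le> 1" for n
      using prob_space by simp
    have "distr (distr R borel ?\<phi>) borel ?\<psi> = distr R borel (\<lambda>s. max 0 s)"
      by (subst distr_distr) (auto simp: o_def)
    also have "\<dots> = distr R borel (\<lambda>s. s)"
      by (rule distr_cong_AE) (use R(2) in \<open>auto elim!: eventually_mono\<close>)
    also have "\<dots> = R" by (rule distr_id2) simp
    finally show "distr (distr R borel ?\<phi>) borel ?\<psi> = R" .
  qed
  define M' where "M' = distr M borel ?\<phi>"
  define N' where "N' = distr N borel ?\<phi>"
  interpret M': real_distribution M' using main(1)[OF M] by (simp add: M'_def)
  interpret N': real_distribution N' using main(1)[OF N] by (simp add: N'_def)
  have mom: "(\<integral>y. y ^ n \<partial>M') = (\<integral>y. y ^ n \<partial>N')" for n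
    by (simp only: M'_def N'_def main(3)[OF M] main(3)[OF N] eq)
  have "char M' t = char N' t" for t
  proof -
    \<comment> \<open>The moments agree, so this one Taylor polynomial approximates both
      characteristic functions.\<close>
    let ?T = "\<lambda>n. \<Sum>k\<le>n. ((\<i> * t) ^ k / fact k) * complex_of_real (\<integral>y. y ^ k \<partial>M')"
    have 1: "cmod (char M' t - ?T n) \<le> 2 * (\<bar>t\<bar> ^ n / fact n)" for n
    proof -
      have "cmod (char M' t - ?T n) \<le> (2 * \<bar>t\<bar> ^ n / fact n) * (\<integral>y. \<bar>y\<bar> ^ n \<partial>M')"
        by (rule M'.char_approx1) (simp add: M'_def main(2)[OF M])
      also have "\<dots> \<le> (2 * \<bar>t\<bar> ^ n / fact n) * 1"
        by (rule mult_left_mono) (auto simp: M'_def main(4)[OF M])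
      finally show ?thesis by simp
    qed
    have 2: "cmod (char N' t - ?T n) \<le> 2 * (\<bar>t\<bar> ^ n / fact n)" for n
    proof -
      have "cmod (char N' t - ?T n) \<le> (2 * \<bar>t\<bar> ^ n / fact n) * (\<integral>y. \<bar>y\<bar> ^ n \<partial>N')"
        unfolding mom by (rule N'.char_approx1) (simp add: N'_def main(2)[OF N])
      also have "\<dots> \<le> (2 * \<bar>t\<bar> ^ n / fact n) * 1"
        by (rule mult_left_mono) (auto simp: N'_def main(4)[OF N])
      finally show ?thesis by simp
    qed
    have "cmod (char M' t - char N' t) \<le> 4 * (\<bar>t\<bar> ^ n / fact n)" for n
    proof -
      have "cmod (char M' t - char N' t) = cmod ((char M' t - ?T n) - (char N' t - ?T n))" by simp
      also have "\<dots> \<le> cmod (char M' t - ?T n) + cmod (char N' t - ?T n)" by (rule norm_triangle_ineq4)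
      also have "\<dots> \<le> 2 * (\<bar>t\<bar> ^ n / fact n) + 2 * (\<bar>t\<bar> ^ n / fact n)" using 1 2 by (rule add_mono)
      finally show ?thesis by simp
    qed
    moreover have "(\<lambda>n. 4 * (\<bar>t\<bar> ^ n / fact n)) \<longlonglongrightarrow> 4 * 0"
      using summable_LIMSEQ_zero[OF summable_exp, of "\<bar>t\<bar>"]
      by (intro tendsto_mult_left) (simp add: divide_inverse mult.commute)
    ultimately have "cmod (char M' t - char N' t) \<le> 0"
      by (intro LIMSEQ_le_const) auto
    then show ?thesis by simp
  qed
  then have "M' = N'" by (intro Levy_uniqueness M'.real_distribution_axioms N'.real_distribution_axioms) auto
  then show "M = N" using main(5)[OF M] main(5)[OF N] by (metis M'_def N'_def)
qed

text \<open>The case k = 0 says that the total masses agree. Dividing by the common mass c reduces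
  to probability measures; for c = 0 both measures vanish.\<close>

lemma laplace_transform_unique:
  assumes M: "finite_measure M" "sets M = sets borel" "AE s in M. 0 \<le> s"
    and N: "finite_measure N" "sets N = sets borel" "AE s in N. 0 \<le> s"
    and eq: "\<And>k::nat. (\<integral>s. exp (- real k * s) \<partial>M) = (\<integral>s. exp (- real k * s) \<partial>N)"
  shows "M = N"
proof -
  interpret M: finite_measure M by fact
  interpret N: finite_measure N by fact
  have sp: "space M = UNIV" "space N = UNIV" using M(2) N(2) by (metis sets_eq_imp_space_eq space_borel)+
  define c where "c = measure M UNIV"
  have c: "measure N UNIV = c" using eq[of 0] by (simp add: c_def sp)
  show ?thesis
  proof (cases "c = 0")
    case True
    show ?thesis
    proof (rule measure_eqI)
      fix A assume "A \<in> sets M"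
      have "emeasure M A \<le> emeasure M UNIV" "emeasure N A \<le> emeasure N UNIV"
        using M(2) N(2) by (auto intro!: emeasure_mono)
      then show "emeasure M A = emeasure N A"
        using True c by (simp add: M.emeasure_eq_measure N.emeasure_eq_measure c_def measure_le_0_iff)
    qed (simp add: M N)
  next
    case False
    then have c0: "c > 0" using measure_nonneg[of M UNIV] unfolding c_def by linarith
    have fac: "real_distribution (density R (\<lambda>_. ennreal (1 / c)))" "AE s in density R (\<lambda>_. ennreal (1 / c)). 0 \<le> s"
      "(\<integral>s. f s \<partial>density R (\<lambda>_. ennreal (1 / c))) = (1 / c) * (\<integral>s. f s \<partial>R)"
      "A \<in> sets borel \<Longrightarrow> emeasure R A = ennreal c * emeasure (density R (\<lambda>_. ennreal (1 / c))) A"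
      if R: "finite_measure R" "sets R = sets borel" "AE s in R. 0 \<le> s" "measure R UNIV = c"
        and f: "f \<in> borel_measurable borel" for R and f :: "real \<Rightarrow> real" and A
    proof -
      interpret finite_measure R by fact
      have spR: "space R = UNIV" using R(2) by (metis sets_eq_imp_space_eq space_borel)
      have em: "emeasure (density R (\<lambda>_. ennreal (1 / c))) A = ennreal (1 / c) * emeasure R A" if "A \<in> sets borel" for A
        using that R(2) by (simp add: emeasure_density nn_integral_cmult_indicator)
      have "emeasure (density R (\<lambda>_. ennreal (1 / c))) UNIV = 1"
        using em[of UNIV] c0 by (simp add: emeasure_eq_measure R(4) ennreal_mult[symmetric])
      then show "real_distribution (density R (\<lambda>_. ennreal (1 / c)))"
        using R(2) by (auto simp: real_distribution_def real_distribution_axioms_def spR intro!: prob_spaceI)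
      show "AE s in density R (\<lambda>_. ennreal (1 / c)). 0 \<le> s"
        using R(3) by (subst AE_density) (auto elim!: eventually_mono)
      show "(\<integral>s. f s \<partial>density R (\<lambda>_. ennreal (1 / c))) = (1 / c) * (\<integral>s. f s \<partial>R)"
        using c0 f by (subst integral_density) (auto simp: measurable_cong_sets[OF R(2) refl])
      show "emeasure R A = ennreal c * emeasure (density R (\<lambda>_. ennreal (1 / c))) A" if "A \<in> sets borel"
        using em[OF that] c0 by (simp add: mult.assoc[symmetric] ennreal_mult[symmetric])
    qed
    have "density M (\<lambda>_. ennreal (1 / c)) = density N (\<lambda>_. ennreal (1 / c))"
    proof (rule laplace_transform_unique_prob)
      show "(\<integral>s. exp (- real k * s) \<partial>density M (\<lambda>_. ennreal (1 / c))) =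
          (\<integral>s. exp (- real k * s) \<partial>density N (\<lambda>_. ennreal (1 / c)))" for k :: nat
      proof -
        have "(\<lambda>s. exp (- real k * s)) \<in> borel_measurable borel" by measurable
        then show ?thesis by (simp only: fac(3)[OF M c_def[symmetric]] fac(3)[OF N c] eq)
      qed
    qed (use fac(1,2)[OF M _ borel_measurable_const] fac(1,2)[OF N _ borel_measurable_const] c c_def in auto)
    then show ?thesis
      using fac(4)[OF M _ borel_measurable_const] fac(4)[OF N _ borel_measurable_const] c
      by (intro measure_eqI) (auto simp: M N c_def)
  qed
qed

section \<open>Integrability and differentiation of Laplace exponents\<close>

text \<open>For s \<le> 1 the bound is s itself; for s > 1 the inequality k s \<le> exp (k s) gives
  1/k.\<close>

lemma mult_exp_le_min:
  fixes s k :: real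
  assumes "0 \<le> s" "0 < k"
  shows "s * exp (- k * s) \<le> max 1 (1 / k) * min s 1"
proof (cases "s \<le> 1")
  case True
  have "s * exp (- k * s) \<le> s * 1" using assms by (intro mult_left_mono) auto
  also have "\<dots> \<le> max 1 (1 / k) * s" using mult_right_mono[of 1 "max 1 (1 / k)" s] assms by simp
  finally show ?thesis using True by simp
next
  case False
  have "k * s \<le> exp (k * s)" using exp_ge_add_one_self[of "k * s"] by linarith
  then have "s * exp (- k * s) \<le> 1 / k" using assms by (simp add: exp_minus field_simps)
  then show ?thesis using False by simp
qed

lemma one_minus_exp_le_min:
  fixes s k :: real
  assumes "0 \<le> s" "0 < k"
  shows "1 - exp (- k * s) \<le> max 1 k * min s 1"
proof (cases "s \<le> 1")
  case True
  have "1 - exp (- k * s) \<le> k * s" using exp_ge_add_one_self[of "- k * s"] by simp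
  also have "\<dots> \<le> max 1 k * s" using assms by (intro mult_right_mono) auto
  finally show ?thesis using True by simp
next
  case False
  have "1 - exp (- k * s) \<le> 1" by simp
  also have "1 \<le> max 1 k" by simp
  finally show ?thesis using False by simp
qed

text \<open>Integrability of min s 1 is what (H0) grants to a Levy measure, and it is trivial for a
  probability law. Stating the results for a general m covers both.\<close>

lemma
  assumes [measurable_cong]: "sets m = sets borel" and pos: "AE s in m. 0 \<le> (s::real)"
    and int: "integrable m (\<lambda>s. min s 1)" and k: "0 < (k::real)"
  shows integrable_mult_exp: "integrable m (\<lambda>s. s * exp (- k * s))"
    and integrable_one_minus_exp: "integrable m (\<lambda>s. 1 - exp (- k * s))"
proof -
  show "integrable m (\<lambda>s. s * exp (- k * s))"
  proof (rule Bochner_Integration.integrable_bound[OF integrable_mult_right[OF int, of "max 1 (1 / k)"]])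
    show "AE s in m. norm (s * exp (- k * s)) \<le> norm (max 1 (1 / k) * min s 1)"
      using pos by (rule eventually_mono) (use mult_exp_le_min[OF _ k] in \<open>auto simp: abs_mult\<close>)
  qed measurable
  show "integrable m (\<lambda>s. 1 - exp (- k * s))"
  proof (rule Bochner_Integration.integrable_bound[OF integrable_mult_right[OF int, of "max 1 k"]])
    show "AE s in m. norm (1 - exp (- k * s)) \<le> norm (max 1 k * min s 1)"
      using pos by (rule eventually_mono) (use one_minus_exp_le_min[OF _ k] k in \<open>auto simp: abs_mult\<close>)
  qed measurable
qed

text \<open>Differentiation under the integral along the steps 1/(n+1), dominated by s exp (- k s)
  because 1 - exp (- s h) \<le> s h. Working with 1 - exp instead of exp keeps the integrand
  integrable for an infinite measure; the lemma is applied to the law of S r and to the Levy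
  measure.\<close>

lemma laplace_exponent_difference_quotient:
  assumes m [measurable_cong]: "sets m = sets borel" and pos: "AE s in m. 0 \<le> (s::real)"
    and int: "integrable m (\<lambda>s. min s 1)" and k: "0 < (k::real)"
  shows "(\<lambda>n. real (Suc n) * ((\<integral>s. 1 - exp (- (k + 1 / real (Suc n)) * s) \<partial>m) - (\<integral>s. 1 - exp (- k * s) \<partial>m)))
    \<longlonglongrightarrow> (\<integral>s. s * exp (- k * s) \<partial>m)"
proof -
  let ?f = "\<lambda>n s. exp (- k * s) * (real (Suc n) * (1 - exp (- s / real (Suc n))))"
  have kn: "0 < k + 1 / real (Suc n)" for n using k by (simp add: add_pos_nonneg)
  have "real (Suc n) * ((\<integral>s. 1 - exp (- (k + 1 / real (Suc n)) * s) \<partial>m) - (\<integral>s. 1 - exp (- k * s) \<partial>m))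
      = (\<integral>s. ?f n s \<partial>m)" for n
  proof -
    have "real (Suc n) * ((\<integral>s. 1 - exp (- (k + 1 / real (Suc n)) * s) \<partial>m) - (\<integral>s. 1 - exp (- k * s) \<partial>m))
        = (\<integral>s. real (Suc n) * ((1 - exp (- (k + 1 / real (Suc n)) * s)) - (1 - exp (- k * s))) \<partial>m)"
      by (simp only: integral_mult_right_zero Bochner_Integration.integral_diff[OF
            integrable_one_minus_exp[OF m pos int kn[of n]] integrable_one_minus_exp[OF m pos int k]])
    also have "\<dots> = (\<integral>s. ?f n s \<partial>m)"
    proof (rule Bochner_Integration.integral_cong[OF refl])
      fix s :: real
      have "- (k + 1 / real (Suc n)) * s = - k * s + - s / real (Suc n)" by (simp add: field_simps)
      then show "real (Suc n) * ((1 - exp (- (k + 1 / real (Suc n)) * s)) - (1 - exp (- k * s))) = ?f n s"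
        by (simp only: exp_add) (simp add: algebra_simps)
    qed
    finally show ?thesis .
  qed
  moreover have "(\<lambda>n. \<integral>s. ?f n s \<partial>m) \<longlonglongrightarrow> (\<integral>s. s * exp (- k * s) \<partial>m)"
  proof (rule integral_dominated_convergence[where w = "\<lambda>s. s * exp (- k * s)"])
    show "integrable m (\<lambda>s. s * exp (- k * s))" by (rule integrable_mult_exp[OF m pos int k])
    show "AE s in m. (\<lambda>n. ?f n s) \<longlonglongrightarrow> s * exp (- k * s)"
    proof (rule AE_I2)
      fix s :: real
      have "((\<lambda>x. 1 - exp (- s * x)) has_real_derivative s) (at 0)"
        by (auto intro!: derivative_eq_intros)
      then have "((\<lambda>h. (1 - exp (- s * h)) / h) \<longlongrightarrow> s) (at 0)"
        by (auto dest: DERIV_D)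
      moreover have "filterlim (\<lambda>n. 1 / real (Suc n)) (at 0) sequentially"
        using LIMSEQ_Suc[OF lim_1_over_n] by (auto simp: filterlim_at)
      ultimately have "(\<lambda>n. (1 - exp (- s * (1 / real (Suc n)))) / (1 / real (Suc n))) \<longlonglongrightarrow> s"
        by (rule filterlim_compose)
      then have "(\<lambda>n. real (Suc n) * (1 - exp (- s / real (Suc n)))) \<longlonglongrightarrow> s"
        by (simp add: mult.commute del: of_nat_Suc)
      from tendsto_mult_left[OF this, of "exp (- k * s)"]
      show "(\<lambda>n. ?f n s) \<longlonglongrightarrow> s * exp (- k * s)" by (simp add: mult.commute)
    qed
    show "AE s in m. norm (?f n s) \<le> s * exp (- k * s)" for n
      using pos
    proof (rule eventually_mono)
      fix s :: real assume s: "0 \<le> s"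
      have "real (Suc n) * (1 - exp (- s / real (Suc n))) \<le> real (Suc n) * (s / real (Suc n))"
        using exp_ge_add_one_self[of "- s / real (Suc n)"] by (intro mult_left_mono) linarith+
      then have "real (Suc n) * (1 - exp (- s / real (Suc n))) \<le> s" by simp
      moreover have "0 \<le> real (Suc n) * (1 - exp (- s / real (Suc n)))" using s by simp
      ultimately show "norm (?f n s) \<le> s * exp (- k * s)"
        by (simp add: abs_mult mult.commute mult_right_mono del: of_nat_Suc)
    qed
  qed measurable
  ultimately show ?thesis by simp
qed

text \<open>Chain rule for exp along a sequence. The Caratheodory form of the derivative avoids
  dividing by a n - l, which may be 0.\<close>

lemma exp_difference_quotient:
  fixes a :: "nat \<Rightarrow> real"
  assumes d: "(\<lambda>n. c n * (a n - l)) \<longlonglongrightarrow> d" and c: "(\<lambda>n. inverse (c n)) \<longlonglongrightarrow> 0" "\<And>n. c n \<noteq> 0"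
  shows "(\<lambda>n. c n * (exp (a n) - exp l)) \<longlonglongrightarrow> exp l * d"
proof -
  have "DERIV exp l :> exp l" by (rule DERIV_exp)
  then obtain g where g: "\<And>z. exp z - exp l = g z * (z - l)" "isCont g l" "g l = exp l"
    unfolding CARAT_DERIV by blast
  have "(\<lambda>n. inverse (c n) * (c n * (a n - l)) + l) \<longlonglongrightarrow> 0 * d + l"
    by (intro tendsto_add tendsto_mult c d tendsto_const)
  then have "a \<longlonglongrightarrow> l" using c(2) by (simp add: mult.assoc[symmetric])
  then have "(\<lambda>n. g (a n)) \<longlonglongrightarrow> exp l" using g(2,3) isCont_tendsto_compose by metis
  from tendsto_mult[OF this d] show ?thesis by (simp add: g(1) algebra_simps)
qed

section \<open>The Levy measure and its Laplace exponent\<close>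

definition levy_measure :: "(real \<Rightarrow> real) \<Rightarrow> real measure" where
  "levy_measure \<nu> = density lborel (\<lambda>s. ennreal (indicator {0<..} s * \<nu> s))"

text \<open>The Bernstein function of the subordinator, with the sign for which the Laplace
  transform of S r is exp (- r * \<open>laplace_exponent \<nu> k\<close>).\<close>

definition laplace_exponent :: "(real \<Rightarrow> real) \<Rightarrow> real \<Rightarrow> real" where
  "laplace_exponent \<nu> k = (\<integral>s. 1 - exp (- k * s) \<partial>levy_measure \<nu>)"

context
  fixes \<nu> :: "real \<Rightarrow> real"
  assumes H0: "H0 \<nu>"
begin

lemma levy_density_measurable [measurable]: "(\<lambda>s. indicator {0<..} s * \<nu> s) \<in> borel_measurable borel"
  using H0 borel_measurable_continuous_on_indicator[of "{0<..}" \<nu>] by (auto simp: H0_def)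

lemma levy_density_ennreal_measurable: "(\<lambda>s. ennreal (indicator {0<..} s * \<nu> s)) \<in> borel_measurable lborel"
  by measurable

lemma levy_density_nonneg: "0 \<le> indicator {0<..} s * \<nu> s"
  using H0 by (auto simp: H0_def indicator_def)

lemma sets_levy_measure [measurable_cong]: "sets (levy_measure \<nu>) = sets borel"
  by (simp add: levy_measure_def)

lemma AE_levy_measure: "AE s in levy_measure \<nu>. 0 < s"
  unfolding levy_measure_def AE_density[OF levy_density_ennreal_measurable] by (auto simp: indicator_def)

lemma nn_integral_levy_measure:
  "f \<in> borel_measurable borel \<Longrightarrow>
    (\<integral>\<^sup>+s. f s \<partial>levy_measure \<nu>) = (\<integral>\<^sup>+s. ennreal (indicator {0<..} s * \<nu> s) * f s \<partial>lborel)"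
  unfolding levy_measure_def by (rule nn_integral_density) auto

lemma integral_levy_measure:
  fixes f :: "real \<Rightarrow> real"
  shows "f \<in> borel_measurable borel \<Longrightarrow>
    (\<integral>s. f s \<partial>levy_measure \<nu>) = (\<integral>s. indicator {0<..} s * \<nu> s * f s \<partial>lborel)"
  unfolding levy_measure_def by (subst integral_density) (auto simp: levy_density_nonneg)

lemma integrable_min_levy_measure: "integrable (levy_measure \<nu>) (\<lambda>s. min s 1)"
proof (rule integrableI_nonneg)
  show "AE s in levy_measure \<nu>. 0 \<le> min s 1" using AE_levy_measure by (auto elim!: eventually_mono)
  have "(\<integral>\<^sup>+s. ennreal (min s 1) \<partial>levy_measure \<nu>)
      = (\<integral>\<^sup>+s. ennreal (min s 1 * \<nu> s) * indicator {0<..} s \<partial>lborel)"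
    using H0 by (subst nn_integral_levy_measure)
      (auto simp: H0_def indicator_def ennreal_mult[symmetric] mult.commute intro!: nn_integral_cong)
  also have "\<dots> < \<infinity>" using H0 by (simp add: H0_def)
  finally show "(\<integral>\<^sup>+s. ennreal (min s 1) \<partial>levy_measure \<nu>) < \<infinity>" .
qed measurable

lemma emeasure_levy_measure: "emeasure (levy_measure \<nu>) UNIV = \<infinity>"
proof -
  have "emeasure (levy_measure \<nu>) UNIV = (\<integral>\<^sup>+s. ennreal (\<nu> s) * indicator {0<..} s \<partial>lborel)"
    unfolding levy_measure_def
    by (subst emeasure_density[OF levy_density_ennreal_measurable])
      (auto simp: indicator_def intro!: nn_integral_cong)
  then show ?thesis using H0 by (simp add: H0_def)
qed

lemma AE_levy_nonneg: "AE s in levy_measure \<nu>. 0 \<le> s"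
  using AE_levy_measure by (rule eventually_mono) simp

lemma laplace_exponent_eq:
  "0 < k \<Longrightarrow> (LINT s:{0<..}|lborel. (exp (- k * s) - 1) * \<nu> s) = - laplace_exponent \<nu> k"
  unfolding laplace_exponent_def set_lebesgue_integral_def
  by (subst integral_levy_measure, measurable)
     (auto simp: algebra_simps simp flip: Bochner_Integration.integral_minus intro!: Bochner_Integration.integral_cong)

text \<open>The integrand is positive and the Levy measure is not zero, its total mass being
  infinite. Positivity is the source of the exponential decay in r of the probability that S r \<le>
  t.\<close>

lemma laplace_exponent_pos:
  assumes k: "0 < k"
  shows "0 < laplace_exponent \<nu> k"
proof -
  have int: "integrable (levy_measure \<nu>) (\<lambda>s. 1 - exp (- k * s))"
    by (rule integrable_one_minus_exp[OF sets_levy_measure AE_levy_nonneg integrable_min_levy_measure k])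
  have nn: "AE s in levy_measure \<nu>. 0 \<le> 1 - exp (- k * s)"
    using AE_levy_measure by (rule eventually_mono) (use k in simp)
  have "laplace_exponent \<nu> k \<noteq> 0"
  proof
    assume "laplace_exponent \<nu> k = 0"
    then have "AE s in levy_measure \<nu>. 1 - exp (- k * s) = 0"
      unfolding laplace_exponent_def using integral_nonneg_eq_0_iff_AE[OF int nn] by simp
    then have "AE s in levy_measure \<nu>. False"
      using AE_levy_measure by eventually_elim (use k in auto)
    then have "emeasure (levy_measure \<nu>) (space (levy_measure \<nu>)) = 0"
      by (subst (asm) AE_iff_measurable[OF _ refl]) auto
    moreover have "space (levy_measure \<nu>) = UNIV" by (simp add: levy_measure_def)
    ultimately show False by (simp add: emeasure_levy_measure)
  qed
  moreover have "0 \<le> laplace_exponent \<nu> k"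
    unfolding laplace_exponent_def by (rule integral_nonneg_AE[OF nn])
  ultimately show ?thesis by simp
qed

text \<open>By Fatou's lemma a bound on the exponents would bound the total mass of the Levy
  measure, which (H0) makes infinite. This excludes an atom at 0 in the law of S r.\<close>

lemma laplace_exponent_unbounded: "\<exists>n::nat. 0 < n \<and> c < laplace_exponent \<nu> (real n)"
proof (rule ccontr)
  assume "\<not> ?thesis"
  then have b: "laplace_exponent \<nu> (real (Suc n)) \<le> c" for n by (auto simp: not_less)
  have nn: "AE s in levy_measure \<nu>. 0 \<le> 1 - exp (- real (Suc n) * s)" for n
    using AE_levy_measure by (rule eventually_mono) (simp del: of_nat_Suc)
  have "(\<integral>\<^sup>+s. ennreal (1 - exp (- real (Suc n) * s)) \<partial>levy_measure \<nu>) \<le> ennreal c" for n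
  proof -
    have "(\<integral>\<^sup>+s. ennreal (1 - exp (- real (Suc n) * s)) \<partial>levy_measure \<nu>) = ennreal (laplace_exponent \<nu> (real (Suc n)))"
      unfolding laplace_exponent_def
      by (rule nn_integral_eq_integral[OF _ nn], rule integrable_one_minus_exp[OF sets_levy_measure AE_levy_nonneg integrable_min_levy_measure]) simp
    then show ?thesis using b[of n] by (simp add: ennreal_leI)
  qed
  then have "liminf (\<lambda>n. \<integral>\<^sup>+s. ennreal (1 - exp (- real (Suc n) * s)) \<partial>levy_measure \<nu>) \<le> ennreal c"
    by (intro Liminf_le) (auto intro!: always_eventually)
  moreover have "(\<integral>\<^sup>+s. liminf (\<lambda>n. ennreal (1 - exp (- real (Suc n) * s))) \<partial>levy_measure \<nu>)
      \<le> liminf (\<lambda>n. \<integral>\<^sup>+s. ennreal (1 - exp (- real (Suc n) * s)) \<partial>levy_measure \<nu>)"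
    by (rule nn_integral_liminf) measurable
  moreover have "(\<integral>\<^sup>+s. liminf (\<lambda>n. ennreal (1 - exp (- real (Suc n) * s))) \<partial>levy_measure \<nu>) = (\<integral>\<^sup>+s. 1 \<partial>levy_measure \<nu>)"
  proof (rule nn_integral_cong_AE, rule eventually_mono[OF AE_levy_measure])
    fix s :: real assume s: "0 < s"
    have "(\<lambda>n. exp (- s) ^ Suc n) \<longlonglongrightarrow> 0"
      by (rule LIMSEQ_Suc[OF LIMSEQ_realpow_zero]) (use s in auto)
    then have "(\<lambda>n. exp (- real (Suc n) * s)) \<longlonglongrightarrow> 0"
      by (simp only: exp_of_nat_mult[symmetric]) (simp add: algebra_simps)
    then have "(\<lambda>n. ennreal (1 - exp (- real (Suc n) * s))) \<longlonglongrightarrow> ennreal (1 - 0)"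
      by (intro tendsto_ennrealI tendsto_diff tendsto_const)
    then show "liminf (\<lambda>n. ennreal (1 - exp (- real (Suc n) * s))) = 1"
      using lim_imp_Liminf[OF sequentially_bot] by fastforce
  qed
  moreover have "space (levy_measure \<nu>) = UNIV" by (simp add: levy_measure_def)
  ultimately have "\<infinity> \<le> ennreal c" using emeasure_levy_measure by simp
  then show False by (simp add: top_unique)
qed

text \<open>Differentiating the Laplace transform \<open>exp (- r * laplace_exponent \<nu> k)\<close> in \<open>k\<close> shows that
  \<open>s \<mu>(ds)\<close> is the convolution of \<open>r s \<nu>(s) ds\<close> with \<open>\<mu>\<close>, hence absolutely continuous.\<close>

lemma absolutely_continuous_of_laplace_exponent:
  assumes \<mu>: "real_distribution \<mu>" and pos: "AE s in \<mu>. 0 \<le> s" and r: "0 < r"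
    and L: "\<And>k. 0 < k \<Longrightarrow> (\<integral>s. exp (- k * s) \<partial>\<mu>) = exp (- r * laplace_exponent \<nu> k)"
  shows "absolutely_continuous lborel \<mu>"
proof -
  interpret real_distribution \<mu> by fact
  note V = sets_levy_measure AE_levy_nonneg integrable_min_levy_measure
  note [measurable_cong] = sets_levy_measure
  have exp_le: "AE s in \<mu>. norm (exp (- k * s)) \<le> 1" if "0 \<le> k" for k
    using pos by (rule eventually_mono) (use that in simp)
  have int_exp: "integrable \<mu> (\<lambda>s. exp (- k * s))" if "0 \<le> k" for k
    by (rule integrable_const_bound[OF exp_le[OF that]]) measurable
  \<comment> \<open>The measure s \<mu>(ds) does not see the point 0, so an atom there is excluded
    separately: \<mu> {0} is at most the Laplace transform at n, which falls below \<mu> {0} once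
    the exponent exceeds - ln (\<mu> {0}) / r.\<close>
  have zero: "measure \<mu> {0} = 0"
  proof (rule ccontr)
    assume "measure \<mu> {0} \<noteq> 0"
    then have q: "0 < measure \<mu> {0}" using measure_nonneg[of \<mu> "{0}"] by linarith
    obtain n where n: "0 < n" "- ln (measure \<mu> {0}) / r < laplace_exponent \<nu> (real n)"
      using laplace_exponent_unbounded by blast
    have "measure \<mu> {0} = (\<integral>s. indicator {0} s \<partial>\<mu>)" by simp
    also have "\<dots> \<le> (\<integral>s. exp (- real n * s) \<partial>\<mu>)"
      by (intro integral_mono int_exp integrable_real_indicator)
         (auto simp: less_top[symmetric] split: split_indicator)
    also have "\<dots> = exp (- r * laplace_exponent \<nu> (real n))" using n by (intro L) simp
    also have "\<dots> < exp (ln (measure \<mu> {0}))" using n(2) r by (simp add: field_simps)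
    finally show False using q by simp
  qed
  have int_min: "integrable \<mu> (\<lambda>s. min s 1)"
    by (rule integrable_const_bound[of _ 1]) (use pos in \<open>auto elim!: eventually_mono\<close>)
  \<comment> \<open>The same difference quotients are computed twice: as an integral of 1 - exp (- k
    s) against \<mu>, and through the chain rule for exp (- r \<psi>).\<close>
  have deriv: "(\<integral>s. s * exp (- k * s) \<partial>\<mu>)
      = r * (\<integral>s. s * exp (- k * s) \<partial>levy_measure \<nu>) * (\<integral>s. exp (- k * s) \<partial>\<mu>)" if k: "0 < k" for k
  proof -
    have one: "(\<integral>s. 1 - exp (- k * s) \<partial>\<mu>) = 1 - exp (- r * laplace_exponent \<nu> k)" if "0 < k" for k
      using int_exp[of k] L[OF that] that prob_space by simp
    have kn: "0 < k + 1 / real (Suc n)" for n using k by (simp add: add_pos_nonneg)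
    let ?\<psi> = "laplace_exponent \<nu>"
    have "(\<lambda>n. real (Suc n) * ((1 - exp (- r * ?\<psi> (k + 1 / real (Suc n)))) - (1 - exp (- r * ?\<psi> k))))
        \<longlonglongrightarrow> (\<integral>s. s * exp (- k * s) \<partial>\<mu>)"
      using laplace_exponent_difference_quotient[OF events_eq_borel pos int_min k]
      unfolding one[OF k] one[OF kn] .
    moreover have "(\<lambda>n. real (Suc n) * (exp (- r * ?\<psi> (k + 1 / real (Suc n))) - exp (- r * ?\<psi> k)))
        \<longlonglongrightarrow> exp (- r * ?\<psi> k) * (- r * (\<integral>s. s * exp (- k * s) \<partial>levy_measure \<nu>))"
    proof (rule exp_difference_quotient)
      have "(\<lambda>n. - r * (real (Suc n) * (?\<psi> (k + 1 / real (Suc n)) - ?\<psi> k)))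
          \<longlonglongrightarrow> - r * (\<integral>s. s * exp (- k * s) \<partial>levy_measure \<nu>)"
        using laplace_exponent_difference_quotient[OF V k]
        unfolding laplace_exponent_def[symmetric] by (intro tendsto_mult_left)
      then show "(\<lambda>n. real (Suc n) * (- r * ?\<psi> (k + 1 / real (Suc n)) - - r * ?\<psi> k))
          \<longlonglongrightarrow> - r * (\<integral>s. s * exp (- k * s) \<partial>levy_measure \<nu>)"
        by (simp add: algebra_simps)
      show "(\<lambda>n. inverse (real (Suc n))) \<longlonglongrightarrow> 0" by (rule LIMSEQ_inverse_real_of_nat)
    qed auto
    from tendsto_minus[OF this]
    have "(\<lambda>n. real (Suc n) * ((1 - exp (- r * ?\<psi> (k + 1 / real (Suc n)))) - (1 - exp (- r * ?\<psi> k))))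
        \<longlonglongrightarrow> r * (\<integral>s. s * exp (- k * s) \<partial>levy_measure \<nu>) * exp (- r * ?\<psi> k)"
      by (simp add: algebra_simps)
    ultimately show ?thesis unfolding L[OF k] by (rule LIMSEQ_unique)
  qed
  \<comment> \<open>All measures are tilted by exp (- s), which makes s \<mu>(ds) and r s \<nu>(s)
    ds finite and is multiplicative under convolution. The tilted transform at k is the original one
    at k + 1, so only positive arguments of \<open>deriv\<close> occur.\<close>
  let ?w = "\<lambda>s. indicator {0<..} s * \<nu> s * (r * (s * exp (- s)))"
  have w_nn: "0 \<le> ?w s" for s
    using levy_density_nonneg[of s] r by (cases "0 < s") (auto simp: indicator_def)
  define m1 where "m1 = density \<mu> (\<lambda>s. ennreal (s * exp (- s)))"
  define W where "W = density lborel (\<lambda>s. ennreal (?w s))"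
  define U where "U = density \<mu> (\<lambda>s. ennreal (exp (- s)))"
  define m2 where "m2 = distr (W \<Otimes>\<^sub>M U) borel (\<lambda>(a, b). a + b)"
  have [measurable_cong]: "sets W = sets borel" "sets U = sets borel" "sets m1 = sets borel" "sets m2 = sets borel"
    by (auto simp: W_def U_def m1_def m2_def)
  have posm: "AE s in \<mu>. 0 \<le> s * exp (- s)" using pos by (rule eventually_mono) simp
  have intW: "integrable lborel ?w"
  proof -
    have "integrable (levy_measure \<nu>) (\<lambda>s. s * exp (- 1 * s))" by (rule integrable_mult_exp[OF V]) simp
    then have "integrable lborel (\<lambda>s. (indicator {0<..} s * \<nu> s) *\<^sub>R (s * exp (- 1 * s)))"
      unfolding levy_measure_def by (subst (asm) integrable_density) (auto simp: levy_density_nonneg)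
    then have "integrable lborel (\<lambda>s. r * ((indicator {0<..} s * \<nu> s) *\<^sub>R (s * exp (- 1 * s))))"
      by (rule integrable_mult_right)
    then show ?thesis by (simp add: algebra_simps)
  qed
  have "emeasure W UNIV = ennreal (\<integral>s. ?w s \<partial>lborel)"
    unfolding W_def by (subst emeasure_density) (auto intro!: nn_integral_eq_integral intW w_nn)
  then have fW: "finite_measure W" by (intro finite_measureI) (simp add: W_def)
  have "emeasure U UNIV = ennreal (\<integral>s. exp (- 1 * s) \<partial>\<mu>)"
    unfolding U_def using int_exp[of 1] by (subst emeasure_density) (auto intro!: nn_integral_eq_integral)
  then have fU: "finite_measure U" by (intro finite_measureI) (simp add: U_def)
  have int_m1: "integrable \<mu> (\<lambda>s. s * exp (- 1 * s))"
    by (rule integrable_mult_exp[OF events_eq_borel pos int_min]) simp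
  have "emeasure m1 UNIV = ennreal (\<integral>s. s * exp (- 1 * s) \<partial>\<mu>)"
    unfolding m1_def using int_m1 posm by (subst emeasure_density) (auto intro!: nn_integral_eq_integral)
  then have fm1: "finite_measure m1" by (intro finite_measureI) (simp add: m1_def)
  interpret W: finite_measure W by fact
  interpret U: finite_measure U by fact
  interpret WU: pair_sigma_finite W U ..
  interpret P: finite_measure "W \<Otimes>\<^sub>M U" by (rule finite_measure_pair_measure) fact+
  have fm2: "finite_measure m2" unfolding m2_def by (rule P.finite_measure_distr) measurable
  have posW: "AE s in W. 0 \<le> s"
    unfolding W_def by (subst AE_density, measurable) (auto simp: indicator_def)
  have posU: "AE s in U. 0 \<le> s"
    unfolding U_def using pos by (subst AE_density) auto
  have AEW: "AE p in W \<Otimes>\<^sub>M U. 0 \<le> fst p \<and> 0 \<le> snd p"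
  proof (rule WU.AE_pair_measure)
    show "{x \<in> space (W \<Otimes>\<^sub>M U). 0 \<le> fst x \<and> 0 \<le> snd x} \<in> sets (W \<Otimes>\<^sub>M U)" by measurable
    show "AE x in W. AE y in U. 0 \<le> fst (x, y) \<and> 0 \<le> snd (x, y)"
      using posW by (rule eventually_mono) (use posU in \<open>auto elim!: eventually_mono\<close>)
  qed
  have "m1 = m2"
  proof (rule laplace_transform_unique)
    show "AE s in m1. 0 \<le> s" unfolding m1_def using pos by (subst AE_density) auto
    have "AE p in W \<Otimes>\<^sub>M U. 0 \<le> (case p of (a, b) \<Rightarrow> a + b)"
      using AEW by (rule eventually_mono) (auto simp: case_prod_beta)
    then show "AE s in m2. 0 \<le> s" unfolding m2_def by (subst AE_distr_iff) auto
    fix k :: nat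
    have k1: "0 < real k + 1" by simp
    have e1: "exp (- (real k + 1) * s) = exp (- s) * exp (- real k * s)" for s :: real
      by (simp add: exp_add[symmetric] algebra_simps)
    have "(\<integral>s. exp (- real k * s) \<partial>m1) = (\<integral>s. s * exp (- (real k + 1) * s) \<partial>\<mu>)"
      unfolding m1_def e1 using posm by (subst integral_density) (auto simp: mult.assoc)
    also have "\<dots> = r * (\<integral>s. s * exp (- (real k + 1) * s) \<partial>levy_measure \<nu>) * (\<integral>s. exp (- (real k + 1) * s) \<partial>\<mu>)"
      by (rule deriv[OF k1])
    also have "r * (\<integral>s. s * exp (- (real k + 1) * s) \<partial>levy_measure \<nu>) = (\<integral>s. exp (- real k * s) \<partial>W)"
    proof -
      have "(\<integral>s. exp (- real k * s) \<partial>W) = (\<integral>s. ?w s * exp (- real k * s) \<partial>lborel)"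
        unfolding W_def using w_nn by (subst integral_density) auto
      also have "\<dots> = (\<integral>s. r * (indicator {0<..} s * \<nu> s * (s * exp (- (real k + 1) * s))) \<partial>lborel)"
        by (rule Bochner_Integration.integral_cong[OF refl]) (simp only: e1, simp add: algebra_simps)
      finally show ?thesis by (subst integral_levy_measure) auto
    qed
    also have "(\<integral>s. exp (- (real k + 1) * s) \<partial>\<mu>) = (\<integral>s. exp (- real k * s) \<partial>U)"
      unfolding U_def e1 by (subst integral_density) auto
    also have "(\<integral>s. exp (- real k * s) \<partial>W) * (\<integral>s. exp (- real k * s) \<partial>U)
        = (\<integral>a. (\<integral>b. exp (- real k * (a + b)) \<partial>U) \<partial>W)"
      by (simp add: distrib_left exp_add exp_diff mult.commute flip: integral_mult_right_zero integral_mult_left_zero)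
         (simp add: exp_minus divide_inverse)
    also have "\<dots> = (\<integral>p. exp (- real k * (fst p + snd p)) \<partial>(W \<Otimes>\<^sub>M U))"
    proof -
      have "integrable (W \<Otimes>\<^sub>M U) (\<lambda>p. exp (- real k * (fst p + snd p)))"
      proof (rule P.integrable_const_bound[of _ 1])
        show "AE p in W \<Otimes>\<^sub>M U. norm (exp (- real k * (fst p + snd p))) \<le> 1"
          using AEW by (rule eventually_mono) simp
      qed measurable
      from WU.integral_fst'[OF this] show ?thesis by simp
    qed
    also have "\<dots> = (\<integral>s. exp (- real k * s) \<partial>m2)"
      unfolding m2_def by (subst integral_distr) (auto simp: case_prod_beta)
    finally show "(\<integral>s. exp (- real k * s) \<partial>m1) = (\<integral>s. exp (- real k * s) \<partial>m2)" .
  qed (use fm1 fm2 in \<open>auto simp: m1_def m2_def\<close>)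
  show "absolutely_continuous lborel \<mu>"
    unfolding absolutely_continuous_def
  proof
    fix N assume N: "N \<in> null_sets (lborel :: real measure)"
    then have [measurable]: "N \<in> sets borel" by auto
    have "emeasure m2 N = emeasure (W \<Otimes>\<^sub>M U) ((\<lambda>(a, b). a + b) -` N \<inter> space (W \<Otimes>\<^sub>M U))"
      unfolding m2_def by (rule emeasure_distr) auto
    also have "\<dots> = (\<integral>\<^sup>+b. emeasure W ((\<lambda>a. (a, b)) -` ((\<lambda>(a, b). a + b) -` N \<inter> space (W \<Otimes>\<^sub>M U))) \<partial>U)"
      by (rule WU.emeasure_pair_measure_alt2) measurable
    also have "\<dots> = (\<integral>\<^sup>+b. 0 \<partial>U)"
    proof (rule nn_integral_cong)
      fix b assume "b \<in> space U"
      \<comment> \<open>For fixed b the section is a translate of N, null for Lebesgue measure and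
        therefore for W.\<close>
      have "(\<lambda>a. (a, b)) -` ((\<lambda>(a, b). a + b) -` N \<inter> space (W \<Otimes>\<^sub>M U)) = {a. a - (- b) \<in> N}"
        by (auto simp: space_pair_measure W_def U_def)
      moreover have "{a. a - (- b) \<in> N} \<in> null_sets lborel" by (rule null_sets_translation[OF N])
      moreover have "absolutely_continuous lborel W" unfolding W_def by (rule absolutely_continuousI_density) auto
      ultimately show "emeasure W ((\<lambda>a. (a, b)) -` ((\<lambda>(a, b). a + b) -` N \<inter> space (W \<Otimes>\<^sub>M U))) = 0"
        by (auto simp: absolutely_continuous_def)
    qed
    finally have "emeasure m1 N = 0" using \<open>m1 = m2\<close> by simp
    then have "N \<in> null_sets m1" by (intro null_setsI) (auto simp: m1_def)
    then have "AE s in m1. s \<notin> N" by (rule AE_not_in)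
    then have "AE s in \<mu>. 0 < s * exp (- s) \<longrightarrow> s \<notin> N"
      unfolding m1_def by (subst (asm) AE_density) auto
    \<comment> \<open>The weight s exp (- s) vanishes on s \<ge> 0 only at 0, which has just been
      shown to be \<mu>-null.\<close>
    moreover have "{0} \<in> null_sets \<mu>" using zero by (intro null_setsI) (auto simp: emeasure_eq_measure)
    then have "AE s in \<mu>. s \<notin> {0}" by (rule AE_not_in)
    ultimately have "AE s in \<mu>. s \<notin> N" using pos
      by eventually_elim (auto simp: zero_less_mult_iff)
    then show "N \<in> null_sets \<mu>" by (subst AE_iff_null_sets) auto
  qed
qed

end

section \<open>Subordinators and their first passage times\<close>

lemma space_sigma_of_process [simp]: "space (sigma_of_process M N X I) = space M"
  unfolding sigma_of_process_def by (rule space_measure_of) auto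

lemma sets_sigma_of_process:
  "sets (sigma_of_process M N X I) = sigma_sets (space M) {X i -` A \<inter> space M | i A. i \<in> I \<and> A \<in> sets N}"
  unfolding sigma_of_process_def by (rule sets_measure_of) auto

lemma measurable_sigma_of_process:
  assumes "i \<in> I" "X i \<in> space M \<rightarrow> space N"
  shows "X i \<in> measurable (sigma_of_process M N X I) N"
  using assms by (auto simp: measurable_def sets_sigma_of_process)

lemma sets_sigma_of_process_subset:
  assumes "\<And>i. i \<in> I \<Longrightarrow> X i \<in> measurable M N"
  shows "sets (sigma_of_process M N X I) \<subseteq> sets M"
  unfolding sets_sigma_of_process
  by (rule sets.sigma_sets_subset) (use assms in \<open>auto intro: measurable_sets\<close>)

text \<open>The summand 1 puts the grid point strictly above r, as a limit in
  \<open>at_right r\<close> requires.\<close>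

lemma floor_grid_at_right:
  assumes r: "0 \<le> (r::real)"
  shows "filterlim (\<lambda>n. (of_int \<lfloor>real (Suc n) * r\<rfloor> + 1) / real (Suc n)) (at_right r) sequentially"
  unfolding filterlim_at
proof (intro conjI always_eventually allI)
  let ?g = "\<lambda>n. (of_int \<lfloor>real (Suc n) * r\<rfloor> + 1) / real (Suc n)"
  have gr: "r < ?g n" and gle: "?g n \<le> r + 1 / real (Suc n)" for n
  proof -
    have "real (Suc n) * r < of_int \<lfloor>real (Suc n) * r\<rfloor> + 1" by linarith
    then show "r < ?g n" by (simp add: less_divide_eq mult.commute del: of_nat_Suc)
    have "of_int \<lfloor>real (Suc n) * r\<rfloor> + 1 \<le> real (Suc n) * (r + 1 / real (Suc n))"
      by (simp add: distrib_left del: of_nat_Suc)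
    then show "?g n \<le> r + 1 / real (Suc n)" by (simp add: divide_le_eq mult.commute del: of_nat_Suc)
  qed
  show "?g n \<in> {r<..}" "?g n \<noteq> r" for n using gr[of n] by auto
  have "(\<lambda>n. r + 1 / real (Suc n)) \<longlonglongrightarrow> r + 0"
    by (intro tendsto_add tendsto_const LIMSEQ_Suc[OF lim_1_over_n])
  then show "?g \<longlonglongrightarrow> r"
    by (intro tendsto_sandwich[of "\<lambda>_. r" ?g]) (auto intro!: always_eventually less_imp_le[OF gr] gle simp del: of_nat_Suc)
qed

text \<open>The process is approximated by its value at the next grid point, which as a function of
  time takes countably many indices. \<open>max 0\<close> extends it to negative times, where
  nothing is assumed.\<close>

lemma measurable_right_continuous_process:
  fixes X :: "real \<Rightarrow> 'w \<Rightarrow> real"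
  assumes X: "\<And>r. 0 \<le> r \<Longrightarrow> X r \<in> borel_measurable N"
    and rc: "\<And>\<omega> r. \<omega> \<in> space N \<Longrightarrow> 0 \<le> r \<Longrightarrow> ((\<lambda>s. X s \<omega>) \<longlongrightarrow> X r \<omega>) (at_right r)"
  shows "(\<lambda>(r, \<omega>). X (max 0 r) \<omega>) \<in> borel_measurable (borel \<Otimes>\<^sub>M N)"
proof (rule borel_measurable_LIMSEQ_real)
  let ?f = "\<lambda>n p. X (max 0 ((of_int \<lfloor>real (Suc n) * max 0 (fst p)\<rfloor> + 1) / real (Suc n))) (snd p)"
  show "?f n \<in> borel_measurable (borel \<Otimes>\<^sub>M N)" for n
  proof (rule measurable_compose_countable[where f = "\<lambda>i p. X (max 0 ((of_int i + 1) / real (Suc n))) (snd p)"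
        and g = "\<lambda>p. \<lfloor>real (Suc n) * max 0 (fst p)\<rfloor>"])
    show "(\<lambda>p. X (max 0 ((of_int i + 1) / real (Suc n))) (snd p)) \<in> borel_measurable (borel \<Otimes>\<^sub>M N)" for i :: int
      by (rule measurable_compose[OF measurable_snd X]) simp
    show "(\<lambda>p. \<lfloor>real (Suc n) * max 0 (fst p)\<rfloor>) \<in> measurable (borel \<Otimes>\<^sub>M N) (count_space UNIV)"
      by measurable
  qed
  show "(\<lambda>n. ?f n p) \<longlonglongrightarrow> (case p of (r, \<omega>) \<Rightarrow> X (max 0 r) \<omega>)" if "p \<in> space (borel \<Otimes>\<^sub>M N)" for p
  proof -
    obtain r \<omega> where "p = (r, \<omega>)" by (cases p)
    with that have p: "p = (r, \<omega>)" "\<omega> \<in> space N" by (simp_all add: space_pair_measure)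
    have "(\<lambda>n. X ((of_int \<lfloor>real (Suc n) * max 0 r\<rfloor> + 1) / real (Suc n)) \<omega>) \<longlonglongrightarrow> X (max 0 r) \<omega>"
      by (rule filterlim_compose[OF rc[OF p(2)] floor_grid_at_right]) auto
    moreover have "0 \<le> (of_int \<lfloor>real (Suc n) * max 0 r\<rfloor> + 1) / real (Suc n)" for n
      by (intro divide_nonneg_nonneg add_nonneg_nonneg) auto
    ultimately show ?thesis by (simp add: p max_absorb2 del: of_nat_Suc)
  qed
qed

context prob_space
begin

text \<open>Independence means that the diagonal map from M into the product of A and B has the
  product measure as its law, so Fubini decouples the two occurrences of \<omega>. Letting H act on
  pairs of sample points allows it to depend on entire paths.\<close>

lemma integral_pair_indep:
  fixes H :: "'a \<times> 'a \<Rightarrow> real"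
  assumes ind: "indep_set (sets A) (sets B)" and sp: "space A = space M" "space B = space M"
    and H: "H \<in> borel_measurable (A \<Otimes>\<^sub>M B)" and bd: "\<And>p. \<bar>H p\<bar> \<le> C"
  shows "(\<integral>\<omega>. H (\<omega>, \<omega>) \<partial>M) = (\<integral>\<omega>. (\<integral>\<omega>'. H (\<omega>, \<omega>') \<partial>M) \<partial>M)"
proof -
  have sub: "sets A \<subseteq> events" "sets B \<subseteq> events" using ind by (auto simp: indep_set_def indep_sets_def split: bool.splits)
  have id: "(\<lambda>\<omega>. \<omega>) \<in> measurable M A" "(\<lambda>\<omega>. \<omega>) \<in> measurable M B"
    using sub sp by (auto intro!: measurableI dest: sets.sets_into_space simp: Int_absorb2)
  have gen: "sigma_sets (space M) {(\<lambda>\<omega>. \<omega>) -` X \<inter> space M | X. X \<in> sets A} = sets A"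
      "sigma_sets (space M) {(\<lambda>\<omega>. \<omega>) -` X \<inter> space M | X. X \<in> sets B} = sets B"
  proof -
    have eq: "(\<lambda>\<omega>. \<omega>) -` X \<inter> space M = X" if "X \<in> sets A \<or> X \<in> sets B" for X
      using that sets.sets_into_space[of X A] sets.sets_into_space[of X B] sp by auto
    have "{(\<lambda>\<omega>. \<omega>) -` X \<inter> space M | X. X \<in> sets A} = sets A"
      unfolding Setcompr_eq_image Collect_mem_eq using eq image_cong[OF refl, of "sets A" _ id] by simp
    moreover have "{(\<lambda>\<omega>. \<omega>) -` X \<inter> space M | X. X \<in> sets B} = sets B"
      unfolding Setcompr_eq_image Collect_mem_eq using eq image_cong[OF refl, of "sets B" _ id] by simp
    ultimately show "sigma_sets (space M) {(\<lambda>\<omega>. \<omega>) -` X \<inter> space M | X. X \<in> sets A} = sets A"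
      "sigma_sets (space M) {(\<lambda>\<omega>. \<omega>) -` X \<inter> space M | X. X \<in> sets B} = sets B"
      using sets.sigma_sets_eq[of A] sets.sigma_sets_eq[of B] sp by simp_all
  qed
  have "indep_var A (\<lambda>\<omega>. \<omega>) B (\<lambda>\<omega>. \<omega>)"
    unfolding indep_var_eq gen using ind id by simp
  then have D: "distr M A (\<lambda>\<omega>. \<omega>) \<Otimes>\<^sub>M distr M B (\<lambda>\<omega>. \<omega>) = distr M (A \<Otimes>\<^sub>M B) (\<lambda>\<omega>. (\<omega>, \<omega>))"
    by (simp add: indep_var_distribution_eq)
  interpret A: prob_space "distr M A (\<lambda>\<omega>. \<omega>)" by (rule prob_space_distr[OF id(1)])
  interpret B: prob_space "distr M B (\<lambda>\<omega>. \<omega>)" by (rule prob_space_distr[OF id(2)])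
  interpret AB: pair_prob_space "distr M A (\<lambda>\<omega>. \<omega>)" "distr M B (\<lambda>\<omega>. \<omega>)" ..
  have Hm: "H \<in> borel_measurable (distr M A (\<lambda>\<omega>. \<omega>) \<Otimes>\<^sub>M distr M B (\<lambda>\<omega>. \<omega>))" using H by simp
  have Hi: "integrable (distr M A (\<lambda>\<omega>. \<omega>) \<Otimes>\<^sub>M distr M B (\<lambda>\<omega>. \<omega>)) H"
    by (rule AB.P.integrable_const_bound[where B = C, OF _ Hm]) (use bd in auto)
  have "(\<integral>\<omega>. H (\<omega>, \<omega>) \<partial>M) = integral\<^sup>L (distr M (A \<Otimes>\<^sub>M B) (\<lambda>\<omega>. (\<omega>, \<omega>))) H"
    using H id by (subst integral_distr) auto
  also have "\<dots> = (\<integral>\<omega>. (\<integral>\<omega>'. H (\<omega>, \<omega>') \<partial>distr M B (\<lambda>\<omega>. \<omega>)) \<partial>distr M A (\<lambda>\<omega>. \<omega>))"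
    unfolding D[symmetric] by (rule AB.integral_fst'[OF Hi, symmetric])
  also have "\<dots> = (\<integral>\<omega>. (\<integral>\<omega>'. H (\<omega>, \<omega>') \<partial>distr M B (\<lambda>\<omega>. \<omega>)) \<partial>M)"
    by (rule integral_distr[OF id(1)])
       (use B.borel_measurable_lebesgue_integral[of "\<lambda>\<omega> \<omega>'. H (\<omega>, \<omega>')" "distr M A (\<lambda>\<omega>. \<omega>)"] H in simp)
  also have "\<dots> = (\<integral>\<omega>. (\<integral>\<omega>'. H (\<omega>, \<omega>') \<partial>M) \<partial>M)"
  proof (rule Bochner_Integration.integral_cong[OF refl])
    fix \<omega> assume "\<omega> \<in> space M"
    then have "(\<lambda>\<omega>'. H (\<omega>, \<omega>')) \<in> borel_measurable B"
      using H sp by (intro measurable_compose[OF measurable_Pair1' H]) auto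
    then show "(\<integral>\<omega>'. H (\<omega>, \<omega>') \<partial>distr M B (\<lambda>\<omega>. \<omega>)) = (\<integral>\<omega>'. H (\<omega>, \<omega>') \<partial>M)"
      by (rule integral_distr[OF id(2)])
  qed
  finally show ?thesis .
qed

end

section \<open>Laws and increments of the subordinator\<close>

locale subordinator = prob_space M for M :: "'w measure" +
  fixes \<nu> :: "real \<Rightarrow> real" and S :: "real \<Rightarrow> 'w \<Rightarrow> real"
  assumes H0: "H0 \<nu>" and levy: "levy_subordinator M \<nu> S"
begin

lemma S_measurable: "0 \<le> r \<Longrightarrow> S r \<in> borel_measurable M"
  using levy by (simp add: levy_subordinator_def)

lemma S_0: "\<omega> \<in> space M \<Longrightarrow> S 0 \<omega> = 0"
  using levy by (simp add: levy_subordinator_def)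

lemma S_mono: "\<omega> \<in> space M \<Longrightarrow> 0 \<le> r \<Longrightarrow> r \<le> s \<Longrightarrow> S r \<omega> \<le> S s \<omega>"
  using levy by (simp add: levy_subordinator_def)

lemma S_right_continuous: "\<omega> \<in> space M \<Longrightarrow> 0 \<le> r \<Longrightarrow> ((\<lambda>s. S s \<omega>) \<longlongrightarrow> S r \<omega>) (at_right r)"
  using levy by (simp add: levy_subordinator_def)

lemma S_nonneg: "\<omega> \<in> space M \<Longrightarrow> 0 \<le> r \<Longrightarrow> 0 \<le> S r \<omega>"
  using S_mono[of \<omega> 0 r] S_0[of \<omega>] by simp

definition law :: "real \<Rightarrow> real measure" where
  "law r = distr M borel (S r)"

lemma real_distribution_law: "0 \<le> r \<Longrightarrow> real_distribution (law r)"
  unfolding law_def by (rule real_distribution_distr[OF S_measurable])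

lemma AE_law_nonneg: "0 \<le> r \<Longrightarrow> AE s in law r. 0 \<le> s"
  unfolding law_def by (subst AE_distr_iff) (auto simp: S_measurable S_nonneg)

lemma laplace_law:
  assumes "0 < r" "0 < k"
  shows "(\<integral>\<omega>. exp (- k * S r \<omega>) \<partial>M) = exp (- r * laplace_exponent \<nu> k)"
proof -
  have [measurable]: "S r \<in> borel_measurable M" using assms by (simp add: S_measurable)
  have int: "integrable M (\<lambda>\<omega>. exp (- k * S r \<omega>))"
    by (rule integrable_const_bound[of _ 1]) (use assms in \<open>auto intro!: AE_I2 mult_nonneg_nonneg S_nonneg\<close>)
  \<comment> \<open>\<open>ln\<close> is total, so the identity for the logarithm determines the
    expectation only once the latter is known to be positive.\<close>
  have "(\<integral>\<omega>. exp (- k * S r \<omega>) \<partial>M) \<noteq> 0"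
  proof
    assume "(\<integral>\<omega>. exp (- k * S r \<omega>) \<partial>M) = 0"
    then have "AE \<omega> in M. exp (- k * S r \<omega>) = 0"
      by (subst (asm) integral_nonneg_eq_0_iff_AE[OF int]) auto
    then show False using AE_False by simp
  qed
  moreover have "0 \<le> (\<integral>\<omega>. exp (- k * S r \<omega>) \<partial>M)" by simp
  ultimately have "0 < (\<integral>\<omega>. exp (- k * S r \<omega>) \<partial>M)" by linarith
  moreover have "ln (\<integral>\<omega>. exp (- k * S r \<omega>) \<partial>M) = - r * laplace_exponent \<nu> k"
    using levy assms laplace_exponent_eq[OF H0 assms(2)] unfolding levy_subordinator_def by simp
  ultimately show ?thesis by (metis exp_ln)
qed

lemma law_absolutely_continuous:
  assumes r: "0 < r"
  shows "absolutely_continuous lborel (law r)"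
proof -
  have L: "(\<integral>s. exp (- k * s) \<partial>law r) = exp (- r * laplace_exponent \<nu> k)" if "0 < k" for k
    using laplace_law[OF r that] r unfolding law_def by (subst integral_distr) (auto simp: S_measurable)
  show ?thesis
    using absolutely_continuous_of_laplace_exponent[OF H0 real_distribution_law AE_law_nonneg r L] r by auto
qed

lemma AE_S_null:
  assumes "0 < r" "N \<in> null_sets lborel"
  shows "AE \<omega> in M. S r \<omega> \<notin> N"
proof -
  have "N \<in> null_sets (law r)" using law_absolutely_continuous[OF assms(1)] assms(2) by (auto simp: absolutely_continuous_def)
  then have "AE s in law r. s \<notin> N" by (rule AE_not_in)
  moreover have "N \<in> sets borel" using assms(2) by auto
  then have "{s \<in> space borel. s \<notin> N} \<in> sets borel" by (simp add: Compl_eq[symmetric] borel_comp)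
  ultimately show ?thesis
    unfolding law_def by (subst (asm) AE_distr_iff) (use assms(1) in \<open>auto simp: S_measurable\<close>)
qed

lemma AE_S_neq: "0 < r \<Longrightarrow> AE \<omega> in M. S r \<omega> \<noteq> t"
  using AE_S_null[of r "{t}"] finite_imp_null_set_lborel[of "{t}"] by simp

lemma AE_S_pos: "0 < r \<Longrightarrow> AE \<omega> in M. 0 < S r \<omega>"
  using AE_S_neq[of r 0] by (rule AE_mp) (auto intro!: AE_I2 simp: less_le S_nonneg)

text \<open>Markov's inequality for exp (- S r), with the Laplace transform taken at k = 1.\<close>

lemma prob_S_le:
  assumes r: "0 < r"
  shows "measure M {\<omega>\<in>space M. S r \<omega> \<le> t} \<le> exp t * exp (- r * laplace_exponent \<nu> 1)"
proof -
  have [measurable]: "S r \<in> borel_measurable M" using assms by (simp add: S_measurable)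
  have int: "integrable M (\<lambda>\<omega>. exp (- 1 * S r \<omega>))"
    by (rule integrable_const_bound[of _ 1]) (use assms in \<open>auto intro!: AE_I2 S_nonneg\<close>)
  have "measure M {\<omega>\<in>space M. S r \<omega> \<le> t} = (\<integral>\<omega>. indicator {\<omega>\<in>space M. S r \<omega> \<le> t} \<omega> \<partial>M)"
    by (simp add: Int_absorb2)
  also have "\<dots> \<le> (\<integral>\<omega>. exp t * exp (- 1 * S r \<omega>) \<partial>M)"
  proof (rule integral_mono)
    show "integrable M (indicat_real {\<omega> \<in> space M. S r \<omega> \<le> t})"
      by (rule integrable_real_indicator) (auto simp: less_top[symmetric])
    show "integrable M (\<lambda>\<omega>. exp t * exp (- 1 * S r \<omega>))" using int by simp
    show "indicat_real {\<omega> \<in> space M. S r \<omega> \<le> t} \<omega> \<le> exp t * exp (- 1 * S r \<omega>)" for \<omega>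
      by (auto simp: indicator_def exp_add[symmetric])
  qed
  also have "\<dots> = exp t * exp (- r * laplace_exponent \<nu> 1)"
    using laplace_law[OF r, of 1] by simp
  finally show ?thesis .
qed

text \<open>N varies because functionals of S must be measurable not only for M but also for the
  sigma-algebra generated by S, where independence of B is expressed.\<close>

lemma S_joint:
  assumes N: "\<And>r. 0 \<le> r \<Longrightarrow> S r \<in> borel_measurable N" "space N = space M"
    and f: "f \<in> borel_measurable K" and g: "g \<in> measurable K N"
  shows "(\<lambda>x. S (max 0 (f x)) (g x)) \<in> borel_measurable K"
proof -
  have "(\<lambda>(r, \<omega>). S (max 0 r) \<omega>) \<in> borel_measurable (borel \<Otimes>\<^sub>M N)"
    by (rule measurable_right_continuous_process) (auto simp: N S_right_continuous)
  from measurable_compose[OF measurable_Pair[OF f g] this] show ?thesis by simp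
qed

lemmas S_joint_M = S_joint[where N = M, OF S_measurable refl]

text \<open>The increment is independent of S r and has the law of S d. A second sample point
  \<omega>' of the same space plays the role of an independent copy.\<close>

lemma integral_increment:
  fixes F :: "real \<times> real \<Rightarrow> real"
  assumes F: "F \<in> borel_measurable borel" and bd: "\<And>p. \<bar>F p\<bar> \<le> C" and r: "0 \<le> r" and d: "0 \<le> d"
  shows "(\<integral>\<omega>. F (S r \<omega>, S (r + d) \<omega> - S r \<omega>) \<partial>M) = (\<integral>\<omega>. (\<integral>\<omega>'. F (S r \<omega>, S d \<omega>') \<partial>M) \<partial>M)"
proof -
  let ?A = "sigma_of_process M borel S {0..r}"
  let ?B = "sigma_of_process M borel (\<lambda>_ \<omega>. S (r + d) \<omega> - S r \<omega>) (UNIV :: unit set)"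
  have F': "F \<in> borel_measurable (borel \<Otimes>\<^sub>M borel)" using F by (simp add: borel_prod)
  have m: "S r \<in> borel_measurable ?A" using r by (intro measurable_sigma_of_process) auto
  have m': "(\<lambda>\<omega>. S (r + d) \<omega> - S r \<omega>) \<in> borel_measurable ?B"
    by (rule measurable_sigma_of_process[where X = "\<lambda>_ \<omega>. S (r + d) \<omega> - S r \<omega>" and i = "()"]) auto
  have "(\<lambda>p. F (S r (fst p), S (r + d) (snd p) - S r (snd p))) \<in> borel_measurable (?A \<Otimes>\<^sub>M ?B)"
    by (rule measurable_compose[OF measurable_Pair F'])
       (auto intro: measurable_compose[OF measurable_fst m] measurable_compose[OF measurable_snd m'])
  moreover have "indep_set (sets ?A) (sets ?B)"
    using levy r d by (simp add: levy_subordinator_def)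
  ultimately have "(\<integral>\<omega>. F (S r \<omega>, S (r + d) \<omega> - S r \<omega>) \<partial>M)
      = (\<integral>\<omega>. (\<integral>\<omega>'. F (S r \<omega>, S (r + d) \<omega>' - S r \<omega>') \<partial>M) \<partial>M)"
    using integral_pair_indep[of ?A ?B "\<lambda>p. F (S r (fst p), S (r + d) (snd p) - S r (snd p))" C] bd by simp
  also have "\<dots> = (\<integral>\<omega>. (\<integral>\<omega>'. F (S r \<omega>, S d \<omega>') \<partial>M) \<partial>M)"
  proof (rule Bochner_Integration.integral_cong[OF refl])
    fix \<omega>
    have Fm: "(\<lambda>s. F (S r \<omega>, s)) \<in> borel_measurable borel"
      by (rule measurable_compose[OF _ F']) simp
    have "(\<integral>\<omega>'. F (S r \<omega>, S (r + d) \<omega>' - S r \<omega>') \<partial>M)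
        = (\<integral>s. F (S r \<omega>, s) \<partial>distr M borel (\<lambda>\<omega>. S (r + d) \<omega> - S r \<omega>))"
      by (rule integral_distr[symmetric, OF _ Fm]) (use r d in \<open>auto intro!: borel_measurable_diff S_measurable\<close>)
    also have "distr M borel (\<lambda>\<omega>. S (r + d) \<omega> - S r \<omega>) = distr M borel (S d)"
    proof -
      have "\<And>r s. 0 \<le> r \<Longrightarrow> r \<le> s \<Longrightarrow> distr M borel (\<lambda>\<omega>. S s \<omega> - S r \<omega>) = distr M borel (S (s - r))"
        using levy unfolding levy_subordinator_def by blast
      from this[of r "r + d"] show ?thesis using r d by simp
    qed
    also have "(\<integral>s. F (S r \<omega>, s) \<partial>distr M borel (S d)) = (\<integral>\<omega>'. F (S r \<omega>, S d \<omega>') \<partial>M)"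
      by (rule integral_distr[OF S_measurable[OF d] Fm])
    finally show "(\<integral>\<omega>'. F (S r \<omega>, S (r + d) \<omega>' - S r \<omega>') \<partial>M) = (\<integral>\<omega>'. F (S r \<omega>, S d \<omega>') \<partial>M)" .
  qed
  finally show ?thesis .
qed

text \<open>Trades the density in the definition of the semigroups for expectations over S. Absolute
  continuity makes the Radon-Nikodym derivative a genuine density, and its finiteness almost
  everywhere makes \<open>enn2real\<close> harmless.\<close>

lemma integral_density_interval:
  assumes r: "0 < r" and ab: "a \<le> b" and f: "f \<in> borel_measurable borel"
  shows "(LBINT s=a..b. f s * subordinator_density M S r s)
    = (\<integral>\<omega>. indicator (einterval a b) (S r \<omega>) * f (S r \<omega>) \<partial>M)"
proof -
  interpret L: real_distribution "law r" using r by (intro real_distribution_law) simp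
  let ?D = "RN_deriv lborel (law r)"
  have D: "density lborel ?D = law r"
    by (rule sigma_finite_measure.density_RN_deriv[OF sigma_finite_lborel law_absolutely_continuous[OF r]]) simp
  have "AE s in lborel. ?D s \<noteq> \<infinity>"
    by (rule sigma_finite_measure.RN_deriv_finite[OF sigma_finite_lborel L.sigma_finite_measure_axioms law_absolutely_continuous[OF r]]) simp
  then have "AE s in lborel. ?D s = ennreal (subordinator_density M S r s)"
    by (rule eventually_mono) (simp add: subordinator_density_def law_def less_top)
  then have D': "law r = density lborel (\<lambda>s. ennreal (subordinator_density M S r s))"
    by (subst D[symmetric], intro density_cong) (auto simp: subordinator_density_def)
  have [measurable]: "subordinator_density M S r \<in> borel_measurable borel"
    unfolding subordinator_density_def using borel_measurable_RN_deriv[of lborel] by measurable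
  have "(LBINT s=a..b. f s * subordinator_density M S r s)
      = (\<integral>s. subordinator_density M S r s *\<^sub>R (indicator (einterval a b) s * f s) \<partial>lborel)"
    using ab by (simp add: interval_lebesgue_integral_def set_lebesgue_integral_def mult_ac)
  also have "\<dots> = (\<integral>s. indicator (einterval a b) s * f s \<partial>law r)"
    unfolding D' using f by (subst integral_density) (auto simp: subordinator_density_def)
  also have "\<dots> = (\<integral>\<omega>. indicator (einterval a b) (S r \<omega>) * f (S r \<omega>) \<partial>M)"
    unfolding law_def using r f by (subst integral_distr) (auto simp: S_measurable)
  finally show ?thesis .
qed

end

section \<open>Averaging and telescoping along a path\<close>

text \<open>The substitution r = a + v/(n+1) turns the average into an integral over (0,1], to which
  dominated convergence applies. The second claim later supplies the majorant for the expectation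
  over paths.\<close>

lemma average_right_limit:
  fixes q :: "real \<Rightarrow> real"
  assumes q: "q \<in> borel_measurable borel" and bd: "\<And>r. \<bar>q r\<bar> \<le> C" and l: "(q \<longlongrightarrow> l) (at_right a)"
  shows "(\<lambda>n. real (Suc n) * (\<integral>r. indicator {a<..a + 1 / real (Suc n)} r * q r \<partial>lborel)) \<longlonglongrightarrow> l"
    and "\<bar>real (Suc n) * (\<integral>r. indicator {a<..a + 1 / real (Suc n)} r * q r \<partial>lborel)\<bar> \<le> C"
proof -
  let ?f = "\<lambda>n v. indicator {0<..1} v * q (a + 1 / real (Suc n) * v)"
  note [measurable] = q
  have eq: "real (Suc n) * (\<integral>r. indicator {a<..a + 1 / real (Suc n)} r * q r \<partial>lborel) = (\<integral>v. ?f n v \<partial>lborel)" for n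
  proof -
    have "(\<integral>r. indicator {a<..a + 1 / real (Suc n)} r * q r \<partial>lborel)
        = \<bar>1 / real (Suc n)\<bar> *\<^sub>R (\<integral>v. indicator {a<..a + 1 / real (Suc n)} (a + 1 / real (Suc n) * v) * q (a + 1 / real (Suc n) * v) \<partial>lborel)"
      by (rule lborel_integral_real_affine) simp
    also have "(\<lambda>v. indicator {a<..a + 1 / real (Suc n)} (a + 1 / real (Suc n) * v) * q (a + 1 / real (Suc n) * v)) = ?f n"
      by (auto simp: fun_eq_iff indicator_def divide_le_eq zero_less_divide_iff simp del: of_nat_Suc)
    finally show ?thesis by simp
  qed
  have int: "integrable lborel (\<lambda>v. C * indicator {0<..1::real} v)"
    by (intro integrable_mult_right integrable_real_indicator) auto
  have le: "norm (?f n v) \<le> C * indicator {0<..1} v" for n v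
    using bd by (auto simp: indicator_def)
  have "(\<lambda>n. \<integral>v. ?f n v \<partial>lborel) \<longlonglongrightarrow> (\<integral>v. indicator {0<..1::real} v * l \<partial>lborel)"
  proof (rule integral_dominated_convergence[where w = "\<lambda>v. C * indicator {0<..1::real} v"])
    show "integrable lborel (\<lambda>v. C * indicator {0<..1::real} v)" by (rule int)
    show "AE v in lborel. (\<lambda>n. ?f n v) \<longlonglongrightarrow> indicator {0<..1} v * l"
    proof (rule AE_I2)
      fix v :: real
      show "(\<lambda>n. ?f n v) \<longlonglongrightarrow> indicator {0<..1} v * l"
      proof (cases "0 < v")
        case True
        have "(\<lambda>n. a + 1 / real (Suc n) * v) \<longlonglongrightarrow> a + 0 * v"
          by (intro tendsto_add tendsto_mult tendsto_const LIMSEQ_Suc[OF lim_1_over_n])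
        then have "filterlim (\<lambda>n. a + 1 / real (Suc n) * v) (at_right a) sequentially"
          using True by (auto simp: filterlim_at)
        from filterlim_compose[OF l this] show ?thesis by (intro tendsto_mult tendsto_const)
      qed simp
    qed
  qed (use le in auto)
  also have "(\<integral>v. indicator {0<..1::real} v * l \<partial>lborel) = l" by simp
  finally show "(\<lambda>n. real (Suc n) * (\<integral>r. indicator {a<..a + 1 / real (Suc n)} r * q r \<partial>lborel)) \<longlonglongrightarrow> l"
    unfolding eq .
  have "\<bar>\<integral>v. ?f n v \<partial>lborel\<bar> \<le> (\<integral>v. C * indicator {0<..1::real} v \<partial>lborel)"
  proof (rule integral_abs_bound[THEN order_trans], rule integral_mono_AE[OF _ int])
    show "integrable lborel (\<lambda>v. \<bar>?f n v\<bar>)"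
      by (rule Bochner_Integration.integrable_bound[OF int]) (use le bd[of 0] in \<open>auto simp: indicator_def\<close>)
  qed (use le in auto)
  then show "\<bar>real (Suc n) * (\<integral>r. indicator {a<..a + 1 / real (Suc n)} r * q r \<partial>lborel)\<bar> \<le> C"
    unfolding eq by simp
qed

text \<open>The indicators of (d, \<tau> + d] and (0, \<tau>] differ by the two end pieces of length
  d, whichever of d and \<tau> is larger. Writing 0 + d matches the averages taken to the right of
  0.\<close>

lemma integral_telescope_shift:
  fixes q :: "real \<Rightarrow> real"
  assumes q: "q \<in> borel_measurable borel" and bd: "\<And>r. \<bar>q r\<bar> \<le> C" and \<tau>: "0 \<le> \<tau>" and d: "0 < d"
  shows "(\<integral>r. indicator {0<..\<tau>} r * (q (r + d) - q r) \<partial>lborel)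
    = (\<integral>r. indicator {\<tau><..\<tau> + d} r * q r \<partial>lborel) - (\<integral>r. indicator {0<..0 + d} r * q r \<partial>lborel)"
proof -
  have int: "integrable lborel (\<lambda>r. indicator {a<..b} r * q' r)"
    if "q' \<in> borel_measurable borel" "\<And>r. \<bar>q' r\<bar> \<le> C" for a b and q' :: "real \<Rightarrow> real"
  proof (rule Bochner_Integration.integrable_bound)
    have "emeasure lborel {a<..b} < \<infinity>" by (cases "a \<le> b") auto
    then show "integrable lborel (\<lambda>r. C * indicator {a<..b} r)"
      by (intro integrable_mult_right integrable_real_indicator) auto
    show "(\<lambda>r. indicator {a<..b} r * q' r) \<in> borel_measurable lborel" using that by measurable
    show "AE r in lborel. norm (indicator {a<..b} r * q' r) \<le> norm (C * indicator {a<..b} r)"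
      using that(2) by (auto simp: indicator_def intro: order_trans[OF _ abs_ge_self])
  qed
  have qd: "(\<lambda>r. q (r + d)) \<in> borel_measurable borel" using q by measurable
  have "(\<integral>r. indicator {0<..\<tau>} r * (q (r + d) - q r) \<partial>lborel)
      = (\<integral>r. indicator {0<..\<tau>} r * q (r + d) \<partial>lborel) - (\<integral>r. indicator {0<..\<tau>} r * q r \<partial>lborel)"
    using int[OF q bd] int[OF qd bd] by (simp add: right_diff_distrib)
  also have "(\<integral>r. indicator {0<..\<tau>} r * q (r + d) \<partial>lborel) = (\<integral>r. indicator {d<..\<tau> + d} r * q r \<partial>lborel)"
    by (subst lborel_integral_real_affine[where c = 1 and t = d and f = "\<lambda>r. indicator {d<..\<tau> + d} r * q r"])
       (auto simp: indicator_def add.commute intro!: Bochner_Integration.integral_cong)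
  also have "\<dots> - (\<integral>r. indicator {0<..\<tau>} r * q r \<partial>lborel)
      = (\<integral>r. indicator {d<..\<tau> + d} r * q r - indicator {0<..\<tau>} r * q r \<partial>lborel)"
    using int[OF q bd] by simp
  also have "\<dots> = (\<integral>r. indicator {\<tau><..\<tau> + d} r * q r - indicator {0<..0 + d} r * q r \<partial>lborel)"
    by (rule Bochner_Integration.integral_cong) (use \<tau> d in \<open>auto simp: indicator_def\<close>)
  also have "\<dots> = (\<integral>r. indicator {\<tau><..\<tau> + d} r * q r \<partial>lborel) - (\<integral>r. indicator {0<..0 + d} r * q r \<partial>lborel)"
    using int[OF q bd] by (intro Bochner_Integration.integral_diff)
  finally show ?thesis .
qed

section \<open>First passage times\<close>

context subordinator
begin

lemma passage_time_nonneg: "0 \<le> passage_time S t \<omega>"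
  unfolding passage_time_def by (rule Inf_greatest) auto

lemma S_before_passage:
  assumes \<omega>: "\<omega> \<in> space M" and t: "0 \<le> t" and r: "0 \<le> r" "ereal r < passage_time S t \<omega>"
  shows "ereal (S r \<omega>) \<le> t"
proof (rule ccontr)
  assume "\<not> ereal (S r \<omega>) \<le> t"
  moreover from this have "r \<noteq> 0" using S_0[OF \<omega>] t by (auto simp flip: zero_ereal_def)
  ultimately have "passage_time S t \<omega> \<le> ereal r"
    unfolding passage_time_def using r by (intro Inf_lower) auto
  then show False using r by simp
qed

lemma S_after_passage:
  assumes \<omega>: "\<omega> \<in> space M" and r: "passage_time S t \<omega> < ereal r"
  shows "t < ereal (S r \<omega>)"
proof -
  obtain r' where r': "0 < r'" "t < ereal (S r' \<omega>)" "r' < r"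
    using r unfolding passage_time_def by (auto simp: Inf_less_iff)
  then have "S r' \<omega> \<le> S r \<omega>" using \<omega> by (intro S_mono) auto
  then show ?thesis using r' by (meson ereal_less_eq(3) less_le_trans)
qed

text \<open>The probability that S (n + 1) \<le> t is at most exp t times a geometric sequence,
  because the exponent at 1 is positive.\<close>

lemma AE_passage_time_finite: "AE \<omega> in M. passage_time S (ereal t) \<omega> < \<infinity>"
proof -
  have [measurable]: "S (real (Suc n)) \<in> borel_measurable M" for n by (rule S_measurable) simp
  let ?A = "\<lambda>n. {\<omega>\<in>space M. S (real (Suc n)) \<omega> \<le> t}"
  have "(\<lambda>n. measure M (?A n)) \<longlonglongrightarrow> measure M (\<Inter>n. ?A n)"
  proof (rule finite_Lim_measure_decseq)
    show "decseq ?A" unfolding decseq_def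
    proof (intro allI impI subsetI, clarify)
      fix m n \<omega> assume a: "m \<le> n" "\<omega> \<in> space M" "S (real (Suc n)) \<omega> \<le> t"
      have "S (real (Suc m)) \<omega> \<le> S (real (Suc n)) \<omega>" using a by (intro S_mono) auto
      then show "S (real (Suc m)) \<omega> \<le> t" using a by simp
    qed
  qed (auto simp del: of_nat_Suc)
  moreover have "(\<lambda>n. measure M (?A n)) \<longlonglongrightarrow> 0"
  proof (rule tendsto_sandwich[of "\<lambda>_. 0" _ _ "\<lambda>n. exp t * exp (- laplace_exponent \<nu> 1) ^ Suc n"])
    show "\<forall>\<^sub>F n in sequentially. measure M (?A n) \<le> exp t * exp (- laplace_exponent \<nu> 1) ^ Suc n"
      using prob_S_le[of "real (Suc _)" t]
      by (intro always_eventually allI) (simp only: exp_of_nat_mult[symmetric], simp add: algebra_simps)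
    have "(\<lambda>n. exp t * exp (- laplace_exponent \<nu> 1) ^ Suc n) \<longlonglongrightarrow> exp t * 0"
      by (intro tendsto_mult_left LIMSEQ_Suc[OF LIMSEQ_realpow_zero]) (use laplace_exponent_pos[OF H0, of 1] in auto)
    then show "(\<lambda>n. exp t * exp (- laplace_exponent \<nu> 1) ^ Suc n) \<longlonglongrightarrow> 0" by simp
  qed auto
  ultimately have "measure M (\<Inter>n. ?A n) = 0" using LIMSEQ_unique by blast
  then have "(\<Inter>n. ?A n) \<in> null_sets M"
    by (intro null_setsI) (auto simp: emeasure_eq_measure simp del: of_nat_Suc)
  then have "AE \<omega> in M. \<omega> \<notin> (\<Inter>n. ?A n)" by (rule AE_not_in)
  then show ?thesis
  proof (rule AE_mp, intro AE_I2 impI)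
    fix \<omega> assume "\<omega> \<in> space M" "\<omega> \<notin> (\<Inter>n. ?A n)"
    then obtain n where "t < S (real (Suc n)) \<omega>" by (auto simp: not_le)
    then have "passage_time S (ereal t) \<omega> \<le> ereal (real (Suc n))"
      unfolding passage_time_def by (intro Inf_lower) auto
    then show "passage_time S (ereal t) \<omega> < \<infinity>" by (rule le_less_trans) simp
  qed
qed

text \<open>Paths are monotone, so any rational slightly larger than a time at which S exceeds t
  also has this property, and the infimum becomes countable.\<close>

lemma passage_time_measurable:
  assumes N: "\<And>r. 0 \<le> r \<Longrightarrow> S r \<in> borel_measurable N" "space N = space M"
  shows "passage_time S (ereal t) \<in> borel_measurable N"
proof -
  let ?Q = "{q\<in>\<rat>. 0 < (q::real)}"
  have "passage_time S (ereal t) \<omega> = (INF q\<in>?Q. if t < S q \<omega> then ereal q else \<infinity>)" if \<omega>: "\<omega> \<in> space N" for \<omega>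
  proof (rule antisym)
    show "passage_time S (ereal t) \<omega> \<le> (INF q\<in>?Q. if t < S q \<omega> then ereal q else \<infinity>)"
      unfolding passage_time_def by (rule INF_greatest) (auto intro!: Inf_lower)
    show "(INF q\<in>?Q. if t < S q \<omega> then ereal q else \<infinity>) \<le> passage_time S (ereal t) \<omega>"
      unfolding passage_time_def
    proof (rule Inf_greatest, clarify)
      fix r assume r: "0 < r" "ereal t < ereal (S r \<omega>)"
      show "(INF q\<in>?Q. if t < S q \<omega> then ereal q else \<infinity>) \<le> ereal r"
      proof (rule dense_ge)
        fix y assume y: "ereal r < y"
        obtain q where q: "q \<in> \<rat>" "r < q" "ereal q < y"
        proof (cases y)
          case (real y')
          with y obtain q where "q \<in> \<rat>" "r < q" "q < y'" using Rats_dense_in_real[of r y'] by auto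
          then show ?thesis using that real by auto
        next
          case PInf
          obtain q where "q \<in> \<rat>" "r < q" "q < r + 1" using Rats_dense_in_real[of r "r + 1"] by auto
          then show ?thesis using that PInf by auto
        qed (use y in auto)
        have "S r \<omega> \<le> S q \<omega>" using \<omega> N(2) q r by (intro S_mono) auto
        then have "(INF q\<in>?Q. if t < S q \<omega> then ereal q else \<infinity>) \<le> ereal q"
          using q r by (intro INF_lower2[of q]) auto
        then show "(INF q\<in>?Q. if t < S q \<omega> then ereal q else \<infinity>) \<le> y" using q by simp
      qed
    qed
  qed
  moreover have "(\<lambda>\<omega>. INF q\<in>?Q. if t < S q \<omega> then ereal q else \<infinity>) \<in> borel_measurable N"
  proof (rule borel_measurable_INF)
    show "countable ?Q" using countable_rat by (rule countable_subset[rotated]) auto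
    fix q assume "q \<in> ?Q"
    then have [measurable]: "S q \<in> borel_measurable N" by (intro N) auto
    show "(\<lambda>\<omega>. if t < S q \<omega> then ereal q else \<infinity>) \<in> borel_measurable N" by measurable
  qed
  ultimately show ?thesis by (subst measurable_cong) auto
qed

text \<open>On the null event of an infinite passage time this is 0, so that it is a nonnegative
  real everywhere.\<close>

definition hit :: "real \<Rightarrow> 'w \<Rightarrow> real" where
  "hit t \<omega> = real_of_ereal (passage_time S (ereal t) \<omega>)"

lemma hit_nonneg: "0 \<le> hit t \<omega>"
  unfolding hit_def by (rule real_of_ereal_pos[OF passage_time_nonneg])

lemma hit_measurable:
  assumes N: "\<And>r. 0 \<le> r \<Longrightarrow> S r \<in> borel_measurable N" "space N = space M"
  shows "hit t \<in> borel_measurable N"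
  unfolding hit_def using passage_time_measurable[OF N] by measurable

lemma S_hit_measurable:
  assumes N: "\<And>r. 0 \<le> r \<Longrightarrow> S r \<in> borel_measurable N" "space N = space M"
  shows "(\<lambda>\<omega>. S (hit t \<omega>) \<omega>) \<in> borel_measurable N"
  using S_joint[OF N hit_measurable[OF N] measurable_ident] by (simp add: max_absorb2 hit_nonneg)

lemma ereal_hit: "passage_time S (ereal t) \<omega> < \<infinity> \<Longrightarrow> ereal (hit t \<omega>) = passage_time S (ereal t) \<omega>"
  unfolding hit_def using passage_time_nonneg[of "ereal t" \<omega>] by (intro ereal_real') auto

text \<open>S exceeds t right after the passage time, and right continuity keeps the weak inequality
  at that time. Hence a time coordinate started at t has reached 0 by then.\<close>

lemma S_hit_ge:
  assumes \<omega>: "\<omega> \<in> space M" and fin: "passage_time S (ereal t) \<omega> < \<infinity>"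
  shows "t \<le> S (hit t \<omega>) \<omega>"
proof (rule tendsto_lowerbound[OF S_right_continuous[OF \<omega> hit_nonneg]])
  show "\<forall>\<^sub>F s in at_right (hit t \<omega>). t \<le> S s \<omega>"
    using eventually_at_right_less
  proof (rule eventually_mono)
    fix s assume "hit t \<omega> < s"
    then show "t \<le> S s \<omega>"
      using S_after_passage[OF \<omega>, of "ereal t" s] unfolding ereal_hit[OF fin, symmetric] by simp
  qed
qed simp

text \<open>At the time \<open>hit t\<close> itself S may equal t or already have jumped beyond it;
  that single time is Lebesgue-null.\<close>

lemma S_le_iff_hit:
  assumes \<omega>: "\<omega> \<in> space M" and fin: "passage_time S (ereal t) \<omega> < \<infinity>" and t: "0 \<le> t"
    and r: "0 \<le> r" "r \<noteq> hit t \<omega>"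
  shows "S r \<omega> \<le> t \<longleftrightarrow> r \<le> hit t \<omega>"
proof -
  have "S r \<omega> \<le> t" if "r < hit t \<omega>"
    using S_before_passage[OF \<omega>, of "ereal t" r] that t r(1) unfolding ereal_hit[OF fin, symmetric] by simp
  moreover have "t < S r \<omega>" if "hit t \<omega> < r"
    using S_after_passage[OF \<omega>, of "ereal t" r] that unfolding ereal_hit[OF fin, symmetric] by simp
  ultimately show ?thesis using r(2) by force
qed

text \<open>The indicator of \<open>{(r, \<omega>). 0 < r \<and> S r \<omega> \<le> t}\<close>, which up to a null set is the region below
  the first passage time over \<open>t\<close>; \<open>max\<close> keeps it jointly measurable.\<close>

definition below :: "real \<Rightarrow> real \<times> 'w \<Rightarrow> real" where
  "below t p = indicator {0<..} (fst p) * indicator {..t} (S (max 0 (fst p)) (snd p))"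

lemma below_nonneg: "0 \<le> below t p" by (simp add: below_def)

lemma S_pair_measurable: "(\<lambda>p. S (max 0 (fst p)) (snd p)) \<in> borel_measurable (lborel \<Otimes>\<^sub>M M)"
  by (rule S_joint_M) auto

lemma below_measurable [measurable]: "below t \<in> borel_measurable (lborel \<Otimes>\<^sub>M M)"
  unfolding below_def[abs_def] using S_pair_measurable by measurable

text \<open>For t \<ge> 0 the integral is the expected passage time. The bound on the probability of
  S r \<le> t is a multiple of an exponential density in r, whose total mass is 1.\<close>

lemma integrable_below: "integrable (lborel \<Otimes>\<^sub>M M) (below t)"
proof (rule integrableI_nonneg)
  let ?\<psi> = "laplace_exponent \<nu> 1"
  have \<psi>: "0 < ?\<psi>" by (rule laplace_exponent_pos[OF H0]) simp
  have "(\<integral>\<^sup>+p. ennreal (below t p) \<partial>(lborel \<Otimes>\<^sub>M M)) = (\<integral>\<^sup>+r. \<integral>\<^sup>+\<omega>. ennreal (below t (r, \<omega>)) \<partial>M \<partial>lborel)"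
    by (rule nn_integral_fst[symmetric]) measurable
  also have "\<dots> \<le> (\<integral>\<^sup>+r. ennreal (exp t / ?\<psi>) * ennreal (exponential_density ?\<psi> r) \<partial>lborel)"
  proof (rule nn_integral_mono)
    fix r :: real
    show "(\<integral>\<^sup>+\<omega>. ennreal (below t (r, \<omega>)) \<partial>M) \<le> ennreal (exp t / ?\<psi>) * ennreal (exponential_density ?\<psi> r)"
    proof (cases "0 < r")
      case True
      have [measurable]: "S r \<in> borel_measurable M" using True by (simp add: S_measurable)
      have "(\<integral>\<^sup>+\<omega>. ennreal (below t (r, \<omega>)) \<partial>M) = (\<integral>\<^sup>+\<omega>. indicator {\<omega>\<in>space M. S r \<omega> \<le> t} \<omega> \<partial>M)"
        by (rule nn_integral_cong) (use True in \<open>auto simp: below_def indicator_def\<close>)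
      also have "\<dots> = ennreal (measure M {\<omega>\<in>space M. S r \<omega> \<le> t})"
        by (simp add: emeasure_eq_measure)
      also have "\<dots> \<le> ennreal (exp t * exp (- r * ?\<psi>))"
        by (rule ennreal_leI[OF prob_S_le[OF True]])
      also have "exp t * exp (- r * ?\<psi>) = exp t / ?\<psi> * exponential_density ?\<psi> r"
        using \<psi> True by (simp add: exponential_density_def)
      also have "ennreal \<dots> = ennreal (exp t / ?\<psi>) * ennreal (exponential_density ?\<psi> r)"
        using \<psi> by (intro ennreal_mult) (auto simp: exponential_density_def)
      finally show ?thesis .
    qed (simp add: below_def)
  qed
  also have "\<dots> = ennreal (exp t / ?\<psi>) * emeasure (density lborel (\<lambda>r. ennreal (exponential_density ?\<psi> r))) UNIV"
    by (subst emeasure_density, simp_all add: nn_integral_cmult)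
  also have "emeasure (density lborel (\<lambda>r. ennreal (exponential_density ?\<psi> r))) UNIV = 1"
    using prob_space.emeasure_space_1[OF prob_space_exponential_density[OF \<psi>]] by simp
  finally show "(\<integral>\<^sup>+p. ennreal (below t p) \<partial>(lborel \<Otimes>\<^sub>M M)) < \<infinity>"
    by (rule le_less_trans) simp
qed (auto simp: below_nonneg)

lemma integrable_below_mult:
  fixes f :: "real \<times> 'w \<Rightarrow> real"
  assumes f: "f \<in> borel_measurable (lborel \<Otimes>\<^sub>M M)" and bd: "AE p in lborel \<Otimes>\<^sub>M M. below t p \<noteq> 0 \<longrightarrow> \<bar>f p\<bar> \<le> C"
  shows "integrable (lborel \<Otimes>\<^sub>M M) (\<lambda>p. below t p * f p)"
proof (rule Bochner_Integration.integrable_bound[OF integrable_mult_right[OF integrable_below, of C t]])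
  show "AE p in lborel \<Otimes>\<^sub>M M. norm (below t p * f p) \<le> norm (C * below t p)"
    using bd
  proof eventually_elim
    case (elim p)
    then show ?case
      by (cases "below t p = 0") (auto simp: abs_mult mult.commute intro!: mult_right_mono intro: order_trans[OF _ abs_ge_self])
  qed
qed (use f in measurable)

section \<open>Dynkin's formula for the subordinator\<close>

interpretation LM: pair_sigma_finite lborel M ..

text \<open>Dynkin's formula at the first passage time, obtained by integrating
  \<open>(h (S (r + d)) - h (S r)) / d\<close> over \<open>r\<close> below the passage time in two ways.\<close>

lemma dynkin_passage:
  fixes h hL :: "real \<Rightarrow> real"
  assumes t: "0 \<le> t"
    and h: "continuous_on UNIV h" "\<And>s. \<bar>h s\<bar> \<le> C" and hL: "continuous_on UNIV hL" "\<And>s. \<bar>hL s\<bar> \<le> C"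
    and gen: "\<And>e. 0 < e \<Longrightarrow> \<exists>d0>0. \<forall>d s. 0 < d \<and> d < d0 \<and> 0 \<le> s \<longrightarrow>
        \<bar>(\<integral>\<omega>. h (s + S d \<omega>) \<partial>M) - h s - d * hL s\<bar> \<le> e * d"
  shows "(\<integral>\<omega>. h (S (hit t \<omega>) \<omega>) \<partial>M)
    = h 0 + (\<integral>p. below t p * hL (S (max 0 (fst p)) (snd p)) \<partial>(lborel \<Otimes>\<^sub>M M))"
proof -
  let ?S = "\<lambda>p. S (max 0 (fst p)) (snd p)"
  let ?d = "\<lambda>n. 1 / real (Suc n)"
  have d0: "0 < ?d n" for n by simp
  have [measurable]: "h \<in> borel_measurable borel" "hL \<in> borel_measurable borel"
    using h(1) hL(1) by (auto intro: borel_measurable_continuous_onI)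
  note [measurable] = S_pair_measurable
  have [measurable]: "(\<lambda>p. S (max 0 (fst p + c)) (snd p)) \<in> borel_measurable (lborel \<Otimes>\<^sub>M M)" for c
    by (rule S_joint_M) auto
  let ?D = "\<lambda>n p. real (Suc n) * (h (S (max 0 (fst p + ?d n)) (snd p)) - h (?S p))"
  have Dbd: "\<bar>?D n p\<bar> \<le> real (Suc n) * (2 * C)" for n p
  proof -
    have "\<bar>h (S (max 0 (fst p + ?d n)) (snd p)) - h (?S p)\<bar> \<le> 2 * C"
      using h(2)[of "S (max 0 (fst p + ?d n)) (snd p)"] h(2)[of "?S p"] by linarith
    then show ?thesis by (simp add: abs_mult mult_left_mono del: of_nat_Suc)
  qed
  have intD: "integrable (lborel \<Otimes>\<^sub>M M) (\<lambda>p. below t p * ?D n p)" for n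
    by (rule integrable_below_mult[where C = "real (Suc n) * (2 * C)"]) (use Dbd in auto)
  have intL: "integrable (lborel \<Otimes>\<^sub>M M) (\<lambda>p. below t p * hL (?S p))"
    by (rule integrable_below_mult[where C = C]) (use hL(2) in auto)
  define J where "J n = (\<integral>p. below t p * ?D n p \<partial>(lborel \<Otimes>\<^sub>M M))" for n
  \<comment> \<open>Here the expectation is the inner integral. Replacing the increment by an
    independent copy turns the difference quotient into G (S r), uniformly e'-close to hL (S r) on
    the region of finite total mass I.\<close>
  have "J \<longlonglongrightarrow> (\<integral>p. below t p * hL (?S p) \<partial>(lborel \<Otimes>\<^sub>M M))"
  proof (rule LIMSEQ_I)
    fix e :: real assume e: "0 < e"
    define I where "I = (\<integral>p. below t p \<partial>(lborel \<Otimes>\<^sub>M M))"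
    have I: "0 \<le> I" unfolding I_def by (rule integral_nonneg_AE) (simp add: below_nonneg)
    define e' where "e' = e / (2 * (I + 1))"
    have e': "0 < e'" using e I by (simp add: e'_def)
    obtain d0 where d0': "0 < d0" "\<And>d s. 0 < d \<Longrightarrow> d < d0 \<Longrightarrow> 0 \<le> s \<Longrightarrow>
        \<bar>(\<integral>\<omega>. h (s + S d \<omega>) \<partial>M) - h s - d * hL s\<bar> \<le> e' * d"
      using gen[OF e'] by blast
    obtain n0 where n0: "?d n0 < d0" using nat_approx_posE[OF d0'(1)] by blast
    have "\<bar>J n - (\<integral>p. below t p * hL (?S p) \<partial>(lborel \<Otimes>\<^sub>M M))\<bar> < e" if n: "n0 \<le> n" for n
    proof -
      have "?d n \<le> ?d n0" using n by (simp add: frac_le)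
      then have dn: "?d n < d0" using n0 by linarith
      define G where "G s = real (Suc n) * ((\<integral>\<omega>. h (s + S (?d n) \<omega>) \<partial>M) - h s)" for s
      have G: "\<bar>G s - hL s\<bar> \<le> e'" if "0 \<le> s" for s
      proof -
        have "G s - hL s = real (Suc n) * ((\<integral>\<omega>. h (s + S (?d n) \<omega>) \<partial>M) - h s - ?d n * hL s)"
          unfolding G_def by (simp add: right_diff_distrib del: of_nat_Suc)
        also have "\<bar>\<dots>\<bar> \<le> real (Suc n) * (e' * ?d n)"
          unfolding abs_mult using mult_left_mono[OF d0'(2)[OF d0 dn that], of "real (Suc n)"]
          by (simp del: of_nat_Suc)
        finally show ?thesis by simp
      qed
      have Gm [measurable]: "G \<in> borel_measurable borel"
      proof -
        have [measurable]: "S (?d n) \<in> borel_measurable M" by (rule S_measurable) simp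
        show ?thesis unfolding G_def by measurable
      qed
      have Gbd: "AE p in lborel \<Otimes>\<^sub>M M. below t p \<noteq> 0 \<longrightarrow> \<bar>G (?S p)\<bar> \<le> C + e'"
      proof (rule AE_I2, rule impI)
        fix p :: "real \<times> 'w" assume "p \<in> space (lborel \<Otimes>\<^sub>M M)"
        then have "0 \<le> ?S p" by (intro S_nonneg) (auto simp: space_pair_measure)
        then show "\<bar>G (?S p)\<bar> \<le> C + e'" using G[of "?S p"] hL(2)[of "?S p"] by linarith
      qed
      have intG: "integrable (lborel \<Otimes>\<^sub>M M) (\<lambda>p. below t p * G (?S p))"
        by (rule integrable_below_mult[OF _ Gbd]) measurable
      have "J n = (\<integral>r. (\<integral>\<omega>. below t (r, \<omega>) * ?D n (r, \<omega>) \<partial>M) \<partial>lborel)"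
        unfolding J_def by (rule LM.integral_fst'[OF intD, symmetric])
      also have "\<dots> = (\<integral>r. (\<integral>\<omega>. below t (r, \<omega>) * G (?S (r, \<omega>)) \<partial>M) \<partial>lborel)"
      proof (rule Bochner_Integration.integral_cong[OF refl])
        fix r :: real
        show "(\<integral>\<omega>. below t (r, \<omega>) * ?D n (r, \<omega>) \<partial>M) = (\<integral>\<omega>. below t (r, \<omega>) * G (?S (r, \<omega>)) \<partial>M)"
        proof (cases "0 < r")
          case True
          \<comment> \<open>For fixed r the region is decided by S r, the first coordinate, while
            the second stands for the increment over a time 1/(n+1).\<close>
          let ?F = "\<lambda>p. indicator {..t} (fst p) * (real (Suc n) * (h (fst p + snd p) - h (fst p)))"
          have Fb: "\<bar>?F p\<bar> \<le> real (Suc n) * (2 * C)" for p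
          proof -
            have "\<bar>h (fst p + snd p) - h (fst p)\<bar> \<le> 2 * C" using h(2)[of "fst p + snd p"] h(2)[of "fst p"] by linarith
            moreover from this have "0 \<le> 2 * C" by linarith
            ultimately show ?thesis by (auto simp: abs_mult indicator_def mult_left_mono simp del: of_nat_Suc)
          qed
          have Fm: "?F \<in> borel_measurable borel"
            unfolding borel_prod[symmetric] by measurable
          have "(\<integral>\<omega>. below t (r, \<omega>) * ?D n (r, \<omega>) \<partial>M) = (\<integral>\<omega>. ?F (S r \<omega>, S (r + ?d n) \<omega> - S r \<omega>) \<partial>M)"
            by (rule Bochner_Integration.integral_cong) (use True in \<open>auto simp: below_def max_absorb2 simp del: of_nat_Suc\<close>)
          also have "\<dots> = (\<integral>\<omega>. (\<integral>\<omega>'. ?F (S r \<omega>, S (?d n) \<omega>') \<partial>M) \<partial>M)"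
            by (rule integral_increment[OF Fm Fb]) (use True in auto)
          also have "\<dots> = (\<integral>\<omega>. below t (r, \<omega>) * G (?S (r, \<omega>)) \<partial>M)"
          proof (rule Bochner_Integration.integral_cong[OF refl])
            fix \<omega>
            have [measurable]: "S (?d n) \<in> borel_measurable M" by (rule S_measurable) simp
            have "integrable M (\<lambda>\<omega>'. h (S r \<omega> + S (?d n) \<omega>'))"
              by (rule integrable_const_bound[of _ C]) (use h(2) in \<open>auto simp del: of_nat_Suc\<close>)
            then have "(\<integral>\<omega>'. h (S r \<omega> + S (?d n) \<omega>') - h (S r \<omega>) \<partial>M) = (\<integral>\<omega>'. h (S r \<omega> + S (?d n) \<omega>') \<partial>M) - h (S r \<omega>)"
              by (simp add: prob_space)
            then show "(\<integral>\<omega>'. ?F (S r \<omega>, S (?d n) \<omega>') \<partial>M) = below t (r, \<omega>) * G (?S (r, \<omega>))"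
              using True by (simp add: below_def G_def max_absorb2 del: of_nat_Suc)
          qed
          finally show ?thesis .
        qed (simp add: below_def)
      qed
      also have "\<dots> = (\<integral>p. below t p * G (?S p) \<partial>(lborel \<Otimes>\<^sub>M M))"
        by (rule LM.integral_fst'[OF intG])
      finally have "\<bar>J n - (\<integral>p. below t p * hL (?S p) \<partial>(lborel \<Otimes>\<^sub>M M))\<bar>
          = \<bar>\<integral>p. below t p * G (?S p) - below t p * hL (?S p) \<partial>(lborel \<Otimes>\<^sub>M M)\<bar>"
        using intG intL by simp
      also have "\<dots> \<le> (\<integral>p. e' * below t p \<partial>(lborel \<Otimes>\<^sub>M M))"
      proof (rule integral_abs_bound[THEN order_trans], rule integral_mono)
        show "integrable (lborel \<Otimes>\<^sub>M M) (\<lambda>p. \<bar>below t p * G (?S p) - below t p * hL (?S p)\<bar>)"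
          using intG intL by simp
        show "integrable (lborel \<Otimes>\<^sub>M M) (\<lambda>p. e' * below t p)" by (intro integrable_mult_right integrable_below)
        fix p :: "real \<times> 'w" assume "p \<in> space (lborel \<Otimes>\<^sub>M M)"
        then have "0 \<le> ?S p" by (intro S_nonneg) (auto simp: space_pair_measure)
        from mult_left_mono[OF G[OF this] below_nonneg[of t p]]
        show "\<bar>below t p * G (?S p) - below t p * hL (?S p)\<bar> \<le> e' * below t p"
          using below_nonneg[of t p] by (simp add: right_diff_distrib[symmetric] abs_mult mult.commute)
      qed
      also have "\<dots> = e' * I" by (simp add: I_def)
      also have "\<dots> \<le> e / 2" using e I by (simp add: e'_def field_simps)
      also have "\<dots> < e" using e by simp
      finally show ?thesis .
    qed
    then show "\<exists>no. \<forall>n\<ge>no. norm (J n - (\<integral>p. below t p * hL (?S p) \<partial>(lborel \<Otimes>\<^sub>M M))) < e" by auto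
  qed
  \<comment> \<open>Here the time integral is the inner one. Along a path the region is (0,
    \<open>hit t\<close>] up to one point, so the quotients telescope to averages just after
    \<open>hit t\<close> and just after 0, with limits h (S (\<open>hit t\<close>)) and h 0.\<close>
  moreover have "J \<longlonglongrightarrow> (\<integral>\<omega>. h (S (hit t \<omega>) \<omega>) - h 0 \<partial>M)"
  proof -
    have J: "J n = (\<integral>\<omega>. (\<integral>r. below t (r, \<omega>) * ?D n (r, \<omega>) \<partial>lborel) \<partial>M)" for n
      unfolding J_def
      using LM.integral_snd[of "\<lambda>r \<omega>. below t (r, \<omega>) * ?D n (r, \<omega>)"] intD[of n]
      by (simp add: case_prod_beta')
    have jump: "(\<integral>r. below t (r, \<omega>) * ?D n (r, \<omega>) \<partial>lborel)
        = real (Suc n) * (\<integral>r. indicator {hit t \<omega><..hit t \<omega> + ?d n} r * h (S (max 0 r) \<omega>) \<partial>lborel)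
          - real (Suc n) * (\<integral>r. indicator {0<..0 + ?d n} r * h (S (max 0 r) \<omega>) \<partial>lborel)"
      and qm: "(\<lambda>r. h (S (max 0 r) \<omega>)) \<in> borel_measurable borel"
      if \<omega>: "\<omega> \<in> space M" and fin: "passage_time S (ereal t) \<omega> < \<infinity>" for \<omega> n
    proof -
      show qm: "(\<lambda>r. h (S (max 0 r) \<omega>)) \<in> borel_measurable borel"
        using S_joint_M[of "\<lambda>r. r" borel "\<lambda>_. \<omega>"] \<omega> by measurable
      have [measurable]: "(\<lambda>r. below t (r, \<omega>)) \<in> borel_measurable borel"
        using measurable_compose[OF measurable_Pair2'[OF \<omega>] below_measurable[of t]] by simp
      note [measurable] = qm
      have qm2 [measurable]: "(\<lambda>r. h (S (max 0 (r + ?d n)) \<omega>)) \<in> borel_measurable borel"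
        by (rule measurable_compose[OF _ qm]) measurable
      have "(\<integral>r. below t (r, \<omega>) * ?D n (r, \<omega>) \<partial>lborel)
          = (\<integral>r. real (Suc n) * (indicator {0<..hit t \<omega>} r * (h (S (max 0 (r + ?d n)) \<omega>) - h (S (max 0 r) \<omega>))) \<partial>lborel)"
      proof (rule integral_cong_AE)
        show "AE r in lborel. below t (r, \<omega>) * ?D n (r, \<omega>)
            = real (Suc n) * (indicator {0<..hit t \<omega>} r * (h (S (max 0 (r + ?d n)) \<omega>) - h (S (max 0 r) \<omega>)))"
          using AE_lborel_singleton[of "hit t \<omega>"]
        proof eventually_elim
          case (elim r)
          then have "below t (r, \<omega>) = indicator {0<..hit t \<omega>} r"
            using S_le_iff_hit[OF \<omega> fin t, of r] by (auto simp: below_def indicator_def max_absorb2)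
          then show ?case by simp
        qed
      qed (simp_all del: of_nat_Suc)
      also have "\<dots> = real (Suc n) * ((\<integral>r. indicator {hit t \<omega><..hit t \<omega> + ?d n} r * h (S (max 0 r) \<omega>) \<partial>lborel)
          - (\<integral>r. indicator {0<..0 + ?d n} r * h (S (max 0 r) \<omega>) \<partial>lborel))"
        using integral_telescope_shift[OF qm h(2) hit_nonneg d0, of t \<omega> n] by simp
      finally show "(\<integral>r. below t (r, \<omega>) * ?D n (r, \<omega>) \<partial>lborel)
        = real (Suc n) * (\<integral>r. indicator {hit t \<omega><..hit t \<omega> + ?d n} r * h (S (max 0 r) \<omega>) \<partial>lborel)
          - real (Suc n) * (\<integral>r. indicator {0<..0 + ?d n} r * h (S (max 0 r) \<omega>) \<partial>lborel)"
        by (simp only: right_diff_distrib)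
    qed
    have hrc: "((\<lambda>r. h (S (max 0 r) \<omega>)) \<longlongrightarrow> h (S a \<omega>)) (at_right a)" if "\<omega> \<in> space M" "0 \<le> a" for \<omega> a
    proof -
      have "((\<lambda>r. S (max 0 r) \<omega>) \<longlongrightarrow> S a \<omega>) (at_right a)"
        by (rule Lim_transform_eventually[OF S_right_continuous[OF that]])
           (use that in \<open>auto simp: eventually_at_filter max_absorb2\<close>)
      moreover have "isCont h (S a \<omega>)" using h(1) by (simp add: continuous_on_eq_continuous_at)
      ultimately show ?thesis by (rule isCont_tendsto_compose[rotated])
    qed
    have "(\<lambda>n. \<integral>\<omega>. (\<integral>r. below t (r, \<omega>) * ?D n (r, \<omega>) \<partial>lborel) \<partial>M) \<longlonglongrightarrow> (\<integral>\<omega>. h (S (hit t \<omega>) \<omega>) - h 0 \<partial>M)"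
    \<comment> \<open>Each of the two averages is bounded by C, whatever n is.\<close>
    proof (rule integral_dominated_convergence[where w = "\<lambda>_. 2 * C"])
      have "(\<lambda>\<omega>. S (hit t \<omega>) \<omega>) \<in> borel_measurable M" by (rule S_hit_measurable) (auto simp: S_measurable)
      then show "(\<lambda>\<omega>. h (S (hit t \<omega>) \<omega>) - h 0) \<in> borel_measurable M" by measurable
      show "(\<lambda>\<omega>. \<integral>r. below t (r, \<omega>) * ?D n (r, \<omega>) \<partial>lborel) \<in> borel_measurable M" for n
        using borel_measurable_integrable[OF LM.integrable_snd[of "\<lambda>r \<omega>. below t (r, \<omega>) * ?D n (r, \<omega>)"]] intD[of n]
        by (simp add: case_prod_beta')
      show "AE \<omega> in M. (\<lambda>n. \<integral>r. below t (r, \<omega>) * ?D n (r, \<omega>) \<partial>lborel) \<longlonglongrightarrow> h (S (hit t \<omega>) \<omega>) - h 0"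
      proof (rule AE_mp[OF AE_passage_time_finite[of t]], rule AE_I2, rule impI)
        fix \<omega> assume \<omega>: "\<omega> \<in> space M" "passage_time S (ereal t) \<omega> < \<infinity>"
        show "(\<lambda>n. \<integral>r. below t (r, \<omega>) * ?D n (r, \<omega>) \<partial>lborel) \<longlonglongrightarrow> h (S (hit t \<omega>) \<omega>) - h 0"
          unfolding jump[OF \<omega>]
          using average_right_limit(1)[OF qm[OF \<omega>] h(2) hrc[OF \<omega>(1) hit_nonneg[of t \<omega>]]]
            average_right_limit(1)[OF qm[OF \<omega>] h(2) hrc[OF \<omega>(1) order_refl]] S_0[OF \<omega>(1)]
          by (intro tendsto_diff) auto
      qed
      show "AE \<omega> in M. norm (\<integral>r. below t (r, \<omega>) * ?D n (r, \<omega>) \<partial>lborel) \<le> 2 * C" for n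
      proof (rule AE_mp[OF AE_passage_time_finite[of t]], rule AE_I2, rule impI)
        fix \<omega> assume \<omega>: "\<omega> \<in> space M" "passage_time S (ereal t) \<omega> < \<infinity>"
        show "norm (\<integral>r. below t (r, \<omega>) * ?D n (r, \<omega>) \<partial>lborel) \<le> 2 * C"
          unfolding jump[OF \<omega>] real_norm_def
          using average_right_limit(2)[OF qm[OF \<omega>] h(2) hrc[OF \<omega>(1) hit_nonneg[of t \<omega>]], of n]
            average_right_limit(2)[OF qm[OF \<omega>] h(2) hrc[OF \<omega>(1) order_refl], of n] by linarith
      qed
    qed simp
    then show ?thesis unfolding J[symmetric] .
  qed
  ultimately have "(\<integral>p. below t p * hL (?S p) \<partial>(lborel \<Otimes>\<^sub>M M)) = (\<integral>\<omega>. h (S (hit t \<omega>) \<omega>) - h 0 \<partial>M)"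
    by (rule LIMSEQ_unique)
  also have "\<dots> = (\<integral>\<omega>. h (S (hit t \<omega>) \<omega>) \<partial>M) - h 0"
  proof -
    have [measurable]: "(\<lambda>\<omega>. S (hit t \<omega>) \<omega>) \<in> borel_measurable M" by (rule S_hit_measurable) (auto simp: S_measurable)
    have "integrable M (\<lambda>\<omega>. h (S (hit t \<omega>) \<omega>))"
      by (rule integrable_const_bound[of _ C]) (use h(2) in auto)
    then show ?thesis by (simp add: prob_space)
  qed
  finally show ?thesis by simp
qed

end

section \<open>Subordinate semigroups and domain solutions\<close>

lemma generator_rel_unique:
  fixes E :: "'a::metric_space set"
  assumes 1: "generator_rel E R u v" and 2: "generator_rel E R u w"
  shows "v = w"
proof
  fix x
  show "v x = w x"
  proof (cases "x \<in> E")
    case True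
    then have "((\<lambda>r. (R r u x - u x) / r) \<longlongrightarrow> v x) (at_right 0)" "((\<lambda>r. (R r u x - u x) / r) \<longlongrightarrow> w x) (at_right 0)"
      using 1 2 by (auto simp: generator_rel_def intro: tendsto_uniform_limitI)
    then show ?thesis by (rule tendsto_unique[rotated]) simp
  next
    case False
    then show ?thesis using 1 2 by (auto simp: generator_rel_def C_infty_off)
  qed
qed

lemma generator_eqI:
  fixes E :: "'a::metric_space set"
  shows "generator_rel E R u v \<Longrightarrow> generator E R u = v"
  unfolding generator_def by (rule the_equality) (auto intro: generator_rel_unique)

lemma generator_rel_generator:
  fixes E :: "'a::metric_space set"
  shows "u \<in> generator_dom E R \<Longrightarrow> generator_rel E R u (generator E R u)"
  using generator_eqI by (auto simp: generator_dom_def)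

section \<open>Dynkin's formula and strong continuity under subordination\<close>

text \<open>Q is compared with the expectation for r > 0 and at points of E, which is where a
  semigroup given by densities provides it and where a generator, a limit from the right on E,
  evaluates it.\<close>

locale subordination = subordinator M \<nu> S + contraction_semigroup E K
  for M :: "'w measure" and \<nu> S and E :: "'a::metric_space set" and K +
  fixes Q :: "real \<Rightarrow> ('a \<Rightarrow> real) \<Rightarrow> 'a \<Rightarrow> real"
  assumes Q: "\<And>r u z. 0 < r \<Longrightarrow> u \<in> C_infty E \<Longrightarrow> z \<in> E \<Longrightarrow> Q r u z = (\<integral>\<omega>. K (S r \<omega>) u z \<partial>M)"
begin

interpretation LM: pair_sigma_finite lborel M ..

lemma S_pair_nonneg: "p \<in> space (lborel \<Otimes>\<^sub>M M) \<Longrightarrow> 0 \<le> S (max 0 (fst p)) (snd p)"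
  by (rule S_nonneg) (auto simp: space_pair_measure)

lemma expectation_C_infty:
  "0 \<le> r \<Longrightarrow> u \<in> C_infty E \<Longrightarrow> (\<lambda>z. \<integral>\<omega>. K (S r \<omega>) u z \<partial>M) \<in> C_infty E"
  by (rule time_integral_C_infty[OF _ S_measurable S_nonneg finite_measure_axioms])

lemma K_max_measurable:
  assumes u: "u \<in> C_infty E"
  shows "continuous_on UNIV (\<lambda>s. K (max 0 s) u z)" "(\<lambda>s. K (max 0 s) u z) \<in> borel_measurable borel"
proof -
  show "continuous_on UNIV (\<lambda>s. K (max 0 s) u z)"
    by (rule continuous_on_compose2[OF continuous_on_time[OF u]]) (auto intro!: continuous_intros)
  then show "(\<lambda>s. K (max 0 s) u z) \<in> borel_measurable borel" by (rule borel_measurable_continuous_onI)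
qed

text \<open>Membership in the domain bounds E K (S d) u - u - d v by e d uniformly on E. Applying K
  s, a contraction that commutes with the expectation, gives the same bound for the path of K at
  every starting value s.\<close>

lemma generator_rel_dynkin:
  assumes rel: "generator_rel E Q u v" and t: "0 \<le> t"
  shows "(\<integral>\<omega>. K (S (hit t \<omega>) \<omega>) u z \<partial>M)
    = u z + (\<integral>p. below t p * K (S (max 0 (fst p)) (snd p)) v z \<partial>(lborel \<Otimes>\<^sub>M M))"
proof -
  have u: "u \<in> C_infty E" and v: "v \<in> C_infty E"
    and lim: "uniform_limit E (\<lambda>r x. (Q r u x - u x) / r) v (at_right 0)"
    using rel by (auto simp: generator_rel_def)
  obtain C1 where C1: "\<And>x. \<bar>u x\<bar> \<le> C1" using C_infty_bounded[OF u] by blast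
  obtain C2 where C2: "\<And>x. \<bar>v x\<bar> \<le> C2" using C_infty_bounded[OF v] by blast
  have "(\<integral>\<omega>. K (max 0 (S (hit t \<omega>) \<omega>)) u z \<partial>M)
    = K (max 0 0) u z + (\<integral>p. below t p * K (max 0 (S (max 0 (fst p)) (snd p))) v z \<partial>(lborel \<Otimes>\<^sub>M M))"
  proof (rule dynkin_passage[where C = "max C1 C2", OF t])
    show "\<bar>K (max 0 s) u z\<bar> \<le> max C1 C2" for s
      using contraction[OF _ u C1, of "max 0 s" z] by auto
    show "\<bar>K (max 0 s) v z\<bar> \<le> max C1 C2" for s
      using contraction[OF _ v C2, of "max 0 s" z] by auto
    fix e :: real assume e: "0 < e"
    have "\<forall>\<^sub>F r in at_right 0. \<forall>x\<in>E. dist ((Q r u x - u x) / r) (v x) < e"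
      using lim e by (rule uniform_limitD)
    then obtain d0 where d0: "d0 > 0" "\<And>d x. 0 < d \<Longrightarrow> d < d0 \<Longrightarrow> x \<in> E \<Longrightarrow> dist ((Q d u x - u x) / d) (v x) < e"
      unfolding eventually_at_right_field by auto
    have "\<bar>(\<integral>\<omega>. K (max 0 (s + S d \<omega>)) u z \<partial>M) - K (max 0 s) u z - d * K (max 0 s) v z\<bar> \<le> e * d"
      if d: "0 < d" "d < d0" and s: "0 \<le> s" for d s
    proof -
      let ?q = "\<lambda>x. \<integral>\<omega>. K (S d \<omega>) u x \<partial>M"
      have q: "?q \<in> C_infty E" using d u by (intro expectation_C_infty) auto
      \<comment> \<open>The remainder of norm at most e d, nested so that linearity can be applied
        to two functions at a time.\<close>
      let ?g = "\<lambda>x. 1 * (1 * ?q x + (- 1) * u x) + (- d) * v x"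
      have g1: "(\<lambda>x. 1 * ?q x + (- 1) * u x) \<in> C_infty E" by (rule C_infty_lincomb[OF q u])
      have g: "?g \<in> C_infty E" by (rule C_infty_lincomb[OF g1 v])
      have gb: "\<bar>?g x\<bar> \<le> e * d" for x
      proof (cases "x \<in> E")
        case True
        have "\<bar>(?q x - u x) / d - v x\<bar> \<le> e"
          using d0(2)[OF d True] Q[OF d(1) u True] by (simp add: dist_real_def)
        then have "d * \<bar>(?q x - u x) / d - v x\<bar> \<le> d * e" using d by (intro mult_left_mono) auto
        also have "d * \<bar>(?q x - u x) / d - v x\<bar> = \<bar>d * ((?q x - u x) / d - v x)\<bar>" using d by (simp add: abs_mult)
        also have "d * ((?q x - u x) / d - v x) = ?g x" using d by (simp add: field_simps)
        finally show ?thesis by (simp add: mult.commute)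
      next
        case False
        then show ?thesis using C_infty_off[OF g False] e d by simp
      qed
      have "K s ?g z = 1 * K s (\<lambda>x. 1 * ?q x + (- 1) * u x) z + (- d) * K s v z"
        using lincomb[OF s g1 v, of 1 "- d"] by metis
      also have "K s (\<lambda>x. 1 * ?q x + (- 1) * u x) z = K s ?q z - K s u z"
        using fun_cong[OF lincomb[OF s q u, of 1 "- 1"], of z] by simp
      also have "K s ?q z = (\<integral>\<omega>. K (s + S d \<omega>) u z \<partial>M)"
        using d by (intro time_integral_commute[OF u s S_measurable S_nonneg finite_measure_axioms]) auto
      also have "\<dots> = (\<integral>\<omega>. K (max 0 (s + S d \<omega>)) u z \<partial>M)"
        by (rule Bochner_Integration.integral_cong[OF refl]) (use s d S_nonneg[of _ d] in \<open>simp add: max_absorb2\<close>)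
      finally have "K s ?g z = (\<integral>\<omega>. K (max 0 (s + S d \<omega>)) u z \<partial>M) - K (max 0 s) u z - d * K (max 0 s) v z"
        using s by (simp add: max_absorb2)
      then show ?thesis using contraction[OF s g gb, of z] by simp
    qed
    then show "\<exists>d0>0. \<forall>d s. 0 < d \<and> d < d0 \<and> 0 \<le> s \<longrightarrow>
        \<bar>(\<integral>\<omega>. K (max 0 (s + S d \<omega>)) u z \<partial>M) - K (max 0 s) u z - d * K (max 0 s) v z\<bar> \<le> e * d"
      using d0(1) by blast
  qed (rule K_max_measurable(1)[OF u] K_max_measurable(1)[OF v])+
  moreover have "(\<integral>\<omega>. K (max 0 (S (hit t \<omega>) \<omega>)) u z \<partial>M) = (\<integral>\<omega>. K (S (hit t \<omega>) \<omega>) u z \<partial>M)"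
    by (rule Bochner_Integration.integral_cong[OF refl]) (simp only: max_absorb2 S_nonneg hit_nonneg)
  moreover have "(\<integral>p. below t p * K (max 0 (S (max 0 (fst p)) (snd p))) v z \<partial>(lborel \<Otimes>\<^sub>M M))
      = (\<integral>p. below t p * K (S (max 0 (fst p)) (snd p)) v z \<partial>(lborel \<Otimes>\<^sub>M M))"
    by (rule Bochner_Integration.integral_cong[OF refl])
       (simp only: max_absorb2 S_pair_nonneg)
  ultimately show ?thesis by (simp only: at_0[OF u] max.idem)
qed

text \<open>S (1/(n+1)) tends to 0 on every path, so the event that it reaches d has small
  probability; by monotonicity this covers all smaller r. That event costs 2 C times e/(4 C), the
  rest of the space e/2.\<close>

lemma expectation_strong:
  assumes f: "f \<in> C_infty E" and e: "0 < e"
  shows "\<exists>d>0. \<forall>r z. 0 \<le> r \<and> r < d \<longrightarrow> \<bar>(\<integral>\<omega>. K (S r \<omega>) f z \<partial>M) - f z\<bar> \<le> e"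
proof -
  obtain C where C: "C > 0" "\<And>x. \<bar>f x\<bar> \<le> C" using C_infty_bounded[OF f] by blast
  have "e / 2 > 0" using e by simp
  from strong[OF f this] obtain d where d: "d > 0" "\<And>s x. 0 \<le> s \<Longrightarrow> s < d \<Longrightarrow> \<bar>K s f x - f x\<bar> \<le> e / 2"
    by blast
  let ?A = "\<lambda>n. {\<omega>\<in>space M. d \<le> S (1 / real (Suc n)) \<omega>}"
  have [measurable]: "S (1 / real (Suc n)) \<in> borel_measurable M" for n by (rule S_measurable) simp
  have "(\<lambda>n. measure M (?A n)) \<longlonglongrightarrow> measure M (\<Inter>n. ?A n)"
  proof (rule finite_Lim_measure_decseq)
    show "decseq ?A" unfolding decseq_def
    proof (intro allI impI subsetI, clarify)
      fix m n \<omega> assume a: "m \<le> n" "\<omega> \<in> space M" "d \<le> S (1 / real (Suc n)) \<omega>"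
      have "S (1 / real (Suc n)) \<omega> \<le> S (1 / real (Suc m)) \<omega>" using a by (intro S_mono) (auto simp: frac_le)
      then show "d \<le> S (1 / real (Suc m)) \<omega>" using a by simp
    qed
  qed (auto simp del: of_nat_Suc)
  also have "(\<Inter>n. ?A n) = {}"
  proof -
    have False if a: "\<omega> \<in> (\<Inter>n. ?A n)" for \<omega>
    proof -
      have \<omega>: "\<omega> \<in> space M" using a by blast
      have "filterlim (\<lambda>n. 1 / real (Suc n)) (at_right 0) sequentially"
        using LIMSEQ_Suc[OF lim_1_over_n] by (auto simp: filterlim_at)
      from filterlim_compose[OF S_right_continuous[OF \<omega> order_refl] this]
      have "(\<lambda>n. S (1 / real (Suc n)) \<omega>) \<longlonglongrightarrow> 0" using S_0[OF \<omega>] by simp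
      moreover have "d \<le> S (1 / real (Suc n)) \<omega>" for n using a by blast
      ultimately have "d \<le> 0" by (intro LIMSEQ_le_const) auto
      then show False using d by simp
    qed
    then show ?thesis by blast
  qed
  finally have "(\<lambda>n. measure M (?A n)) \<longlonglongrightarrow> 0" by simp
  then have "\<forall>\<^sub>F n in sequentially. measure M (?A n) < e / (4 * C)"
    by (rule order_tendstoD) (use e C in auto)
  then obtain n where n: "measure M (?A n) < e / (4 * C)" by (auto dest: eventually_happens)
  have "\<bar>(\<integral>\<omega>. K (S r \<omega>) f z \<partial>M) - f z\<bar> \<le> e" if r: "0 \<le> r" "r < 1 / real (Suc n)" for r z
  proof -
    have int: "integrable M (\<lambda>\<omega>. K (S r \<omega>) f z)"
      by (rule integrable_time[OF f S_measurable S_nonneg finite_measure_axioms]) (use r in auto)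
    have "\<bar>(\<integral>\<omega>. K (S r \<omega>) f z \<partial>M) - f z\<bar> = \<bar>\<integral>\<omega>. K (S r \<omega>) f z - f z \<partial>M\<bar>"
      using int by (simp add: prob_space)
    also have "\<dots> \<le> (\<integral>\<omega>. e / 2 + 2 * C * indicator (?A n) \<omega> \<partial>M)"
    proof (rule integral_abs_bound[THEN order_trans], rule integral_mono)
      show "integrable M (\<lambda>\<omega>. \<bar>K (S r \<omega>) f z - f z\<bar>)" using int by simp
      show "integrable M (\<lambda>\<omega>. e / 2 + 2 * C * indicator (?A n) \<omega>)"
        by (intro Bochner_Integration.integrable_add integrable_mult_right integrable_real_indicator)
           (auto simp: less_top[symmetric] simp del: of_nat_Suc)
      fix \<omega> assume \<omega>: "\<omega> \<in> space M"
      show "\<bar>K (S r \<omega>) f z - f z\<bar> \<le> e / 2 + 2 * C * indicator (?A n) \<omega>"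
      proof (cases "S r \<omega> < d")
        case True
        then have "\<bar>K (S r \<omega>) f z - f z\<bar> \<le> e / 2" using d(2)[OF S_nonneg[OF \<omega> r(1)]] by blast
        then show ?thesis using C(1) by (simp add: indicator_def)
      next
        case False
        have "S r \<omega> \<le> S (1 / real (Suc n)) \<omega>" using \<omega> r by (intro S_mono) auto
        then have "\<omega> \<in> ?A n" using False \<omega> by simp
        moreover have "\<bar>K (S r \<omega>) f z\<bar> \<le> C" by (rule contraction[OF S_nonneg[OF \<omega> r(1)] f C(2)])
        ultimately show ?thesis using C(2)[of z] e by (simp add: indicator_def)
      qed
    qed
    also have "\<dots> = e / 2 + 2 * C * measure M (?A n)"
      by (subst Bochner_Integration.integral_add)
         (auto simp: prob_space Int_absorb2 less_top[symmetric] simp del: of_nat_Suc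
           intro!: integrable_mult_right integrable_real_indicator)
    also have "\<dots> \<le> e / 2 + 2 * C * (e / (4 * C))"
      using n C by (intro add_left_mono mult_left_mono) auto
    also have "\<dots> = e" using C by simp
    finally show ?thesis .
  qed
  then show ?thesis by (intro exI[of _ "1 / real (Suc n)"]) auto
qed

section \<open>Potentials and the domain of the generator\<close>

text \<open>The potential of f for the subordinated semigroup, cut off where S r > t. The cut-off
  makes it finite for bounded f and is invisible when K s f = 0 for all s \<ge> t.\<close>

definition potential :: "real \<Rightarrow> ('a \<Rightarrow> real) \<Rightarrow> 'a \<Rightarrow> real" where
  "potential t f z = (\<integral>p. below t p * K (S (max 0 (fst p)) (snd p)) f z \<partial>(lborel \<Otimes>\<^sub>M M))"

text \<open>\<open>below\<close> is the indicator of a set of finite measure, so a potential is a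
  time integral over a finite measure and the Riemann sum results apply.\<close>

lemma potential_restrict_space:
  fixes t :: real
  defines "\<Lambda> \<equiv> {p \<in> space (lborel \<Otimes>\<^sub>M M). below t p = 1}"
  shows "(\<integral>p. below t p * g p \<partial>(lborel \<Otimes>\<^sub>M M)) = (\<integral>p. g p \<partial>restrict_space (lborel \<Otimes>\<^sub>M M) \<Lambda>)"
    and "finite_measure (restrict_space (lborel \<Otimes>\<^sub>M M) \<Lambda>)"
    and "f \<in> borel_measurable (lborel \<Otimes>\<^sub>M M) \<Longrightarrow> f \<in> borel_measurable (restrict_space (lborel \<Otimes>\<^sub>M M) \<Lambda>)"
proof -
  have \<Lambda>: "\<Lambda> \<in> sets (lborel \<Otimes>\<^sub>M M)" unfolding \<Lambda>_def by measurable
  then have \<Lambda>': "\<Lambda> \<inter> space (lborel \<Otimes>\<^sub>M M) \<in> sets (lborel \<Otimes>\<^sub>M M)" by simp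
  have ind: "below t p = indicator \<Lambda> p" if "p \<in> space (lborel \<Otimes>\<^sub>M M)" for p
    using that by (auto simp: \<Lambda>_def indicator_def below_def)
  show "(\<integral>p. below t p * g p \<partial>(lborel \<Otimes>\<^sub>M M)) = (\<integral>p. g p \<partial>restrict_space (lborel \<Otimes>\<^sub>M M) \<Lambda>)"
    by (subst integral_restrict_space[OF \<Lambda>']) (auto simp: ind intro!: Bochner_Integration.integral_cong)
  have "integrable (lborel \<Otimes>\<^sub>M M) (indicator \<Lambda> :: _ \<Rightarrow> real)"
    using integrable_below[of t] by (rule Bochner_Integration.integrable_cong[THEN iffD1, rotated 2]) (auto simp: ind)
  then have "emeasure (lborel \<Otimes>\<^sub>M M) \<Lambda> < \<infinity>"
    using \<Lambda> by (simp add: integrable_indicator_iff sets.Int_space_eq2)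
  then show "finite_measure (restrict_space (lborel \<Otimes>\<^sub>M M) \<Lambda>)"
    using \<Lambda> by (intro finite_measureI)
      (simp add: space_restrict_space emeasure_restrict_space sets.Int_space_eq2 sets.Int_space_eq1 less_top)
  show "f \<in> borel_measurable (lborel \<Otimes>\<^sub>M M) \<Longrightarrow> f \<in> borel_measurable (restrict_space (lborel \<Otimes>\<^sub>M M) \<Lambda>)"
    by (rule measurable_restrict_space1)
qed

lemma
  assumes f: "f \<in> C_infty E"
  shows potential_C_infty: "potential t f \<in> C_infty E"
    and K_potential: "0 \<le> b \<Longrightarrow>
      K b (potential t f) z = (\<integral>p. below t p * K (b + S (max 0 (fst p)) (snd p)) f z \<partial>(lborel \<Otimes>\<^sub>M M))"
proof -
  let ?m = "restrict_space (lborel \<Otimes>\<^sub>M M) {p \<in> space (lborel \<Otimes>\<^sub>M M). below t p = 1}"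
  let ?X = "\<lambda>p. S (max 0 (fst p)) (snd p)"
  have X: "?X \<in> borel_measurable ?m" by (rule potential_restrict_space(3)[OF S_pair_measurable])
  have Xn: "0 \<le> ?X p" if "p \<in> space ?m" for p
    using that by (intro S_nonneg) (auto simp: space_restrict_space space_pair_measure)
  have eq: "potential t f = (\<lambda>z. \<integral>p. K (?X p) f z \<partial>?m)"
    unfolding potential_def[abs_def] potential_restrict_space(1) ..
  show "potential t f \<in> C_infty E"
    unfolding eq by (rule time_integral_C_infty[OF f X Xn potential_restrict_space(2)])
  show "K b (potential t f) z = (\<integral>p. below t p * K (b + ?X p) f z \<partial>(lborel \<Otimes>\<^sub>M M))" if "0 \<le> b"
    unfolding eq potential_restrict_space(1)
    by (rule time_integral_commute[OF f that X Xn potential_restrict_space(2)])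
qed

text \<open>Let \<phi> z r be the expectation of K (S r) f z. Since K s f vanishes for s \<ge> t,
  the potential is the integral of \<phi> over (0, \<infinity>), and applying Q h shifts it to (h,
  \<infinity>). The difference is minus the integral over (0, h], whose average tends to f z
  uniformly by strong continuity.\<close>

lemma generator_rel_potential:
  assumes f: "f \<in> C_infty E" and nil: "\<And>s z. t \<le> s \<Longrightarrow> 0 \<le> s \<Longrightarrow> K s f z = 0"
  shows "generator_rel E Q (potential t f) (\<lambda>z. - f z)"
proof -
  let ?S = "\<lambda>p. S (max 0 (fst p)) (snd p)"
  obtain C where C: "C > 0" "\<And>x. \<bar>f x\<bar> \<le> C" using C_infty_bounded[OF f] by blast
  have neg: "(\<lambda>z. - f z) \<in> C_infty E" using C_infty_lincomb[OF f f, of "-1" 0] by simp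
  define \<phi> where "\<phi> z r = (\<integral>\<omega>. K (S r \<omega>) f z \<partial>M)" for z r
  have main: "(\<integral>\<omega>. K (S h \<omega>) (potential t f) z \<partial>M) - potential t f z = - (\<integral>r. indicator {0<..h} r * \<phi> z r \<partial>lborel)"
      "integrable lborel (\<lambda>r. indicator {0<..h} r * \<phi> z r)"
    if h: "0 < h" for h z
  proof -
    define k where "k s = K (max 0 s) f z" for s
    have km [measurable]: "k \<in> borel_measurable borel" unfolding k_def by (rule K_max_measurable(2)[OF f])
    have kb: "\<bar>k s\<bar> \<le> C" for s unfolding k_def by (rule contraction[OF _ f C(2)]) simp
    have k0: "k s = 0" if "t \<le> s" "0 \<le> s" for s using nil that by (simp add: k_def max_absorb2)
    have kS: "K (S r \<omega>) f z = k (S r \<omega>)" if "\<omega> \<in> space M" "0 \<le> r" for r \<omega>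
      using S_nonneg[OF that] by (simp add: k_def max_absorb2)
    have \<phi>: "\<phi> z r = (\<integral>\<omega>. k (S r \<omega>) \<partial>M)" if "0 \<le> r" for r
      unfolding \<phi>_def by (rule Bochner_Integration.integral_cong[OF refl]) (use that kS in auto)
    have [measurable]: "S h \<in> borel_measurable M" using h by (simp add: S_measurable)
    note [measurable] = S_pair_measurable
    define m where "m s = (\<integral>\<omega>. k (S h \<omega> + s) \<partial>M)" for s
    have mm [measurable]: "m \<in> borel_measurable borel" unfolding m_def by measurable
    have mb: "\<bar>m s\<bar> \<le> C" for s
    proof -
      have i: "integrable M (\<lambda>\<omega>. k (S h \<omega> + s))" by (rule integrable_const_bound[of _ C]) (use kb in auto)
      have "\<bar>m s\<bar> \<le> (\<integral>\<omega>. C \<partial>M)" unfolding m_def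
        by (rule integral_abs_bound[THEN order_trans], rule integral_mono) (use i kb in auto)
      then show ?thesis by (simp add: prob_space)
    qed
    have m0: "m s = 0" if "t \<le> s" "0 \<le> s" for s
    proof -
      have "m s = (\<integral>\<omega>. 0 \<partial>M)" unfolding m_def
      proof (rule Bochner_Integration.integral_cong[OF refl])
        fix \<omega> assume "\<omega> \<in> space M"
        then have "0 \<le> S h \<omega>" using h by (intro S_nonneg) auto
        then show "k (S h \<omega> + s) = 0" using that by (intro k0) auto
      qed
      then show ?thesis by simp
    qed
    \<comment> \<open>Where S r > t the factor \<open>below\<close> is 0, but so is g; hence
      \<open>below\<close> reduces to the restriction r > 0. Both k and its average m over S h
      satisfy the assumptions.\<close>
    have fub: "(\<integral>p. below t p * g (?S p) \<partial>(lborel \<Otimes>\<^sub>M M)) = (\<integral>r. indicator {0<..} r * (\<integral>\<omega>. g (S r \<omega>) \<partial>M) \<partial>lborel)"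
      "integrable lborel (\<lambda>r. indicator {0<..} r * (\<integral>\<omega>. g (S r \<omega>) \<partial>M))"
      if g [measurable]: "g \<in> borel_measurable borel" and gb: "\<And>s. \<bar>g s\<bar> \<le> C" and g0: "\<And>s. t \<le> s \<Longrightarrow> 0 \<le> s \<Longrightarrow> g s = 0" for g
    proof -
      have int: "integrable (lborel \<Otimes>\<^sub>M M) (\<lambda>p. below t p * g (?S p))"
        by (rule integrable_below_mult[where C = C]) (use gb in auto)
      have eq: "(\<integral>\<omega>. below t (r, \<omega>) * g (?S (r, \<omega>)) \<partial>M) = indicator {0<..} r * (\<integral>\<omega>. g (S r \<omega>) \<partial>M)" for r
      proof (cases "0 < r")
        case True
        have "(\<integral>\<omega>. below t (r, \<omega>) * g (?S (r, \<omega>)) \<partial>M) = (\<integral>\<omega>. g (S r \<omega>) \<partial>M)"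
        proof (rule Bochner_Integration.integral_cong[OF refl])
          fix \<omega> assume "\<omega> \<in> space M"
          then show "below t (r, \<omega>) * g (?S (r, \<omega>)) = g (S r \<omega>)"
            using True S_nonneg[of \<omega> r] g0[of "S r \<omega>"] by (auto simp: below_def max_absorb2 indicator_def)
        qed
        then show ?thesis using True by simp
      qed (simp add: below_def)
      show "(\<integral>p. below t p * g (?S p) \<partial>(lborel \<Otimes>\<^sub>M M)) = (\<integral>r. indicator {0<..} r * (\<integral>\<omega>. g (S r \<omega>) \<partial>M) \<partial>lborel)"
        using LM.integral_fst'[OF int] unfolding eq by simp
      show "integrable lborel (\<lambda>r. indicator {0<..} r * (\<integral>\<omega>. g (S r \<omega>) \<partial>M))"
        using LM.integrable_fst'[OF int] unfolding eq .
    qed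
    have pot: "potential t f z = (\<integral>r. indicator {0<..} r * \<phi> z r \<partial>lborel)"
      and int\<phi>: "integrable lborel (\<lambda>r. indicator {0<..} r * \<phi> z r)"
    proof -
      have "potential t f z = (\<integral>p. below t p * k (?S p) \<partial>(lborel \<Otimes>\<^sub>M M))"
        unfolding potential_def
        by (rule Bochner_Integration.integral_cong[OF refl]) (simp add: k_def max_absorb2 S_pair_nonneg)
      also have "\<dots> = (\<integral>r. indicator {0<..} r * (\<integral>\<omega>. k (S r \<omega>) \<partial>M) \<partial>lborel)" by (rule fub(1)[OF km kb k0])
      also have "\<dots> = (\<integral>r. indicator {0<..} r * \<phi> z r \<partial>lborel)"
        by (rule Bochner_Integration.integral_cong[OF refl]) (auto simp: indicator_def \<phi>)
      finally show "potential t f z = (\<integral>r. indicator {0<..} r * \<phi> z r \<partial>lborel)" .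
      have "(\<lambda>r. indicator {0<..} r * (\<integral>\<omega>. k (S r \<omega>) \<partial>M)) = (\<lambda>r. indicator {0<..} r * \<phi> z r)"
        by (auto simp: indicator_def \<phi> fun_eq_iff)
      then show "integrable lborel (\<lambda>r. indicator {0<..} r * \<phi> z r)" using fub(2)[OF km kb k0] by simp
    qed
    interpret MLM: pair_sigma_finite M "lborel \<Otimes>\<^sub>M M"
      by (intro pair_sigma_finite.intro sigma_finite_measure_axioms sigma_finite_pair_measure sigma_finite_lborel)
    have "(\<integral>\<omega>. K (S h \<omega>) (potential t f) z \<partial>M)
        = (\<integral>\<omega>. (\<integral>p. below t p * k (S h \<omega> + ?S p) \<partial>(lborel \<Otimes>\<^sub>M M)) \<partial>M)"
    proof (rule Bochner_Integration.integral_cong[OF refl])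
      fix \<omega> assume "\<omega> \<in> space M"
      then have 0: "0 \<le> S h \<omega>" using h by (intro S_nonneg) auto
      show "K (S h \<omega>) (potential t f) z = (\<integral>p. below t p * k (S h \<omega> + ?S p) \<partial>(lborel \<Otimes>\<^sub>M M))"
        unfolding K_potential[OF f 0] k_def
        by (rule Bochner_Integration.integral_cong[OF refl])
           (use 0 in \<open>simp add: max_absorb2 S_pair_nonneg\<close>)
    qed
    also have "\<dots> = (\<integral>p. (\<integral>\<omega>. below t p * k (S h \<omega> + ?S p) \<partial>M) \<partial>(lborel \<Otimes>\<^sub>M M))"
    proof (rule MLM.Fubini_integral[symmetric])
      have ib: "integrable (lborel \<Otimes>\<^sub>M M) (\<lambda>p. below t p * k (c + ?S p))" for c
        by (rule integrable_below_mult[where C = C]) (use kb in auto)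
      show "integrable (M \<Otimes>\<^sub>M (lborel \<Otimes>\<^sub>M M)) (\<lambda>(\<omega>, p). below t p * k (S h \<omega> + ?S p))"
      proof (rule MLM.Fubini_integrable)
        have [measurable]: "(\<lambda>q. ?S (snd q)) \<in> borel_measurable (M \<Otimes>\<^sub>M (lborel \<Otimes>\<^sub>M M))"
          using measurable_compose[OF measurable_snd S_pair_measurable] .
        have [measurable]: "(\<lambda>q. below t (snd q)) \<in> borel_measurable (M \<Otimes>\<^sub>M (lborel \<Otimes>\<^sub>M M))"
          using measurable_compose[OF measurable_snd below_measurable] .
        show mes [measurable]: "(\<lambda>(\<omega>, p). below t p * k (S h \<omega> + ?S p)) \<in> borel_measurable (M \<Otimes>\<^sub>M (lborel \<Otimes>\<^sub>M M))"
          unfolding case_prod_beta' by measurable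
        show "AE \<omega> in M. integrable (lborel \<Otimes>\<^sub>M M) (\<lambda>p. case (\<omega>, p) of (\<omega>, p) \<Rightarrow> below t p * k (S h \<omega> + ?S p))"
          using ib by simp
        show "integrable M (\<lambda>\<omega>. \<integral>p. norm (case (\<omega>, p) of (\<omega>, p) \<Rightarrow> below t p * k (S h \<omega> + ?S p)) \<partial>(lborel \<Otimes>\<^sub>M M))"
        proof (rule integrable_const_bound[where B = "\<integral>p. C * below t p \<partial>(lborel \<Otimes>\<^sub>M M)"])
          show "AE \<omega> in M. norm (\<integral>p. norm (case (\<omega>, p) of (\<omega>, p) \<Rightarrow> below t p * k (S h \<omega> + ?S p)) \<partial>(lborel \<Otimes>\<^sub>M M))
              \<le> (\<integral>p. C * below t p \<partial>(lborel \<Otimes>\<^sub>M M))"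
          proof (rule AE_I2)
            fix \<omega>
            have "(\<integral>p. \<bar>below t p * k (S h \<omega> + ?S p)\<bar> \<partial>(lborel \<Otimes>\<^sub>M M)) \<le> (\<integral>p. C * below t p \<partial>(lborel \<Otimes>\<^sub>M M))"
            proof (rule integral_mono)
              show "integrable (lborel \<Otimes>\<^sub>M M) (\<lambda>p. \<bar>below t p * k (S h \<omega> + ?S p)\<bar>)" by (rule integrable_abs[OF ib])
              show "integrable (lborel \<Otimes>\<^sub>M M) (\<lambda>p. C * below t p)" by (rule integrable_mult_right[OF integrable_below])
              show "\<bar>below t p * k (S h \<omega> + ?S p)\<bar> \<le> C * below t p" for p
                using mult_left_mono[OF kb below_nonneg[of t p], of "S h \<omega> + ?S p"] below_nonneg[of t p]
                by (simp add: abs_mult mult.commute)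
            qed
            then show "norm (\<integral>p. norm (case (\<omega>, p) of (\<omega>, p) \<Rightarrow> below t p * k (S h \<omega> + ?S p)) \<partial>(lborel \<Otimes>\<^sub>M M))
              \<le> (\<integral>p. C * below t p \<partial>(lborel \<Otimes>\<^sub>M M))" by simp
          qed
          show "(\<lambda>\<omega>. \<integral>p. norm (case (\<omega>, p) of (\<omega>, p) \<Rightarrow> below t p * k (S h \<omega> + ?S p)) \<partial>(lborel \<Otimes>\<^sub>M M)) \<in> borel_measurable M"
            by (rule sigma_finite_measure.borel_measurable_lebesgue_integral[OF
                  sigma_finite_pair_measure[OF sigma_finite_lborel sigma_finite_measure_axioms]])
               (use measurable_compose[OF mes borel_measurable_norm] in \<open>simp add: case_prod_beta'\<close>)
        qed
      qed
    qed
    also have "\<dots> = (\<integral>p. below t p * m (?S p) \<partial>(lborel \<Otimes>\<^sub>M M))" by (simp add: m_def)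
    also have "\<dots> = (\<integral>r. indicator {0<..} r * (\<integral>\<omega>. m (S r \<omega>) \<partial>M) \<partial>lborel)" by (rule fub(1)[OF mm mb m0])
    also have "\<dots> = (\<integral>r. indicator {h<..} (h + 1 * r) * \<phi> z (h + 1 * r) \<partial>lborel)"
    proof (rule Bochner_Integration.integral_cong[OF refl])
      fix r :: real
      show "indicator {0<..} r * (\<integral>\<omega>. m (S r \<omega>) \<partial>M) = indicator {h<..} (h + 1 * r) * \<phi> z (h + 1 * r)"
      proof (cases "0 < r")
        case True
        \<comment> \<open>S (r + h) has the law of S r plus an independent copy of S h, so averaging
          over both sample points moves r to r + h.\<close>
        let ?F = "\<lambda>p. k (fst p + snd p)"
        have "?F \<in> borel_measurable borel" unfolding borel_prod[symmetric] by measurable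
        from integral_increment[OF this, of C r h]
        have "(\<integral>\<omega>. k (S (r + h) \<omega>) \<partial>M) = (\<integral>\<omega>. \<integral>\<omega>'. k (S r \<omega> + S h \<omega>') \<partial>M \<partial>M)"
          using kb True h by simp
        then show ?thesis using True h by (simp add: \<phi> m_def add.commute)
      qed simp
    qed
    also have "\<dots> = (\<integral>r. indicator {h<..} r * \<phi> z r \<partial>lborel)"
      using lborel_integral_real_affine[of 1 "\<lambda>r. indicator {h<..} r * \<phi> z r" h] by simp
    finally have Qpot: "(\<integral>\<omega>. K (S h \<omega>) (potential t f) z \<partial>M) = (\<integral>r. indicator {h<..} r * \<phi> z r \<partial>lborel)" .
    have eq1: "indicator {h<..} r * \<phi> z r = indicator {h<..} r * (indicator {0<..} r * \<phi> z r)"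
      and eq2: "indicator {0<..h} r * \<phi> z r = indicator {0<..h} r * (indicator {0<..} r * \<phi> z r)" for r
      using h by (auto simp: indicator_def)
    have i1: "integrable lborel (\<lambda>r. indicator {h<..} r * \<phi> z r)"
      unfolding eq1 by (rule integrable_real_mult_indicator[OF _ int\<phi>, unfolded mult.commute[of _ "indicator _ _"]]) simp
    show i2: "integrable lborel (\<lambda>r. indicator {0<..h} r * \<phi> z r)"
      unfolding eq2 by (rule integrable_real_mult_indicator[OF _ int\<phi>, unfolded mult.commute[of _ "indicator _ _"]]) simp
    have "(\<integral>r. indicator {h<..} r * \<phi> z r \<partial>lborel) + (\<integral>r. indicator {0<..h} r * \<phi> z r \<partial>lborel)
        = (\<integral>r. indicator {0<..} r * \<phi> z r \<partial>lborel)"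
      unfolding Bochner_Integration.integral_add[OF i1 i2, symmetric]
      by (rule Bochner_Integration.integral_cong[OF refl]) (use h in \<open>auto simp: indicator_def\<close>)
    then show "(\<integral>\<omega>. K (S h \<omega>) (potential t f) z \<partial>M) - potential t f z = - (\<integral>r. indicator {0<..h} r * \<phi> z r \<partial>lborel)"
      unfolding Qpot pot by linarith
  qed
  have "uniform_limit E (\<lambda>r z. (Q r (potential t f) z - potential t f z) / r) (\<lambda>z. - f z) (at_right 0)"
  proof (rule uniform_limitI)
    fix e :: real assume e: "0 < e"
    then have "0 < e / 2" by simp
    from expectation_strong[OF f this] obtain d where d: "0 < d" "\<And>r z. 0 \<le> r \<Longrightarrow> r < d \<Longrightarrow> \<bar>\<phi> z r - f z\<bar> \<le> e / 2"
      unfolding \<phi>_def by blast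
    have "dist ((Q h (potential t f) z - potential t f z) / h) (- f z) < e" if h: "0 < h" "h < d" and z: "z \<in> E" for h z
    proof -
      have ic: "integrable lborel (\<lambda>r. indicator {0<..h} r * c)" for c :: real
        using h by (intro integrable_mult_left integrable_real_indicator) auto
      have cv: "(\<integral>r. indicator {0<..h} r * c \<partial>lborel) = h * c" for c :: real
        using h by simp
      have "Q h (potential t f) z - potential t f z + h * f z
          = - (\<integral>r. indicator {0<..h} r * \<phi> z r \<partial>lborel) + (\<integral>r. indicator {0<..h} r * f z \<partial>lborel)"
        using Q[OF h(1) potential_C_infty[OF f, of t] z] main(1)[OF h(1), of z] unfolding cv by linarith
      also have "\<dots> = (\<integral>r. indicator {0<..h} r * f z - indicator {0<..h} r * \<phi> z r \<partial>lborel)"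
        using main(2)[OF h(1), of z] ic[of "f z"] by simp
      also have "\<bar>\<dots>\<bar> \<le> (\<integral>r. indicator {0<..h} r * (e / 2) \<partial>lborel)"
      proof (rule integral_abs_bound[THEN order_trans], rule integral_mono)
        show "integrable lborel (\<lambda>r. \<bar>indicator {0<..h} r * f z - indicator {0<..h} r * \<phi> z r\<bar>)"
          using main(2)[OF h(1), of z] ic[of "f z"] by simp
        show "\<bar>indicator {0<..h} r * f z - indicator {0<..h} r * \<phi> z r\<bar> \<le> indicator {0<..h} r * (e / 2)" for r
          using d(2)[of r z] h by (auto simp: indicator_def abs_minus_commute)
      qed (rule ic)
      also have "\<dots> = h * (e / 2)" by (rule cv)
      finally have "\<bar>Q h (potential t f) z - potential t f z + h * f z\<bar> / h \<le> e / 2"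
        using h by (simp add: divide_le_eq mult.commute)
      also have "\<bar>Q h (potential t f) z - potential t f z + h * f z\<bar> / h
          = \<bar>(Q h (potential t f) z - potential t f z + h * f z) / h\<bar>"
        using h by (simp add: abs_divide)
      also have "(Q h (potential t f) z - potential t f z + h * f z) / h
          = (Q h (potential t f) z - potential t f z) / h - - f z"
        using h by (simp add: add_divide_distrib)
      finally show ?thesis using e by (simp add: dist_real_def)
    qed
    then show "\<forall>\<^sub>F h in at_right 0. \<forall>z\<in>E. dist ((Q h (potential t f) z - potential t f z) / h) (- f z) < e"
      unfolding eventually_at_right_field using d(1) by blast
  qed
  then show ?thesis
    using potential_C_infty[OF f] neg by (simp add: generator_rel_def)
qed

lemma generator_rel_add:
  assumes 1: "generator_rel E Q u v" and 2: "generator_rel E Q u' v'"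
  shows "generator_rel E Q (\<lambda>z. u z + u' z) (\<lambda>z. v z + v' z)"
proof -
  have u: "u \<in> C_infty E" "u' \<in> C_infty E" and v: "v \<in> C_infty E" "v' \<in> C_infty E"
    using 1 2 by (auto simp: generator_rel_def)
  have sum: "(\<lambda>z. u z + u' z) \<in> C_infty E" "(\<lambda>z. v z + v' z) \<in> C_infty E"
    using C_infty_lincomb[OF u, of 1 1] C_infty_lincomb[OF v, of 1 1] by simp_all
  have "uniform_limit E (\<lambda>r z. (Q r u z - u z) / r + (Q r u' z - u' z) / r) (\<lambda>z. v z + v' z) (at_right 0)"
    using 1 2 by (intro uniform_limit_add) (auto simp: generator_rel_def)
  moreover have "(Q r u z - u z) / r + (Q r u' z - u' z) / r = (Q r (\<lambda>z. u z + u' z) z - (u z + u' z)) / r"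
    if "0 < r" "z \<in> E" for r z
  proof -
    have i: "integrable M (\<lambda>\<omega>. K (S r \<omega>) w z)" if "w \<in> C_infty E" for w
      by (rule integrable_time[OF that S_measurable S_nonneg finite_measure_axioms]) (use \<open>0 < r\<close> in auto)
    have "Q r (\<lambda>z. u z + u' z) z = (\<integral>\<omega>. K (S r \<omega>) u z + K (S r \<omega>) u' z \<partial>M)"
      unfolding Q[OF that(1) sum(1) that(2)]
    proof (rule Bochner_Integration.integral_cong[OF refl])
      fix \<omega> assume "\<omega> \<in> space M"
      then have "0 \<le> S r \<omega>" using that by (intro S_nonneg) auto
      from fun_cong[OF lincomb[OF this u, of 1 1], of z]
      show "K (S r \<omega>) (\<lambda>z. u z + u' z) z = K (S r \<omega>) u z + K (S r \<omega>) u' z" by simp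
    qed
    also have "\<dots> = Q r u z + Q r u' z"
      using i[OF u(1)] i[OF u(2)] Q[OF that(1) u(1) that(2)] Q[OF that(1) u(2) that(2)] by simp
    finally show ?thesis by (simp add: add_divide_distrib[symmetric] diff_divide_distrib[symmetric])
  qed
  then have "\<forall>\<^sub>F r in at_right 0. \<forall>z\<in>E. (Q r u z - u z) / r + (Q r u' z - u' z) / r
      = (Q r (\<lambda>z. u z + u' z) z - (u z + u' z)) / r"
    by (auto simp: eventually_at_right_field intro!: exI[of _ 1])
  from uniform_limit_cong[OF this, of "\<lambda>z. v z + v' z" "\<lambda>z. v z + v' z"]
  have "uniform_limit E (\<lambda>r z. (Q r u z - u z) / r + (Q r u' z - u' z) / r) (\<lambda>z. v z + v' z) (at_right 0)
    \<longleftrightarrow> uniform_limit E (\<lambda>r z. (Q r (\<lambda>z. u z + u' z) z - (u z + u' z)) / r) (\<lambda>z. v z + v' z) (at_right 0)"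
    by simp
  ultimately have "uniform_limit E (\<lambda>r z. (Q r (\<lambda>z. u z + u' z) z - (u z + u' z)) / r) (\<lambda>z. v z + v' z) (at_right 0)"
    by simp
  then show ?thesis using sum by (simp add: generator_rel_def)
qed

end

section \<open>Domain solutions: representation and existence\<close>

context subordinator
begin

text \<open>The interval integral omits only the null event S r = 0.\<close>

lemma space_semigroup_eq:
  fixes \<Omega> :: "'a::metric_space set"
  assumes P: "contraction_semigroup \<Omega> P" and r: "0 < r" and v: "v \<in> C_infty \<Omega>"
  shows "space_semigroup P (subordinator_density M S) r v x = (\<integral>\<omega>. P (S r \<omega>) v x \<partial>M)"
proof -
  interpret contraction_semigroup \<Omega> P by fact
  have m: "(\<lambda>s. P (max 0 s) v x) \<in> borel_measurable borel"
    by (rule measurable_time[OF v]) auto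
  have Sm: "S r \<in> borel_measurable M" using r by (simp add: S_measurable)
  have "(LBINT s=0..\<infinity>. P s v x * subordinator_density M S r s)
      = (LBINT s=0..\<infinity>. P (max 0 s) v x * subordinator_density M S r s)"
    by (rule interval_lebesgue_integral_cong) (auto simp: einterval_iff max_absorb2)
  also have "\<dots> = (\<integral>\<omega>. indicator (einterval 0 \<infinity>) (S r \<omega>) * P (max 0 (S r \<omega>)) v x \<partial>M)"
    by (rule integral_density_interval[OF r _ m]) simp
  also have "\<dots> = (\<integral>\<omega>. P (S r \<omega>) v x \<partial>M)"
  proof (rule integral_cong_AE)
    show "(\<lambda>\<omega>. indicator (einterval 0 \<infinity>) (S r \<omega>) * P (max 0 (S r \<omega>)) v x) \<in> borel_measurable M"
      using Sm m by measurable
    show "(\<lambda>\<omega>. P (S r \<omega>) v x) \<in> borel_measurable M"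
      by (rule measurable_time[OF v Sm S_nonneg]) (use r in auto)
    show "AE \<omega> in M. indicator (einterval 0 \<infinity>) (S r \<omega>) * P (max 0 (S r \<omega>)) v x = P (S r \<omega>) v x"
      using AE_S_pos[OF r] by (rule eventually_mono) (simp add: einterval_iff max_absorb2)
  qed
  finally show ?thesis using r by (simp add: space_semigroup_def)
qed

text \<open>For s < t the clipped time \<open>max 0 (t - s)\<close> is t - s, beyond t it is 0,
  which gives the two integrals. The omitted values 0 and t have probability 0 because the law of S
  r has no atoms.\<close>

lemma time_space_semigroup_eq:
  fixes \<Omega> :: "'a::metric_space set"
  assumes P: "contraction_semigroup \<Omega> P" and r: "0 < r"
    and u: "u \<in> C_infty ({0..T} \<times> \<Omega>)" and t: "t \<in> {0..T}"
  shows "time_space_semigroup T P (subordinator_density M S) r u (t, x)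
    = (\<integral>\<omega>. shift_semigroup T P (S r \<omega>) u (t, x) \<partial>M)"
proof -
  interpret contraction_semigroup "{0..T} \<times> \<Omega>" "shift_semigroup T P" by (rule contraction_semigroup_shift[OF P])
  let ?K = "shift_semigroup T P" and ?p = "subordinator_density M S"
  have m [measurable]: "(\<lambda>s. ?K (max 0 s) u (t, x)) \<in> borel_measurable borel"
    by (rule measurable_time[OF u]) auto
  have Sm [measurable]: "S r \<in> borel_measurable M" using r by (simp add: S_measurable)
  have t0: "0 \<le> t" using t by simp
  have "(LBINT s=0..ereal t. P s (\<lambda>y. u (t - s, y)) x * ?p r s)
      = (LBINT s=0..ereal t. ?K (max 0 s) u (t, x) * ?p r s)"
    by (rule interval_lebesgue_integral_cong)
       (use t0 in \<open>auto simp: einterval_iff max_absorb2 shift_semigroup_apply[OF t]\<close>)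
  also have "\<dots> = (\<integral>\<omega>. indicator (einterval 0 (ereal t)) (S r \<omega>) * ?K (max 0 (S r \<omega>)) u (t, x) \<partial>M)"
    by (rule integral_density_interval[OF r _ m]) (use t0 in simp)
  finally have 1: "(LBINT s=0..ereal t. P s (\<lambda>y. u (t - s, y)) x * ?p r s)
      = (\<integral>\<omega>. indicator (einterval 0 (ereal t)) (S r \<omega>) * ?K (max 0 (S r \<omega>)) u (t, x) \<partial>M)" .
  have "(LBINT s=ereal t..\<infinity>. P s (\<lambda>y. u (0, y)) x * ?p r s)
      = (LBINT s=ereal t..\<infinity>. ?K (max 0 s) u (t, x) * ?p r s)"
    by (rule interval_lebesgue_integral_cong)
       (use t0 in \<open>auto simp: einterval_iff max_absorb1 max_absorb2 shift_semigroup_apply[OF t]\<close>)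
  also have "\<dots> = (\<integral>\<omega>. indicator (einterval (ereal t) \<infinity>) (S r \<omega>) * ?K (max 0 (S r \<omega>)) u (t, x) \<partial>M)"
    by (rule integral_density_interval[OF r _ m]) simp
  finally have 2: "(LBINT s=ereal t..\<infinity>. P s (\<lambda>y. u (0, y)) x * ?p r s)
      = (\<integral>\<omega>. indicator (einterval (ereal t) \<infinity>) (S r \<omega>) * ?K (max 0 (S r \<omega>)) u (t, x) \<partial>M)" .
  obtain C where C: "\<And>x. \<bar>u x\<bar> \<le> C" using C_infty_bounded[OF u] by blast
  have Kb: "\<bar>?K (max 0 s) u (t, x)\<bar> \<le> C" for s by (rule contraction[OF _ u C]) simp
  have i: "integrable M (\<lambda>\<omega>. indicator A (S r \<omega>) * ?K (max 0 (S r \<omega>)) u (t, x))" if "A \<in> sets borel" for A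
  proof (rule integrable_const_bound[where B = C])
    show "AE \<omega> in M. norm (indicator A (S r \<omega>) * ?K (max 0 (S r \<omega>)) u (t, x)) \<le> C"
      using Kb order_trans[OF abs_ge_zero Kb[of 0]] by (auto simp: indicator_def)
    show "(\<lambda>\<omega>. indicator A (S r \<omega>) * ?K (max 0 (S r \<omega>)) u (t, x)) \<in> borel_measurable M"
      using that by measurable
  qed
  have "time_space_semigroup T P ?p r u (t, x)
      = (LBINT s=0..ereal t. P s (\<lambda>y. u (t - s, y)) x * ?p r s) + (LBINT s=ereal t..\<infinity>. P s (\<lambda>y. u (0, y)) x * ?p r s)"
    unfolding time_space_semigroup_def using r t by simp
  also have "\<dots> = (\<integral>\<omega>. indicator (einterval 0 (ereal t)) (S r \<omega>) * ?K (max 0 (S r \<omega>)) u (t, x)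
        + indicator (einterval (ereal t) \<infinity>) (S r \<omega>) * ?K (max 0 (S r \<omega>)) u (t, x) \<partial>M)"
    unfolding 1 2 by (rule Bochner_Integration.integral_add[symmetric, OF i i]) auto
  also have "\<dots> = (\<integral>\<omega>. ?K (S r \<omega>) u (t, x) \<partial>M)"
  proof (rule integral_cong_AE)
    show "(\<lambda>\<omega>. indicator (einterval 0 (ereal t)) (S r \<omega>) * ?K (max 0 (S r \<omega>)) u (t, x)
        + indicator (einterval (ereal t) \<infinity>) (S r \<omega>) * ?K (max 0 (S r \<omega>)) u (t, x)) \<in> borel_measurable M"
      by measurable
    show "(\<lambda>\<omega>. ?K (S r \<omega>) u (t, x)) \<in> borel_measurable M"
      by (rule measurable_time[OF u Sm S_nonneg]) (use r in auto)
    show "AE \<omega> in M. indicator (einterval 0 (ereal t)) (S r \<omega>) * ?K (max 0 (S r \<omega>)) u (t, x)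
        + indicator (einterval (ereal t) \<infinity>) (S r \<omega>) * ?K (max 0 (S r \<omega>)) u (t, x) = ?K (S r \<omega>) u (t, x)"
      using AE_S_pos[OF r] AE_S_neq[OF r, of t]
      by eventually_elim (auto simp: einterval_iff max_absorb2 indicator_def)
  qed
  finally show ?thesis .
qed

lemma subordination_time_space:
  assumes "contraction_semigroup \<Omega> P"
  shows "subordination M \<nu> S ({0..T} \<times> \<Omega>) (shift_semigroup T P)
    (time_space_semigroup T P (subordinator_density M S))"
  by (intro subordination.intro subordination_axioms.intro subordinator_axioms contraction_semigroup_shift assms)
     (auto simp: time_space_semigroup_eq[OF assms])

text \<open>Dynkin's formula at the level t, the starting value of the time coordinate: the passage
  over t is the moment when that coordinate has come down to 0 and only the initial value is
  seen.\<close>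

lemma domain_solution_representation:
  fixes \<Omega> :: "'a::euclidean_space set"
  assumes P: "contraction_semigroup \<Omega> P" and T: "0 < T"
    and \<gamma>: "\<gamma> \<in> C_infty ({0..T} \<times> \<Omega>)" and \<phi>: "\<phi> \<in> C_infty \<Omega>"
    and u: "domain_solution T \<Omega> P (subordinator_density M S) \<gamma> \<phi> u"
    and t: "t \<in> {0..T}" and x: "x \<in> \<Omega>"
  shows "u (t, x) = (\<integral>\<omega>. P (S (hit t \<omega>) \<omega>) \<phi> x \<partial>M)
    + (\<integral>p. below t p * shift_semigroup T P (S (max 0 (fst p)) (snd p)) \<gamma> (t, x) \<partial>(lborel \<Otimes>\<^sub>M M))"
proof -
  let ?E = "{0..T} \<times> \<Omega>" and ?K = "shift_semigroup T P" and ?Q = "time_space_semigroup T P (subordinator_density M S)"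
  interpret SP: contraction_semigroup \<Omega> P by fact
  interpret Q: subordination M \<nu> S ?E ?K ?Q by (rule subordination_time_space[OF P])
  have rel: "generator_rel ?E ?Q u (generator ?E ?Q u)"
    using u by (intro generator_rel_generator) (simp add: domain_solution_def)
  then have uC: "u \<in> C_infty ?E" and gC: "generator ?E ?Q u \<in> C_infty ?E" by (auto simp: generator_rel_def)
  have gen: "generator ?E ?Q u z = - \<gamma> z" if "z \<in> {0<..T} \<times> \<Omega>" for z
    using u that unfolding domain_solution_def by blast
  \<comment> \<open>The equation is imposed for positive times; both sides are continuous up to t =
    0, so it extends there along the points T/(n+1).\<close>
  have gen0: "generator ?E ?Q u (0, y) = - \<gamma> (0, y)" if y: "y \<in> \<Omega>" for y
  proof -
    have lim: "(\<lambda>n. w (T / real (Suc n), y)) \<longlonglongrightarrow> w (0, y)" if w: "w \<in> C_infty ?E" for w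
    proof (rule continuous_on_tendsto_compose[OF C_infty_continuous_on[OF w]])
      have "(\<lambda>n. T * (1 / real (Suc n))) \<longlonglongrightarrow> T * 0"
        by (intro tendsto_mult_left LIMSEQ_Suc[OF lim_1_over_n])
      then show "(\<lambda>n. (T / real (Suc n), y)) \<longlonglongrightarrow> (0, y)"
        by (intro tendsto_Pair tendsto_const) simp
      show "\<forall>\<^sub>F n in sequentially. (T / real (Suc n), y) \<in> ?E"
        using T y by (intro always_eventually allI) (auto simp: divide_le_eq)
    qed (use T y in auto)
    have "generator ?E ?Q u (T / real (Suc n), y) = - \<gamma> (T / real (Suc n), y)" for n
      using T y by (intro gen) (auto simp: divide_le_eq)
    then show ?thesis using lim[OF gC] tendsto_minus[OF lim[OF \<gamma>]] LIMSEQ_unique by fastforce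
  qed
  have "generator ?E ?Q u z = - \<gamma> z" for z
  proof (cases "z \<in> ?E")
    case True
    then obtain s y where z: "z = (s, y)" "0 \<le> s" "s \<le> T" "y \<in> \<Omega>" by auto
    then show ?thesis using gen[of z] gen0[of y] by (cases "s = 0") auto
  qed (simp add: C_infty_off[OF gC] C_infty_off[OF \<gamma>])
  then have "generator ?E ?Q u = (\<lambda>z. - \<gamma> z)" by (rule ext)
  with rel have rel': "generator_rel ?E ?Q u (\<lambda>z. - \<gamma> z)" by (rule back_subst)
  \<comment> \<open>At the passage time S is at least t, so the clipped time is 0 and u is evaluated
    at its initial value.\<close>
  have 1: "(\<integral>\<omega>. ?K (S (hit t \<omega>) \<omega>) u (t, x) \<partial>M) = (\<integral>\<omega>. P (S (hit t \<omega>) \<omega>) \<phi> x \<partial>M)"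
  proof (rule integral_cong_AE)
    have Sm: "(\<lambda>\<omega>. S (hit t \<omega>) \<omega>) \<in> borel_measurable M" by (rule S_hit_measurable) (auto simp: S_measurable)
    show "(\<lambda>\<omega>. ?K (S (hit t \<omega>) \<omega>) u (t, x)) \<in> borel_measurable M"
      by (rule Q.measurable_time[OF uC Sm]) (simp add: S_nonneg hit_nonneg)
    show "(\<lambda>\<omega>. P (S (hit t \<omega>) \<omega>) \<phi> x) \<in> borel_measurable M"
      by (rule SP.measurable_time[OF \<phi> Sm]) (simp add: S_nonneg hit_nonneg)
    have u0: "(\<lambda>y. u (0, y)) = \<phi>"
    proof
      fix y show "u (0, y) = \<phi> y"
        using u C_infty_off[OF uC, of "(0, y)"] C_infty_off[OF \<phi>, of y]
        by (cases "y \<in> \<Omega>") (auto simp: domain_solution_def)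
    qed
    show "AE \<omega> in M. ?K (S (hit t \<omega>) \<omega>) u (t, x) = P (S (hit t \<omega>) \<omega>) \<phi> x"
    proof (rule AE_mp[OF AE_passage_time_finite[of t]], rule AE_I2, rule impI)
      fix \<omega> assume "\<omega> \<in> space M" "passage_time S (ereal t) \<omega> < \<infinity>"
      then have "t \<le> S (hit t \<omega>) \<omega>" by (rule S_hit_ge)
      then have "max 0 (t - S (hit t \<omega>) \<omega>) = 0" by simp
      then show "?K (S (hit t \<omega>) \<omega>) u (t, x) = P (S (hit t \<omega>) \<omega>) \<phi> x"
        unfolding shift_semigroup_apply[OF t] by (simp only: u0)
    qed
  qed
  have 2: "?K s (\<lambda>z. - \<gamma> z) (t, x) = - ?K s \<gamma> (t, x)" if "0 \<le> s" for s
    using fun_cong[OF Q.lincomb[OF that \<gamma> \<gamma>, of "-1" 0], of "(t, x)"] by simp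
  have "(\<integral>p. below t p * ?K (S (max 0 (fst p)) (snd p)) (\<lambda>z. - \<gamma> z) (t, x) \<partial>(lborel \<Otimes>\<^sub>M M))
      = (\<integral>p. - (below t p * ?K (S (max 0 (fst p)) (snd p)) \<gamma> (t, x)) \<partial>(lborel \<Otimes>\<^sub>M M))"
    by (rule Bochner_Integration.integral_cong[OF refl]) (simp add: 2 Q.S_pair_nonneg)
  then show ?thesis
    using Q.generator_rel_dynkin[OF rel', of t "(t, x)"] t unfolding 1 by simp
qed

lemma domain_solution_exists:
  fixes \<Omega> :: "'a::euclidean_space set"
  assumes P: "contraction_semigroup \<Omega> P" and T: "0 < T"
    and \<gamma>: "\<gamma> \<in> C_infty ({0..T} \<times> \<Omega>)"
    and \<phi>: "\<phi> \<in> generator_dom \<Omega> (space_semigroup P (subordinator_density M S))"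
    and \<gamma>0: "\<And>x. x \<in> \<Omega> \<Longrightarrow> \<gamma> (0, x) = - generator \<Omega> (space_semigroup P (subordinator_density M S)) \<phi> x"
  shows "\<exists>u. domain_solution T \<Omega> P (subordinator_density M S) \<gamma> \<phi> u"
proof -
  let ?E = "{0..T} \<times> \<Omega>" and ?K = "shift_semigroup T P"
  let ?Q = "time_space_semigroup T P (subordinator_density M S)" and ?R = "space_semigroup P (subordinator_density M S)"
  interpret SP: contraction_semigroup \<Omega> P by fact
  interpret Q: subordination M \<nu> S ?E ?K ?Q by (rule subordination_time_space[OF P])
  define \<psi> where "\<psi> = generator \<Omega> ?R \<phi>"
  have rel: "generator_rel \<Omega> ?R \<phi> \<psi>" unfolding \<psi>_def by (rule generator_rel_generator[OF \<phi>])
  then have \<phi>C: "\<phi> \<in> C_infty \<Omega>" and \<psi>C: "\<psi> \<in> C_infty \<Omega>"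
    and lim: "uniform_limit \<Omega> (\<lambda>r x. (?R r \<phi> x - \<phi> x) / r) \<psi> (at_right 0)"
    by (auto simp: generator_rel_def)
  let ?c = "\<lambda>v. \<lambda>(t, x). if t \<in> {0..T} then v x else (0::real)"
  have cC: "?c v \<in> C_infty ?E" if "v \<in> C_infty \<Omega>" for v using that by (rule C_infty_constant_in_time)
  \<comment> \<open>A function constant in time is moved in space alone, so its time-space generator
    is the constant extension of the spatial one.\<close>
  have Qc: "?Q r (?c \<phi>) (t, x) = ?R r \<phi> x" if "0 < r" "t \<in> {0..T}" "x \<in> \<Omega>" for r t x
  proof -
    have "?K s (?c \<phi>) (t, x) = P s \<phi> x" if "0 \<le> s" for s
    proof -
      have "max 0 (t - s) \<in> {0..T}" using \<open>t \<in> {0..T}\<close> that by auto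
      then show ?thesis unfolding shift_semigroup_apply[OF \<open>t \<in> {0..T}\<close>] by simp
    qed
    then show ?thesis
      unfolding time_space_semigroup_eq[OF P that(1) cC[OF \<phi>C] that(2)] space_semigroup_eq[OF P that(1) \<phi>C]
      by (intro Bochner_Integration.integral_cong refl) (use that in \<open>simp add: S_nonneg\<close>)
  qed
  have relc: "generator_rel ?E ?Q (?c \<phi>) (?c \<psi>)"
    unfolding generator_rel_def
  proof (intro conjI cC \<phi>C \<psi>C uniform_limitI)
    fix e :: real assume "0 < e"
    with lim have "\<forall>\<^sub>F r in at_right 0. \<forall>x\<in>\<Omega>. dist ((?R r \<phi> x - \<phi> x) / r) (\<psi> x) < e" by (rule uniform_limitD)
    then show "\<forall>\<^sub>F r in at_right 0. \<forall>z\<in>?E. dist ((?Q r (?c \<phi>) z - ?c \<phi> z) / r) (?c \<psi> z) < e"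
      using eventually_at_right_less[of 0]
    proof eventually_elim
      case (elim r)
      show ?case
      proof
        fix z assume "z \<in> ?E"
        then obtain t x where z: "z = (t, x)" "t \<in> {0..T}" "x \<in> \<Omega>" by blast
        then show "dist ((?Q r (?c \<phi>) z - ?c \<phi> z) / r) (?c \<psi> z) < e"
          using elim Qc[OF _ z(2,3), of r] by simp
      qed
    qed
  qed
  \<comment> \<open>The forcing that remains for the potential. The condition on \<gamma> at time 0
    is exactly that f vanishes there.\<close>
  define f where "f = (\<lambda>z. 1 * \<gamma> z + 1 * ?c \<psi> z)"
  have fC: "f \<in> C_infty ?E" unfolding f_def by (rule C_infty_lincomb[OF \<gamma> cC[OF \<psi>C]])
  have f0: "f (0, y) = 0" for y
    using \<gamma>0[of y] C_infty_off[OF \<gamma>, of "(0, y)"] C_infty_off[OF \<psi>C, of y] T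
    by (cases "y \<in> \<Omega>") (auto simp: f_def \<psi>_def)
  have P0: "P s (\<lambda>y. 0) x = 0" if "0 \<le> s" for s x
    using fun_cong[OF SP.lincomb[OF that C_infty_zero C_infty_zero, of 0 0], of x] by simp
  have Kf: "?K s f (t, x) = 0" if "t \<le> s" "0 \<le> s" for s t x
  proof (cases "t \<in> {0..T}")
    case True
    have "max 0 (t - s) = 0" using that by simp
    then show ?thesis unfolding shift_semigroup_apply[OF True] by (simp add: f0 P0 that)
  qed (simp only: shift_semigroup_off not_False_eq_True)
  \<comment> \<open>The level T serves all t \<in> [0,T] at once, as the potential has to be a
    single function of (t, x).\<close>
  have Kf': "?K s f z = 0" if "T \<le> s" "0 \<le> s" for s z
  proof -
    obtain t x where z: "z = (t, x)" by (cases z)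
    show ?thesis
    proof (cases "t \<in> {0..T}")
      case True
      then show ?thesis unfolding z using that by (intro Kf) auto
    qed (simp only: z shift_semigroup_off not_False_eq_True)
  qed
  define u where "u = (\<lambda>z. ?c \<phi> z + Q.potential T f z)"
  have "generator_rel ?E ?Q u (\<lambda>z. ?c \<psi> z + - f z)"
    unfolding u_def by (rule Q.generator_rel_add[OF relc Q.generator_rel_potential[OF fC Kf']])
  then have relu: "generator_rel ?E ?Q u (\<lambda>z. - \<gamma> z)" by (simp add: f_def)
  \<comment> \<open>Started at t = 0 every s \<ge> 0 is already past t, so the potential leaves the
    initial value untouched.\<close>
  have "Q.potential T f (0, x) = 0" for x
  proof -
    have "Q.potential T f (0, x) = (\<integral>p. 0 \<partial>((lborel :: real measure) \<Otimes>\<^sub>M M))"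
      unfolding Q.potential_def
      by (rule Bochner_Integration.integral_cong[OF refl]) (simp add: Kf Q.S_pair_nonneg)
    then show ?thesis by simp
  qed
  then have "\<forall>x\<in>\<Omega>. u (0, x) = \<phi> x" using T by (simp add: u_def)
  then have "domain_solution T \<Omega> P (subordinator_density M S) \<gamma> \<phi> u"
    using relu generator_eqI[OF relu] by (auto simp: domain_solution_def generator_dom_def)
  then show ?thesis by blast
qed

end

section \<open>The time-changed Feller process\<close>

lemma admissible_domain_borel:
  fixes \<Omega> :: "'a::euclidean_space set"
  assumes "admissible_domain \<Omega>"
  shows "\<Omega> \<in> sets borel"
  using assms unfolding admissible_domain_def by (auto intro: borel_open borel_closed compact_imp_closed)

text \<open>On a closed set 1 / (1 + norm x) decays at infinity; on a bounded open set the distance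
  to the complement decays at the boundary. Each admissible domain is of one of these kinds.\<close>

lemma admissible_domain_weight:
  fixes \<Omega> :: "'a::euclidean_space set"
  assumes "admissible_domain \<Omega>"
  shows "\<exists>k\<in>C_infty \<Omega>. \<forall>x\<in>\<Omega>. 0 < k x"
proof -
  have "\<exists>k. k \<in> C_infty \<Omega> \<and> (\<forall>x\<in>\<Omega>. 0 < k x)"
  proof (cases "closed \<Omega>")
    case True
    let ?k = "\<lambda>x. if x \<in> \<Omega> then 1 / (1 + norm x) else 0"
    have "?k \<in> C_infty \<Omega>"
    proof (rule C_infty_compact_exhaustion)
      have "continuous_on \<Omega> (\<lambda>x. 1 / (1 + norm x))"
        by (intro continuous_intros) (auto simp: add_nonneg_eq_0_iff)
      then show "continuous_on \<Omega> ?k" by (rule continuous_on_eq) auto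
      fix e :: real assume e: "0 < e"
      have "\<bar>?k x\<bar> < e" if "x \<in> \<Omega> - \<Omega> \<inter> cball 0 (1 / e)" for x
      proof -
        have "1 / e < 1 + norm x" using that by auto
        then have "1 / (1 + norm x) < e" using e by (simp add: divide_less_eq mult.commute add_pos_nonneg)
        then show ?thesis using that by simp
      qed
      then show "\<exists>K. compact K \<and> K \<subseteq> \<Omega> \<and> (\<forall>x\<in>\<Omega> - K. \<bar>?k x\<bar> < e)"
        using closed_Int_compact[OF True compact_cball[of 0 "1 / e"]] by (intro exI[of _ "\<Omega> \<inter> cball 0 (1 / e)"]) auto
    qed auto
    then show ?thesis by (intro exI[of _ ?k]) (auto simp: add_pos_nonneg)
  next
    case False
    then have \<Omega>: "bounded \<Omega>" "open \<Omega>"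
      using assms by (auto simp: admissible_domain_def compact_imp_closed)
    \<comment> \<open>\<open>infdist\<close> to the empty set is 0 by convention, so positivity on
      \<Omega> requires a nonempty complement.\<close>
    have ne: "- \<Omega> \<noteq> {}"
    proof
      assume "- \<Omega> = {}"
      then have "\<Omega> = UNIV" by auto
      then show False using \<Omega>(1) not_bounded_UNIV by simp
    qed
    let ?k = "\<lambda>x. infdist x (- \<Omega>)"
    have "?k \<in> C_infty \<Omega>"
    proof (rule C_infty_compact_exhaustion)
      show "continuous_on \<Omega> ?k" by (intro continuous_on_infdist continuous_on_id)
      fix e :: real assume e: "0 < e"
      have sub: "{x. e \<le> ?k x} \<subseteq> \<Omega>"
      proof
        fix x assume "x \<in> {x. e \<le> ?k x}"
        then show "x \<in> \<Omega>" using e infdist_zero[of x "- \<Omega>"] by (cases "x \<in> \<Omega>") auto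
      qed
      moreover have "closed {x. e \<le> ?k x}"
        by (intro closed_Collect_le continuous_intros)
      ultimately have "compact {x. e \<le> ?k x}"
        using \<Omega>(1) bounded_subset compact_eq_bounded_closed by blast
      then show "\<exists>K. compact K \<and> K \<subseteq> \<Omega> \<and> (\<forall>x\<in>\<Omega> - K. \<bar>?k x\<bar> < e)"
        using sub by (intro exI[of _ "{x. e \<le> ?k x}"]) (auto simp: infdist_nonneg not_le)
    qed (auto intro: infdist_zero)
    moreover have "0 < ?k x" if "x \<in> \<Omega>" for x
      using infdist_pos_not_in_closed[of "- \<Omega>" x] \<Omega>(2) ne that by (simp add: closed_Compl)
    ultimately show ?thesis by blast
  qed
  then show ?thesis by blast
qed

text \<open>The distance to the complement of V, capped at 1 and multiplied by k, tests membership
  in V by a function of \<open>C_infty\<close>. The whole space is treated apart because its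
  complement is empty.\<close>

lemma C_infty_open_weight:
  fixes \<Omega> :: "'a::metric_space set"
  assumes k: "k \<in> C_infty \<Omega>" "\<And>x. x \<in> \<Omega> \<Longrightarrow> 0 < k x" and V: "open V"
  shows "\<exists>w\<in>C_infty \<Omega>. (\<forall>x. 0 \<le> w x) \<and> (\<forall>x\<in>\<Omega>. 0 < w x \<longleftrightarrow> x \<in> V)"
proof (cases "V = UNIV")
  case True
  have "0 \<le> k x" for x using k(2)[of x] C_infty_off[OF k(1), of x] by (cases "x \<in> \<Omega>") auto
  then show ?thesis using k True by (intro bexI[of _ k]) auto
next
  case False
  let ?c = "\<lambda>x. min 1 (infdist x (- V))"
  show ?thesis
  proof (intro bexI conjI allI ballI)
    show "(\<lambda>x. ?c x * k x) \<in> C_infty \<Omega>"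
      by (rule C_infty_mult_bounded[OF k(1), of _ 1])
         (auto intro!: continuous_intros continuous_on_infdist simp: infdist_nonneg)
    show "0 \<le> ?c x * k x" for x
      using k(2)[of x] C_infty_off[OF k(1), of x] by (cases "x \<in> \<Omega>") (auto simp: infdist_nonneg)
    show "0 < ?c x * k x \<longleftrightarrow> x \<in> V" if "x \<in> \<Omega>" for x
      using k(2)[OF that] infdist_pos_not_in_closed[of "- V" x] V False infdist_zero[of x "- V"]
      by (cases "x \<in> V") (auto simp: closed_Compl zero_less_mult_iff)
  qed
qed

text \<open>For growing n these functions increase to the indicator of {w > 0}: approximations of
  indicators of open sets within \<open>C_infty\<close>.\<close>

lemma C_infty_min_one:
  fixes w :: "'a::metric_space \<Rightarrow> real"
  assumes w: "w \<in> C_infty E" "\<And>x. 0 \<le> w x"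
  shows "(\<lambda>x. min 1 (real n * w x)) \<in> C_infty E"
proof (rule C_infty_compact_exhaustion)
  show "min 1 (real n * w x) = 0" if "x \<notin> E" for x using C_infty_off[OF w(1) that] by simp
  show "continuous_on E (\<lambda>x. min 1 (real n * w x))"
    by (intro continuous_on_min continuous_on_const continuous_on_mult_left C_infty_continuous_on[OF w(1)])
  fix e :: real assume e: "0 < e"
  let ?K = "{x\<in>E. e / (real n + 1) \<le> \<bar>w x\<bar>}"
  have "\<bar>min 1 (real n * w x)\<bar> < e" if "x \<in> E - ?K" for x
  proof -
    have "w x < e / (real n + 1)" using that w(2)[of x] by auto
    then have "(real n + 1) * w x < e" by (simp add: less_divide_eq mult.commute)
    moreover have "0 \<le> real n * w x" using w(2)[of x] by simp
    ultimately show ?thesis using w(2)[of x] by (simp add: distrib_right)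
  qed
  moreover have "compact ?K" using e by (intro C_infty_compact[OF w(1)]) simp
  ultimately show "\<exists>K. compact K \<and> K \<subseteq> E \<and> (\<forall>x\<in>E - K. \<bar>min 1 (real n * w x)\<bar> < e)"
    by (intro exI[of _ ?K]) auto
qed

lemma min_one_indicator_limit:
  assumes "0 \<le> (w::real)"
  shows "(\<lambda>n. min 1 (real n * w)) \<longlonglongrightarrow> (if 0 < w then 1 else 0)"
proof (cases "0 < w")
  case True
  obtain N where N: "1 / w < real N" using reals_Archimedean2 by blast
  have "min 1 (real n * w) = 1" if "N \<le> n" for n
  proof -
    have "1 / w < real n" using N that by linarith
    then show ?thesis using True by (simp add: divide_less_eq)
  qed
  then have "\<forall>\<^sub>F n in sequentially. min 1 (real n * w) = 1" unfolding eventually_sequentially by blast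
  then show ?thesis using True by (simp add: tendsto_eventually)
qed (use assms in simp)

section \<open>Measurability and laws of the Feller process\<close>

lemma space_borel_sigma_of [simp]: "space (borel_sigma_of X) = topspace X"
  unfolding borel_sigma_of_def by (rule space_measure_of) (auto dest: openin_subset)

lemma sets_borel_sigma_of: "sets (borel_sigma_of X) = sigma_sets (topspace X) {U. openin X U}"
  unfolding borel_sigma_of_def by (rule sets_measure_of) (auto dest: openin_subset)

lemma C_infty_measurable_compactified:
  assumes "f \<in> C_infty \<Omega>"
  shows "at_cemetery_zero f \<in> borel_measurable (borel_sigma_of (compactified \<Omega>))"
proof (rule borel_measurableI)
  fix U :: "real set" assume "open U"
  then have "openin (compactified \<Omega>) {z \<in> topspace (compactified \<Omega>). at_cemetery_zero f z \<in> U}"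
    using assms by (intro openin_continuous_map_preimage[where Y = euclideanreal]) (auto simp: C_infty_def)
  moreover have "{z \<in> topspace (compactified \<Omega>). at_cemetery_zero f z \<in> U}
      = at_cemetery_zero f -` U \<inter> space (borel_sigma_of (compactified \<Omega>))" by auto
  ultimately show "at_cemetery_zero f -` U \<inter> space (borel_sigma_of (compactified \<Omega>)) \<in> sets (borel_sigma_of (compactified \<Omega>))"
    unfolding sets_borel_sigma_of by (metis mem_Collect_eq sigma_sets.Basic)
qed

text \<open>The strictly positive function \<open>k\<close> detects survival through a right-continuous real-valued
  process, which reduces measurability questions to the real case.\<close>

locale feller_path = prob_space M + contraction_semigroup \<Omega> P
  for M :: "'w measure" and \<Omega> :: "'a::euclidean_space set" and P +
  fixes x :: 'a and B :: "real \<Rightarrow> 'w \<Rightarrow> 'a option" and k :: "'a \<Rightarrow> real"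
  assumes process: "feller_process M \<Omega> P x B" and H1: "H1 \<Omega> P" and \<Omega>_borel [measurable]: "\<Omega> \<in> sets borel"
    and x: "x \<in> \<Omega>" and k: "k \<in> C_infty \<Omega>" "\<And>y. y \<in> \<Omega> \<Longrightarrow> 0 < k y"
begin

definition alive :: "real \<Rightarrow> 'w \<Rightarrow> bool" where
  "alive s \<omega> \<longleftrightarrow> B s \<omega> \<noteq> None"

text \<open>The default x lies in \<Omega>, so the location stays in \<Omega> also after
  death.\<close>

definition loc :: "real \<Rightarrow> 'w \<Rightarrow> 'a" where
  "loc s \<omega> = (case B s \<omega> of None \<Rightarrow> x | Some y \<Rightarrow> y)"

lemma at_cemetery_zero_eq: "at_cemetery_zero f (B s \<omega>) = (if alive s \<omega> then f (loc s \<omega>) else 0)"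
  by (auto simp: at_cemetery_zero_def alive_def loc_def split: option.splits)

lemma B_measurable: "0 \<le> r \<Longrightarrow> B r \<in> measurable M (borel_sigma_of (compactified \<Omega>))"
  using process by (simp add: feller_process_def)

lemma loc_in: "\<omega> \<in> space M \<Longrightarrow> 0 \<le> s \<Longrightarrow> loc s \<omega> \<in> \<Omega>"
  using measurable_space[OF B_measurable, of s \<omega>] x by (auto simp: loc_def split: option.splits)

lemma alive_antimono: "\<omega> \<in> space M \<Longrightarrow> 0 \<le> r \<Longrightarrow> r \<le> s \<Longrightarrow> alive s \<omega> \<Longrightarrow> alive r \<omega>"
proof -
  have "\<forall>\<omega>\<in>space M. \<forall>r\<ge>0. \<forall>s\<ge>r. B r \<omega> = None \<longrightarrow> B s \<omega> = None"
    using process unfolding feller_process_def by (elim conjE)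
  from this[rule_format, of \<omega> r s]
  show "\<omega> \<in> space M \<Longrightarrow> 0 \<le> r \<Longrightarrow> r \<le> s \<Longrightarrow> alive s \<omega> \<Longrightarrow> alive r \<omega>"
    unfolding alive_def by (cases "B r \<omega>") auto
qed

lemma right_continuous:
  assumes f: "f \<in> C_infty \<Omega>" and \<omega>: "\<omega> \<in> space M" and r: "0 \<le> r"
  shows "((\<lambda>s. at_cemetery_zero f (B s \<omega>)) \<longlongrightarrow> at_cemetery_zero f (B r \<omega>)) (at_right r)"
proof -
  have "limitin (compactified \<Omega>) (\<lambda>s. B s \<omega>) (B r \<omega>) (at_right r)"
    using process \<omega> r by (simp add: feller_process_def)
  moreover have "continuous_map (compactified \<Omega>) euclideanreal (at_cemetery_zero f)"
    using f by (simp add: C_infty_def)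
  ultimately have "limitin euclideanreal (at_cemetery_zero f \<circ> (\<lambda>s. B s \<omega>)) (at_cemetery_zero f (B r \<omega>)) (at_right r)"
    by (intro continuous_map_limit)
  then show ?thesis by (simp add: o_def)
qed

lemma alive_iff:
  assumes "\<omega> \<in> space M" "0 \<le> s"
  shows "alive s \<omega> \<longleftrightarrow> 0 < at_cemetery_zero k (B s \<omega>)"
  using k(2)[OF loc_in[OF assms]] by (simp add: at_cemetery_zero_eq)

text \<open>B is evaluated at a random time f z and a sample point g z. N is M or the sigma-algebra
  generated by B, the latter for use with independence.\<close>

context
  fixes N :: "'w measure" and K :: "'b measure" and f :: "'b \<Rightarrow> real" and g
  assumes N: "\<And>r. 0 \<le> r \<Longrightarrow> B r \<in> measurable N (borel_sigma_of (compactified \<Omega>))" "space N = space M"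
    and f: "f \<in> borel_measurable K" and g: "g \<in> measurable K N"
begin

lemma B_joint:
  assumes w: "w \<in> C_infty \<Omega>"
  shows "(\<lambda>z. at_cemetery_zero w (B (max 0 (f z)) (g z))) \<in> borel_measurable K"
proof -
  have "(\<lambda>(r, \<omega>). at_cemetery_zero w (B (max 0 r) \<omega>)) \<in> borel_measurable (borel \<Otimes>\<^sub>M N)"
    by (rule measurable_right_continuous_process)
       (use N in \<open>auto intro: measurable_compose[OF _ C_infty_measurable_compactified[OF w]] right_continuous[OF w]\<close>)
  from measurable_compose[OF measurable_Pair[OF f g] this] show ?thesis by simp
qed

lemma g_space: "z \<in> space K \<Longrightarrow> g z \<in> space M"
  using measurable_space[OF g] N(2) by simp

lemma alive_joint: "Measurable.pred K (\<lambda>z. alive (max 0 (f z)) (g z))"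
proof -
  note [measurable] = B_joint[OF k(1)]
  have "Measurable.pred K (\<lambda>z. 0 < at_cemetery_zero k (B (max 0 (f z)) (g z)))" by measurable
  then show ?thesis by (rule measurable_cong[THEN iffD1, rotated]) (simp add: alive_iff g_space)
qed

text \<open>For open V a weight w that is positive in \<Omega> exactly on V decides the preimage:
  while alive, the location is in V if and only if w is positive there; after death it is the
  constant x.\<close>

lemma loc_joint: "(\<lambda>z. loc (max 0 (f z)) (g z)) \<in> borel_measurable K"
proof (rule borel_measurableI)
  fix V :: "'a set" assume V: "open V"
  obtain w where w: "w \<in> C_infty \<Omega>" and w': "(\<forall>y. 0 \<le> w y) \<and> (\<forall>y\<in>\<Omega>. 0 < w y \<longleftrightarrow> y \<in> V)"
    using C_infty_open_weight[OF k V] by (rule bexE)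
  note w = w conjunct1[OF w', rule_format] conjunct2[OF w', rule_format]
  note [measurable] = B_joint[OF w(1)] alive_joint
  have "loc (max 0 (f z)) (g z) \<in> V \<longleftrightarrow>
      (if alive (max 0 (f z)) (g z) then 0 < at_cemetery_zero w (B (max 0 (f z)) (g z)) else x \<in> V)"
    if "z \<in> space K" for z
    using w(3)[OF loc_in[OF g_space[OF that], of "max 0 (f z)"]]
    by (auto simp: at_cemetery_zero_eq) (auto simp: alive_def loc_def)
  then have "(\<lambda>z. loc (max 0 (f z)) (g z)) -` V \<inter> space K
      = {z \<in> space K. if alive (max 0 (f z)) (g z) then 0 < at_cemetery_zero w (B (max 0 (f z)) (g z)) else x \<in> V}"
    by auto
  also have "\<dots> \<in> sets K" by measurable
  finally show "(\<lambda>z. loc (max 0 (f z)) (g z)) -` V \<inter> space K \<in> sets K" .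
qed

end

lemma loc_measurable [measurable]: "0 \<le> s \<Longrightarrow> loc s \<in> borel_measurable M"
  using loc_joint[OF B_measurable refl borel_measurable_const[of s] measurable_ident] by (simp add: max_absorb2)

lemma alive_measurable [measurable]: "0 \<le> s \<Longrightarrow> Measurable.pred M (alive s)"
  using alive_joint[OF B_measurable refl borel_measurable_const[of s] measurable_ident] by (simp add: max_absorb2)

text \<open>The Markov property at time 0, where B is the constant x, followed by taking
  expectations on both sides.\<close>

lemma expectation_C_infty_path:
  assumes v: "v \<in> C_infty \<Omega>" and r: "0 \<le> r"
  shows "(\<integral>\<omega>. at_cemetery_zero v (B r \<omega>) \<partial>M) = P r v x"
proof -
  let ?F = "sigma_of_process M (borel_sigma_of (compactified \<Omega>)) B {0..0}"
  have "subalgebra M ?F"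
    unfolding subalgebra_def using sets_sigma_of_process_subset[of "{0..0}" B M] B_measurable by auto
  then interpret F: finite_measure_subalgebra M ?F by unfold_locales
  obtain C where C: "\<And>y. \<bar>v y\<bar> \<le> C" using C_infty_bounded[OF v] by blast
  have m: "(\<lambda>\<omega>. at_cemetery_zero v (B r \<omega>)) \<in> borel_measurable M"
    by (rule measurable_compose[OF B_measurable[OF r] C_infty_measurable_compactified[OF v]])
  have int: "integrable M (\<lambda>\<omega>. at_cemetery_zero v (B r \<omega>))"
    by (rule integrable_const_bound[where B = C, OF _ m])
       (use C order_trans[OF abs_ge_zero C[of x]] in \<open>auto simp: at_cemetery_zero_eq\<close>)
  have "\<forall>s\<ge>0. \<forall>r\<ge>0. \<forall>v\<in>C_infty \<Omega>. AE \<omega> in M.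
        real_cond_exp M (sigma_of_process M (borel_sigma_of (compactified \<Omega>)) B {0..s})
          (\<lambda>\<omega>. at_cemetery_zero v (B (s + r) \<omega>)) \<omega> = at_cemetery_zero (P r v) (B s \<omega>)"
    using process unfolding feller_process_def by blast
  from this[rule_format, OF order_refl r v]
  have "AE \<omega> in M. real_cond_exp M ?F (\<lambda>\<omega>. at_cemetery_zero v (B r \<omega>)) \<omega> = at_cemetery_zero (P r v) (B 0 \<omega>)"
    by simp
  then have ae: "AE \<omega> in M. real_cond_exp M ?F (\<lambda>\<omega>. at_cemetery_zero v (B r \<omega>)) \<omega> = P r v x"
  proof (rule AE_mp, intro AE_I2 impI)
    fix \<omega> assume "\<omega> \<in> space M" "real_cond_exp M ?F (\<lambda>\<omega>. at_cemetery_zero v (B r \<omega>)) \<omega> = at_cemetery_zero (P r v) (B 0 \<omega>)"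
    moreover have "B 0 \<omega> = Some x" using process \<open>\<omega> \<in> space M\<close> by (simp add: feller_process_def)
    ultimately show "real_cond_exp M ?F (\<lambda>\<omega>. at_cemetery_zero v (B r \<omega>)) \<omega> = P r v x"
      by (simp add: at_cemetery_zero_def)
  qed
  have "(\<integral>\<omega>. at_cemetery_zero v (B r \<omega>) \<partial>M) = (\<integral>\<omega>. real_cond_exp M ?F (\<lambda>\<omega>. at_cemetery_zero v (B r \<omega>)) \<omega> \<partial>M)"
    by (rule F.real_cond_exp_int(2)[OF int, symmetric])
  also have "\<dots> = (\<integral>\<omega>. P r v x \<partial>M)"
    by (rule integral_cong_AE) (use F.real_cond_exp_int(1)[OF int] ae in auto)
  finally show ?thesis by (simp add: prob_space)
qed

text \<open>(H1) gives the density against functions of \<open>C_infty\<close>. The approximations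
  min 1 (n w) extend this to indicators of open sets, which generate the Borel sets and are stable
  under intersection.\<close>

lemma AE_loc_null:
  assumes s: "0 < s" and A: "A \<in> null_sets lborel"
  shows "AE \<omega> in M. alive s \<omega> \<longrightarrow> loc s \<omega> \<notin> A"
proof -
  have s0: "0 \<le> s" using s by simp
  obtain p where p': "(\<forall>y\<in>\<Omega>. 0 \<le> p y) \<and> set_integrable lborel \<Omega> p \<and>
      (\<forall>v\<in>C_infty \<Omega>. P s v x = (LINT y:\<Omega>|lborel. v y * p y))"
    using H1[unfolded H1_def, THEN spec, THEN mp, OF s, THEN bspec, OF x] by (rule exE)
  then have p: "\<And>y. y \<in> \<Omega> \<Longrightarrow> 0 \<le> p y" "set_integrable lborel \<Omega> p"
    "\<And>v. v \<in> C_infty \<Omega> \<Longrightarrow> P s v x = (LINT y:\<Omega>|lborel. v y * p y)"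
    by simp_all
  \<comment> \<open>p is controlled on \<Omega> only; its extension by 0 is integrable and
    nonnegative on the whole space.\<close>
  define q where "q y = indicator \<Omega> y * p y" for y
  have "integrable lborel q" using p(2) by (simp add: q_def[abs_def] set_integrable_def)
  moreover have "0 \<le> q y" for y using p(1)[of y] by (simp add: q_def indicator_def)
  ultimately have q: "integrable lborel q" "\<And>y. 0 \<le> q y" by simp_all
  then have qm [measurable]: "q \<in> borel_measurable borel" by auto
  note [measurable] = loc_measurable[OF s0] alive_measurable[OF s0]
  \<comment> \<open>The law of the location on the event of survival; the density drops the mass at
    the cemetery.\<close>
  define m1 where "m1 = distr (density M (\<lambda>\<omega>. if alive s \<omega> then 1 else 0)) borel (loc s)"
  define m2 where "m2 = density lborel (\<lambda>y. ennreal (q y))"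
  have m1: "emeasure m1 V = ennreal (\<integral>\<omega>. (if alive s \<omega> \<and> loc s \<omega> \<in> V then 1 else 0) \<partial>M)"
    if [measurable]: "V \<in> sets borel" for V
  proof -
    have "emeasure m1 V = (\<integral>\<^sup>+\<omega>. ennreal (if alive s \<omega> \<and> loc s \<omega> \<in> V then 1 else 0) \<partial>M)"
      unfolding m1_def
      by (subst emeasure_distr, simp, simp, subst emeasure_density)
         (auto intro!: nn_integral_cong simp: indicator_def)
    also have "\<dots> = ennreal (\<integral>\<omega>. (if alive s \<omega> \<and> loc s \<omega> \<in> V then 1 else 0) \<partial>M)"
      by (rule nn_integral_eq_integral) (auto intro!: integrable_const_bound[of _ 1])
    finally show ?thesis .
  qed
  have m2: "emeasure m2 V = ennreal (\<integral>y. indicator V y * q y \<partial>lborel)" if [measurable]: "V \<in> sets borel" for V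
  proof -
    have "emeasure m2 V = (\<integral>\<^sup>+y. ennreal (indicator V y * q y) \<partial>lborel)"
      unfolding m2_def by (subst emeasure_density) (auto intro!: nn_integral_cong simp: indicator_def)
    also have "\<dots> = ennreal (\<integral>y. indicator V y * q y \<partial>lborel)"
      by (rule nn_integral_eq_integral)
         (use integrable_real_mult_indicator[OF _ q(1), of V] q(2) in \<open>auto simp: mult.commute\<close>)
    finally show ?thesis .
  qed
  have "m1 = m2"
  proof (rule measure_eqI_generator_eq[where \<Omega> = UNIV and E = "{S. open S}" and A = "\<lambda>_. UNIV"])
    show "Int_stable {S :: 'a set. open S}" by (auto simp: Int_stable_def)
    show "sets m1 = sigma_sets UNIV {S. open S}" "sets m2 = sigma_sets UNIV {S. open S}"
      by (simp_all add: m1_def m2_def borel_def)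
    show "emeasure m1 UNIV \<noteq> \<infinity>" by (simp add: m1)
    fix V :: "'a set" assume "V \<in> {S. open S}"
    then have V: "open V" and [measurable]: "V \<in> sets borel" by auto
    obtain w where w: "w \<in> C_infty \<Omega>" and w': "(\<forall>y. 0 \<le> w y) \<and> (\<forall>y\<in>\<Omega>. 0 < w y \<longleftrightarrow> y \<in> V)"
      using C_infty_open_weight[OF k V] by (rule bexE)
    note w = w conjunct1[OF w', rule_format] conjunct2[OF w', rule_format]
    have wm [measurable]: "w \<in> borel_measurable borel" by (rule C_infty_borel_measurable[OF w(1) \<Omega>_borel])
    let ?v = "\<lambda>n y. min 1 (real n * w y)"
    have vC: "?v n \<in> C_infty \<Omega>" for n by (rule C_infty_min_one[OF w(1,2)])
    have eq: "(\<integral>\<omega>. at_cemetery_zero (?v n) (B s \<omega>) \<partial>M) = (\<integral>y. ?v n y * q y \<partial>lborel)" for n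
      unfolding expectation_C_infty_path[OF vC s0] p(3)[OF vC] set_lebesgue_integral_def
      by (rule Bochner_Integration.integral_cong) (auto simp: q_def)
    have "(\<lambda>n. \<integral>\<omega>. at_cemetery_zero (?v n) (B s \<omega>) \<partial>M) \<longlonglongrightarrow> (\<integral>\<omega>. (if alive s \<omega> \<and> loc s \<omega> \<in> V then 1 else 0) \<partial>M)"
    proof (rule integral_dominated_convergence[where w = "\<lambda>_. 1"])
      show "AE \<omega> in M. (\<lambda>n. at_cemetery_zero (?v n) (B s \<omega>)) \<longlonglongrightarrow> (if alive s \<omega> \<and> loc s \<omega> \<in> V then 1 else 0)"
      proof (rule AE_I2)
        fix \<omega> assume "\<omega> \<in> space M"
        then show "(\<lambda>n. at_cemetery_zero (?v n) (B s \<omega>)) \<longlonglongrightarrow> (if alive s \<omega> \<and> loc s \<omega> \<in> V then 1 else 0)"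
          using min_one_indicator_limit[OF w(2), of "loc s \<omega>"] w(3)[OF loc_in[OF _ s0]]
          by (cases "alive s \<omega>") (simp_all add: at_cemetery_zero_eq)
      qed
      show "AE \<omega> in M. norm (at_cemetery_zero (?v n) (B s \<omega>)) \<le> 1" for n
        using w(2) by (auto simp: at_cemetery_zero_eq)
      show "(\<lambda>\<omega>. at_cemetery_zero (?v n) (B s \<omega>)) \<in> borel_measurable M" for n
        unfolding at_cemetery_zero_eq by measurable
    qed auto
    moreover have "(\<lambda>n. \<integral>y. ?v n y * q y \<partial>lborel) \<longlonglongrightarrow> (\<integral>y. indicator V y * q y \<partial>lborel)"
    proof (rule integral_dominated_convergence[where w = q])
      show "AE y in lborel. (\<lambda>n. ?v n y * q y) \<longlonglongrightarrow> indicator V y * q y"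
      proof (rule AE_I2)
        fix y
        have eq: "(if 0 < w y then 1 else 0) * q y = indicator V y * q y"
          using w(3)[of y] by (auto simp: q_def indicator_def)
        show "(\<lambda>n. ?v n y * q y) \<longlonglongrightarrow> indicator V y * q y"
          using tendsto_mult_right[OF min_one_indicator_limit[OF w(2), of y], of "q y"] unfolding eq .
      qed
      show "AE y in lborel. norm (?v n y * q y) \<le> q y" for n
      proof (rule AE_I2)
        fix y
        have "0 \<le> ?v n y" "?v n y \<le> 1" using w(2)[of y] by auto
        then show "norm (?v n y * q y) \<le> q y"
          using q(2)[of y] mult_right_mono[of "?v n y" 1 "q y"] by (simp add: abs_mult)
      qed
    qed (use q in auto)
    ultimately have "(\<integral>\<omega>. (if alive s \<omega> \<and> loc s \<omega> \<in> V then 1 else 0) \<partial>M) = (\<integral>y. indicator V y * q y \<partial>lborel)"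
      unfolding eq by (rule LIMSEQ_unique)
    then show "emeasure m1 V = emeasure m2 V" by (simp add: m1 m2)
  qed auto
  have Ab [measurable]: "A \<in> sets borel" using A by auto
  have "absolutely_continuous lborel m2" unfolding m2_def by (rule absolutely_continuousI_density) auto
  then have "A \<in> null_sets m1" using A \<open>m1 = m2\<close> by (auto simp: absolutely_continuous_def)
  then have "AE y in m1. y \<notin> A" by (rule AE_not_in)
  then have "AE \<omega> in density M (\<lambda>\<omega>. if alive s \<omega> then 1 else 0). loc s \<omega> \<notin> A"
    unfolding m1_def by (subst (asm) AE_distr_iff) auto
  then have "AE \<omega> in M. 0 < (if alive s \<omega> then 1 else 0 :: ennreal) \<longrightarrow> loc s \<omega> \<notin> A"
    by (subst (asm) AE_density) auto
  then show ?thesis by (rule eventually_mono) auto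
qed

end

text \<open>Fubini's theorem for null sets, combined with the reflection taking s to t - s, which
  preserves null sets.\<close>

lemma AE_lborel_slice:
  fixes N :: "(real \<times> 'a::euclidean_space) set"
  assumes N: "N \<in> null_sets lborel"
  obtains N1 where "N1 \<in> null_sets lborel" "\<And>s. s \<notin> N1 \<Longrightarrow> {y. (t - s, y) \<in> N} \<in> null_sets lborel"
proof -
  have "N \<in> sets borel" using N by auto
  then have N' [measurable]: "N \<in> sets (borel \<Otimes>\<^sub>M borel)" unfolding borel_prod .
  have "AE z in lborel \<Otimes>\<^sub>M lborel. z \<notin> N" using AE_not_in[OF N] unfolding lborel_prod .
  from lborel_pair.AE_pair[OF this] have "AE s in lborel. AE y in lborel. (s, y) \<notin> N" .
  then obtain N0 where N0: "N0 \<in> null_sets lborel" "{s. \<not> (AE y in lborel. (s, y) \<notin> N)} \<subseteq> N0"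
    unfolding eventually_ae_filter by auto
  have [measurable]: "N0 \<in> sets borel" using N0 by auto
  have "AE s in lborel. s \<notin> N0" by (rule AE_not_in[OF N0(1)])
  then have "AE s in lborel. t + (- 1) * s \<notin> N0" by (intro AE_borel_affine) auto
  then obtain N1 where N1: "N1 \<in> null_sets lborel" "{s. \<not> t + (- 1) * s \<notin> N0} \<subseteq> N1"
    unfolding eventually_ae_filter by auto
  show thesis
  proof (rule that[OF N1(1)])
    fix s assume "s \<notin> N1"
    then have "t - s \<notin> N0" using N1(2) by auto
    then have ae: "AE y in lborel. (t - s, y) \<notin> N" using N0(2) by auto
    have "{y. (t - s, y) \<in> N} = Pair (t - s) -` N" by auto
    moreover have "Pair (t - s) -` N \<in> sets borel" using sets_Pair1[OF N'] by simp
    ultimately show "{y. (t - s, y) \<in> N} \<in> null_sets lborel"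
      using ae AE_iff_null_sets[of "Pair (t - s) -` N" lborel] by simp
  qed
qed

section \<open>Expectations along the time-changed path\<close>

locale subordinated_path = subordinator M \<nu> S + feller_path M \<Omega> P x B k
  for M :: "'w measure" and \<nu> S and \<Omega> :: "'a::euclidean_space set" and P x B k +
  assumes indep: "independent_processes M (borel_sigma_of (compactified \<Omega>)) B borel S"
begin

interpretation LM: pair_sigma_finite lborel M ..

abbreviation "\<sigma>S \<equiv> sigma_of_process M borel S {0..}"
abbreviation "\<sigma>B \<equiv> sigma_of_process M (borel_sigma_of (compactified \<Omega>)) B {0..}"

lemma \<sigma>S_measurable: "0 \<le> r \<Longrightarrow> S r \<in> borel_measurable \<sigma>S"
  by (rule measurable_sigma_of_process) auto

lemma \<sigma>B_measurable: "0 \<le> r \<Longrightarrow> B r \<in> measurable \<sigma>B (borel_sigma_of (compactified \<Omega>))"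
  by (rule measurable_sigma_of_process) (use measurable_space[OF B_measurable] in auto)

text \<open>X is a functional of S and H depends on the second sample point through B, so B can be
  averaged out with X frozen.\<close>

lemma integral_independent:
  fixes H :: "real \<times> 'w \<Rightarrow> real"
  assumes X: "X \<in> borel_measurable \<sigma>S" and H: "H \<in> borel_measurable (borel \<Otimes>\<^sub>M \<sigma>B)" and bd: "\<And>p. \<bar>H p\<bar> \<le> C"
  shows "(\<integral>\<omega>. H (X \<omega>, \<omega>) \<partial>M) = (\<integral>\<omega>. (\<integral>\<omega>'. H (X \<omega>, \<omega>') \<partial>M) \<partial>M)"
proof -
  have "indep_set (sets \<sigma>B) (sets \<sigma>S)" using indep by (simp add: independent_processes_def)
  then have "indep_set (sets \<sigma>S) (sets \<sigma>B)" unfolding indep_sets2_eq by (metis Int_commute mult.commute)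
  moreover have "(\<lambda>p. H (X (fst p), snd p)) \<in> borel_measurable (\<sigma>S \<Otimes>\<^sub>M \<sigma>B)"
    by (rule measurable_compose[OF measurable_Pair H]) (auto intro: measurable_compose[OF measurable_fst X])
  ultimately show ?thesis
    using integral_pair_indep[of \<sigma>S \<sigma>B "\<lambda>p. H (X (fst p), snd p)" C] bd by simp
qed

text \<open>Here s is the clock of B; the subordinated path is obtained at s = S r.\<close>

definition along :: "(real \<times> 'a \<Rightarrow> real) \<Rightarrow> real \<Rightarrow> real \<Rightarrow> 'w \<Rightarrow> real" where
  "along g t s \<omega> = at_cemetery_zero (\<lambda>y. g (t - s, y)) (B s \<omega>)"

lemma along_joint:
  assumes N: "\<And>r. 0 \<le> r \<Longrightarrow> B r \<in> measurable N (borel_sigma_of (compactified \<Omega>))" "space N = space M"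
    and f [measurable]: "f \<in> borel_measurable K" and h: "h \<in> measurable K N" and g: "g \<in> borel_measurable borel"
  shows "(\<lambda>z. along g t (max 0 (f z)) (h z)) \<in> borel_measurable K"
proof -
  note [measurable] = alive_joint[OF N f h] loc_joint[OF N f h]
  have [measurable]: "g \<in> borel_measurable (borel \<Otimes>\<^sub>M borel)" using g by (simp add: borel_prod)
  show ?thesis unfolding along_def at_cemetery_zero_eq by measurable
qed

lemma along_bound: "(\<And>z. \<bar>g z\<bar> \<le> C) \<Longrightarrow> \<bar>along g t s \<omega>\<bar> \<le> C"
  using order_trans[OF abs_ge_zero, of "g (0, x)" C] by (auto simp: along_def at_cemetery_zero_eq)

lemma along_pair_measurable:
  assumes g: "g \<in> borel_measurable borel"
  shows "(\<lambda>p. along g t (S (max 0 (fst p)) (snd p)) (snd p)) \<in> borel_measurable (lborel \<Otimes>\<^sub>M M)"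
proof -
  have "(\<lambda>p. along g t (max 0 (S (max 0 (fst p)) (snd p))) (snd p)) \<in> borel_measurable (lborel \<Otimes>\<^sub>M M)"
    by (rule along_joint[OF B_measurable refl S_pair_measurable measurable_snd g])
  then show ?thesis
    by (rule measurable_cong[THEN iffD1, rotated]) (auto simp: space_pair_measure max_absorb2[OF S_nonneg])
qed

text \<open>S (\<open>hit t\<close>) is a functional of S alone; conditionally on it, B is evaluated
  at a fixed time, where its expectation is given by P.\<close>

lemma expectation_at_passage:
  assumes \<phi>: "\<phi> \<in> C_infty \<Omega>"
  shows "(\<integral>\<omega>. at_cemetery_zero \<phi> (B (S (hit t \<omega>) \<omega>) \<omega>) \<partial>M) = (\<integral>\<omega>. P (S (hit t \<omega>) \<omega>) \<phi> x \<partial>M)"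
proof -
  obtain C where C: "\<And>y. \<bar>\<phi> y\<bar> \<le> C" using C_infty_bounded[OF \<phi>] by blast
  let ?H = "\<lambda>p. at_cemetery_zero \<phi> (B (max 0 (fst p)) (snd p))"
  have nn: "0 \<le> S (hit t \<omega>) \<omega>" if "\<omega> \<in> space M" for \<omega> using that by (simp add: S_nonneg hit_nonneg)
  have "(\<integral>\<omega>. ?H (S (hit t \<omega>) \<omega>, \<omega>) \<partial>M) = (\<integral>\<omega>. (\<integral>\<omega>'. ?H (S (hit t \<omega>) \<omega>, \<omega>') \<partial>M) \<partial>M)"
  proof (rule integral_independent[where C = C])
    show "(\<lambda>\<omega>. S (hit t \<omega>) \<omega>) \<in> borel_measurable \<sigma>S" by (rule S_hit_measurable[OF \<sigma>S_measurable]) simp_all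
    show "?H \<in> borel_measurable (borel \<Otimes>\<^sub>M \<sigma>B)"
      by (rule B_joint[OF \<sigma>B_measurable _ measurable_fst measurable_snd \<phi>]) simp_all
    show "\<bar>?H p\<bar> \<le> C" for p using C order_trans[OF abs_ge_zero C[of x]] by (simp add: at_cemetery_zero_eq)
  qed
  moreover have "(\<integral>\<omega>. ?H (S (hit t \<omega>) \<omega>, \<omega>) \<partial>M) = (\<integral>\<omega>. at_cemetery_zero \<phi> (B (S (hit t \<omega>) \<omega>) \<omega>) \<partial>M)"
    by (rule Bochner_Integration.integral_cong[OF refl]) (simp add: max_absorb2[OF nn])
  moreover have "(\<integral>\<omega>. (\<integral>\<omega>'. ?H (S (hit t \<omega>) \<omega>, \<omega>') \<partial>M) \<partial>M) = (\<integral>\<omega>. P (S (hit t \<omega>) \<omega>) \<phi> x \<partial>M)"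
    by (rule Bochner_Integration.integral_cong[OF refl]) (simp add: max_absorb2[OF nn] expectation_C_infty_path[OF \<phi> nn])
  ultimately show ?thesis by simp
qed

text \<open>For fixed r, S r = s \<le> t is frozen. Averaging over B then gives P s applied to the
  slice of \<gamma> at t - s, which is the shift semigroup at (t, x).\<close>

lemma potential_along:
  assumes \<gamma>: "\<gamma> \<in> C_infty ({0..T} \<times> \<Omega>)" and t: "t \<in> {0..T}"
  shows "(\<integral>p. below t p * shift_semigroup T P (S (max 0 (fst p)) (snd p)) \<gamma> (t, x) \<partial>(lborel \<Otimes>\<^sub>M M))
    = (\<integral>p. below t p * along \<gamma> t (S (max 0 (fst p)) (snd p)) (snd p) \<partial>(lborel \<Otimes>\<^sub>M M))"
proof -
  let ?K = "shift_semigroup T P" and ?S = "\<lambda>p. S (max 0 (fst p)) (snd p)"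
  interpret Sh: contraction_semigroup "{0..T} \<times> \<Omega>" ?K
    by (rule contraction_semigroup_shift) (rule contraction_semigroup_axioms)
  obtain C where C: "\<And>z. \<bar>\<gamma> z\<bar> \<le> C" using C_infty_bounded[OF \<gamma>] by blast
  have nn: "0 \<le> ?S p" if "p \<in> space (lborel \<Otimes>\<^sub>M M)" for p
    using that by (intro S_nonneg) (auto simp: space_pair_measure)
  have \<gamma>b: "\<gamma> \<in> borel_measurable borel"
    by (rule C_infty_borel_measurable[OF \<gamma>])
       (simp add: borel_prod[symmetric] del: borel_prod)
  have i1: "integrable (lborel \<Otimes>\<^sub>M M) (\<lambda>p. below t p * ?K (?S p) \<gamma> (t, x))"
    by (rule integrable_below_mult[where C = C])
       (auto intro!: Sh.measurable_time[OF \<gamma> S_pair_measurable nn] AE_I2 Sh.contraction[OF nn \<gamma> C])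
  have i2: "integrable (lborel \<Otimes>\<^sub>M M) (\<lambda>p. below t p * along \<gamma> t (?S p) (snd p))"
    by (rule integrable_below_mult[where C = C]) (auto intro: along_pair_measurable[OF \<gamma>b] along_bound[OF C])
  have "(\<integral>\<omega>. below t (r, \<omega>) * ?K (?S (r, \<omega>)) \<gamma> (t, x) \<partial>M)
      = (\<integral>\<omega>. below t (r, \<omega>) * along \<gamma> t (?S (r, \<omega>)) (snd (r, \<omega>)) \<partial>M)" for r
  proof (cases "0 < r")
    case True
    let ?H = "\<lambda>p. indicator {..t} (fst p) * along \<gamma> t (max 0 (fst p)) (snd p)"
    have "(\<integral>\<omega>. ?H (S r \<omega>, \<omega>) \<partial>M) = (\<integral>\<omega>. (\<integral>\<omega>'. ?H (S r \<omega>, \<omega>') \<partial>M) \<partial>M)"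
    proof (rule integral_independent[where C = C])
      show "S r \<in> borel_measurable \<sigma>S" using True by (intro \<sigma>S_measurable) simp
      have [measurable]: "(\<lambda>p. along \<gamma> t (max 0 (fst p)) (snd p)) \<in> borel_measurable (borel \<Otimes>\<^sub>M \<sigma>B)"
        by (rule along_joint[OF \<sigma>B_measurable _ measurable_fst measurable_snd \<gamma>b]) simp_all
      show "?H \<in> borel_measurable (borel \<Otimes>\<^sub>M \<sigma>B)" by measurable
      show "\<bar>?H p\<bar> \<le> C" for p
        using along_bound[where g = \<gamma>, OF C, where t = t and s = "max 0 (fst p)" and \<omega> = "snd p"] order_trans[OF abs_ge_zero C[of "(0, x)"]]
        by (auto simp: indicator_def)
    qed
    moreover have "(\<integral>\<omega>. ?H (S r \<omega>, \<omega>) \<partial>M) = (\<integral>\<omega>. below t (r, \<omega>) * along \<gamma> t (?S (r, \<omega>)) (snd (r, \<omega>)) \<partial>M)"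
      by (rule Bochner_Integration.integral_cong[OF refl])
         (use True in \<open>simp add: below_def max_absorb2 S_nonneg\<close>)
    moreover have "(\<integral>\<omega>. (\<integral>\<omega>'. ?H (S r \<omega>, \<omega>') \<partial>M) \<partial>M) = (\<integral>\<omega>. below t (r, \<omega>) * ?K (?S (r, \<omega>)) \<gamma> (t, x) \<partial>M)"
    proof (rule Bochner_Integration.integral_cong[OF refl])
      fix \<omega> assume \<omega>: "\<omega> \<in> space M"
      have Sn: "0 \<le> S r \<omega>" using \<omega> True by (intro S_nonneg) auto
      show "(\<integral>\<omega>'. ?H (S r \<omega>, \<omega>') \<partial>M) = below t (r, \<omega>) * ?K (?S (r, \<omega>)) \<gamma> (t, x)"
      proof (cases "S r \<omega> \<le> t")
        case le: True
        have "(\<integral>\<omega>'. ?H (S r \<omega>, \<omega>') \<partial>M) = (\<integral>\<omega>'. at_cemetery_zero (\<lambda>y. \<gamma> (t - S r \<omega>, y)) (B (S r \<omega>) \<omega>') \<partial>M)"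
          using le Sn by (simp add: along_def max_absorb2)
        also have "\<dots> = P (S r \<omega>) (\<lambda>y. \<gamma> (t - S r \<omega>, y)) x"
          by (rule expectation_C_infty_path[OF C_infty_slice[OF \<gamma>] Sn])
        also have "\<dots> = ?K (S r \<omega>) \<gamma> (t, x)"
          unfolding shift_semigroup_apply[OF t] using le by (simp add: max_absorb2)
        finally show ?thesis using True le by (simp add: below_def max_absorb2)
      qed (use True in \<open>simp add: below_def max_absorb2\<close>)
    qed
    ultimately show ?thesis by simp
  qed (simp add: below_def)
  then show ?thesis
    unfolding LM.integral_fst'[OF i1, symmetric] LM.integral_fst'[OF i2, symmetric] by simp
qed

text \<open>For r > 0, S r avoids the null set of times at which the slice of N is not null, since
  its law is absolutely continuous. At any other time s > 0, B s avoids the slice by (H1). At r = 0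
  the point is (t, x) itself, hence the restriction to positive r.\<close>

lemma AE_along_null:
  assumes N: "N \<in> null_sets lborel"
  shows "AE p in lborel \<Otimes>\<^sub>M M. 0 < fst p \<longrightarrow> 0 < S (max 0 (fst p)) (snd p) \<and> S (max 0 (fst p)) (snd p) \<noteq> t \<and>
    (alive (S (max 0 (fst p)) (snd p)) (snd p) \<longrightarrow>
      (t - S (max 0 (fst p)) (snd p), loc (S (max 0 (fst p)) (snd p)) (snd p)) \<notin> N)"
proof -
  let ?S = "\<lambda>p. S (max 0 (fst p)) (snd p)"
  let ?Q = "\<lambda>p. 0 < fst p \<longrightarrow> 0 < ?S p \<and> ?S p \<noteq> t \<and> along (indicator N) t (?S p) (snd p) = 0"
  have Nb: "N \<in> sets borel" using N by auto
  have Nb': "(indicator N :: _ \<Rightarrow> real) \<in> borel_measurable borel" using Nb by simp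
  have "AE p in lborel \<Otimes>\<^sub>M M. ?Q p"
  proof (rule LM.AE_pair_measure)
    note [measurable] = S_pair_measurable along_pair_measurable[OF Nb']
    show "{p \<in> space (lborel \<Otimes>\<^sub>M M). ?Q p} \<in> sets (lborel \<Otimes>\<^sub>M M)" by measurable
    show "AE r in lborel. AE \<omega> in M. ?Q (r, \<omega>)"
    proof (rule AE_I2)
      fix r :: real
      show "AE \<omega> in M. ?Q (r, \<omega>)"
      proof (cases "0 < r")
        case True
        obtain N1 where N1: "N1 \<in> null_sets lborel" "\<And>s. s \<notin> N1 \<Longrightarrow> {y. (t - s, y) \<in> N} \<in> null_sets lborel"
          by (rule AE_lborel_slice[OF N, of t]) blast
        let ?H = "\<lambda>p. along (indicator N) t (max 0 (fst p)) (snd p)"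
        have Hm: "?H \<in> borel_measurable (borel \<Otimes>\<^sub>M \<sigma>B)"
          by (rule along_joint[OF \<sigma>B_measurable _ measurable_fst measurable_snd Nb']) simp_all
        have Hb: "\<bar>?H p\<bar> \<le> 1" for p by (rule along_bound) (simp add: indicator_def)
        have "(\<integral>\<omega>. ?H (S r \<omega>, \<omega>) \<partial>M) = (\<integral>\<omega>. (\<integral>\<omega>'. ?H (S r \<omega>, \<omega>') \<partial>M) \<partial>M)"
          using True by (intro integral_independent[OF \<sigma>S_measurable Hm Hb]) simp
        also have "\<dots> = 0"
        proof (rule integral_eq_zero_AE)
          show "AE \<omega> in M. (\<integral>\<omega>'. ?H (S r \<omega>, \<omega>') \<partial>M) = 0"
            using AE_S_pos[OF True] AE_S_null[OF True N1(1)]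
          proof eventually_elim
            case (elim \<omega>)
            have "AE \<omega>' in M. alive (S r \<omega>) \<omega>' \<longrightarrow> loc (S r \<omega>) \<omega>' \<notin> {y. (t - S r \<omega>, y) \<in> N}"
              using elim by (intro AE_loc_null N1(2)) auto
            then have "AE \<omega>' in M. ?H (S r \<omega>, \<omega>') = 0"
              by (rule eventually_mono) (use elim in \<open>auto simp: along_def at_cemetery_zero_eq max_absorb2\<close>)
            then show ?case by (rule integral_eq_zero_AE)
          qed
        qed
        finally have zero: "(\<integral>\<omega>. ?H (S r \<omega>, \<omega>) \<partial>M) = 0" .
        have Sr: "S r \<in> borel_measurable M" using True by (simp add: S_measurable)
        have m: "(\<lambda>\<omega>. ?H (S r \<omega>, \<omega>)) \<in> borel_measurable M"
          using along_joint[OF B_measurable refl Sr measurable_ident Nb'] by simp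
        have int: "integrable M (\<lambda>\<omega>. ?H (S r \<omega>, \<omega>))"
          by (rule integrable_const_bound[where B = 1, OF _ m]) (use Hb in auto)
        have "AE \<omega> in M. ?H (S r \<omega>, \<omega>) = 0"
          using zero by (subst (asm) integral_nonneg_eq_0_iff_AE[OF int]) (auto simp: along_def at_cemetery_zero_eq)
        then show ?thesis using AE_S_pos[OF True] AE_S_neq[OF True, of t]
          by eventually_elim (use True in \<open>auto simp: max_absorb2\<close>)
      qed simp
    qed
  qed
  then show ?thesis
    by (rule eventually_mono) (auto simp: along_def at_cemetery_zero_eq indicator_def split: if_splits)
qed

text \<open>Below the passage time, almost surely 0 < S r < t, so t - S r lies in the open interval
  (0, T) where convergence is assumed, and the path avoids the exceptional null set. Dominated
  convergence with majorant C \<open>below\<close> applies.\<close>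

lemma generalised_solution_limit:
  assumes gs: "\<And>n. gs n \<in> C_infty ({0..T} \<times> \<Omega>)" and gb: "\<And>n z. \<bar>gs n z\<bar> \<le> C"
    and lim: "AE z in lborel. z \<in> {0<..<T} \<times> \<Omega> \<longrightarrow> (\<lambda>n. gs n z) \<longlonglongrightarrow> g z"
    and g: "g \<in> borel_measurable borel" and t: "t \<in> {0<..T}"
  shows "(\<lambda>n. \<integral>p. below t p * along (gs n) t (S (max 0 (fst p)) (snd p)) (snd p) \<partial>(lborel \<Otimes>\<^sub>M M))
      \<longlonglongrightarrow> (\<integral>p. below t p * along g t (S (max 0 (fst p)) (snd p)) (snd p) \<partial>(lborel \<Otimes>\<^sub>M M))"
    and "integrable (lborel \<Otimes>\<^sub>M M) (\<lambda>p. below t p * along g t (S (max 0 (fst p)) (snd p)) (snd p))"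
proof -
  let ?S = "\<lambda>p. S (max 0 (fst p)) (snd p)"
  obtain N where N: "N \<in> null_sets lborel" "{z. \<not> (z \<in> {0<..<T} \<times> \<Omega> \<longrightarrow> (\<lambda>n. gs n z) \<longlonglongrightarrow> g z)} \<subseteq> N"
    using lim unfolding eventually_ae_filter by auto
  have gsb: "gs n \<in> borel_measurable borel" for n
    by (rule C_infty_borel_measurable[OF gs]) (simp add: borel_prod[symmetric] del: borel_prod)
  have conv: "AE p in lborel \<Otimes>\<^sub>M M. below t p \<noteq> 0 \<longrightarrow>
      (\<lambda>n. along (gs n) t (?S p) (snd p)) \<longlonglongrightarrow> along g t (?S p) (snd p)"
    using AE_along_null[OF N(1), of t] AE_space
  proof eventually_elim
    case (elim p)
    show ?case
    proof
      assume b: "below t p \<noteq> 0"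
      then have p: "0 < fst p" "?S p \<le> t" by (auto simp: below_def indicator_def split: if_splits)
      then have s: "0 < ?S p" "?S p < t" using elim(1) by auto
      show "(\<lambda>n. along (gs n) t (?S p) (snd p)) \<longlonglongrightarrow> along g t (?S p) (snd p)"
      proof (cases "alive (?S p) (snd p)")
        case True
        have "loc (?S p) (snd p) \<in> \<Omega>" using elim(2) s by (intro loc_in) (auto simp: space_pair_measure)
        moreover have "(t - ?S p, loc (?S p) (snd p)) \<notin> N" using elim(1) p(1) True by blast
        moreover from calculation(1) have "(t - ?S p, loc (?S p) (snd p)) \<in> {0<..<T} \<times> \<Omega>" using s t by auto
        ultimately have "(\<lambda>n. gs n (t - ?S p, loc (?S p) (snd p))) \<longlonglongrightarrow> g (t - ?S p, loc (?S p) (snd p))"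
          using N(2) by blast
        then show ?thesis using True by (simp add: along_def at_cemetery_zero_eq)
      qed (simp add: along_def at_cemetery_zero_eq)
    qed
  qed
  \<comment> \<open>g is bounded only almost everywhere in time-space; along the path its bound is
    inherited from the approximations.\<close>
  have bd: "AE p in lborel \<Otimes>\<^sub>M M. below t p \<noteq> 0 \<longrightarrow> \<bar>along g t (?S p) (snd p)\<bar> \<le> C"
    using conv
  proof (rule eventually_mono, intro impI)
    fix p assume "below t p \<noteq> 0 \<longrightarrow> (\<lambda>n. along (gs n) t (?S p) (snd p)) \<longlonglongrightarrow> along g t (?S p) (snd p)" "below t p \<noteq> 0"
    then have "(\<lambda>n. \<bar>along (gs n) t (?S p) (snd p)\<bar>) \<longlonglongrightarrow> \<bar>along g t (?S p) (snd p)\<bar>" by (intro tendsto_rabs) simp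
    then show "\<bar>along g t (?S p) (snd p)\<bar> \<le> C" by (rule LIMSEQ_le_const2) (auto intro: along_bound[OF gb])
  qed
  show "integrable (lborel \<Otimes>\<^sub>M M) (\<lambda>p. below t p * along g t (?S p) (snd p))"
    by (rule integrable_below_mult[OF along_pair_measurable[OF g] bd])
  show "(\<lambda>n. \<integral>p. below t p * along (gs n) t (?S p) (snd p) \<partial>(lborel \<Otimes>\<^sub>M M))
      \<longlonglongrightarrow> (\<integral>p. below t p * along g t (?S p) (snd p) \<partial>(lborel \<Otimes>\<^sub>M M))"
  proof (rule integral_dominated_convergence[where w = "\<lambda>p. C * below t p"])
    note [measurable] = along_pair_measurable[OF g] along_pair_measurable[OF gsb]
    show "(\<lambda>p. below t p * along g t (?S p) (snd p)) \<in> borel_measurable (lborel \<Otimes>\<^sub>M M)" by measurable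
    show "(\<lambda>p. below t p * along (gs n) t (?S p) (snd p)) \<in> borel_measurable (lborel \<Otimes>\<^sub>M M)" for n by measurable
    show "integrable (lborel \<Otimes>\<^sub>M M) (\<lambda>p. C * below t p)" by (rule integrable_mult_right[OF integrable_below])
    show "AE p in lborel \<Otimes>\<^sub>M M. (\<lambda>n. below t p * along (gs n) t (?S p) (snd p)) \<longlonglongrightarrow> below t p * along g t (?S p) (snd p)"
      using conv
    proof (rule eventually_mono)
      fix p assume "below t p \<noteq> 0 \<longrightarrow> (\<lambda>n. along (gs n) t (?S p) (snd p)) \<longlonglongrightarrow> along g t (?S p) (snd p)"
      then show "(\<lambda>n. below t p * along (gs n) t (?S p) (snd p)) \<longlonglongrightarrow> below t p * along g t (?S p) (snd p)"
        by (cases "below t p = 0") (auto intro: tendsto_mult_left)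
    qed
    show "AE p in lborel \<Otimes>\<^sub>M M. norm (below t p * along (gs n) t (?S p) (snd p)) \<le> C * below t p" for n
      using mult_left_mono[OF along_bound[OF gb] below_nonneg] below_nonneg
      by (intro AE_I2) (simp add: abs_mult mult.commute)
  qed
qed

lemma life_time_less:
  assumes \<omega>: "\<omega> \<in> space M" and s: "life_time \<Omega> B \<omega> < ereal s"
  shows "\<not> alive s \<omega>"
proof -
  obtain s' where s': "0 < s'" "B s' \<omega> \<notin> Some ` \<Omega>" "s' < s"
    using s unfolding life_time_def by (auto simp: Inf_less_iff)
  then have "\<not> alive s' \<omega>"
    using loc_in[OF \<omega>, of s'] by (auto simp: alive_def loc_def split: option.splits)
  then show ?thesis using alive_antimono[OF \<omega>, of s' s] s' by auto
qed

text \<open>A life time of at most s would mean death at every r > s; by right continuity the weight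
  k would vanish at time s as well, contradicting survival.\<close>

lemma alive_less_life_time:
  assumes \<omega>: "\<omega> \<in> space M" and s: "0 \<le> s" and a: "alive s \<omega>"
  shows "ereal s < life_time \<Omega> B \<omega>"
proof (rule ccontr)
  assume "\<not> ereal s < life_time \<Omega> B \<omega>"
  then have le: "life_time \<Omega> B \<omega> \<le> ereal s" by simp
  have "\<forall>\<^sub>F r in at_right s. at_cemetery_zero k (B r \<omega>) = 0"
    using eventually_at_right_less
  proof (rule eventually_mono)
    fix r assume "s < r"
    then have "life_time \<Omega> B \<omega> < ereal r" using le by (simp add: le_less_trans)
    then show "at_cemetery_zero k (B r \<omega>) = 0"
      using life_time_less[OF \<omega>] by (simp add: at_cemetery_zero_eq)
  qed
  then have "((\<lambda>r. at_cemetery_zero k (B r \<omega>)) \<longlongrightarrow> 0) (at_right s)" by (rule tendsto_eventually)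
  with right_continuous[OF k(1) \<omega> s] have "at_cemetery_zero k (B s \<omega>) = 0"
    by (intro tendsto_unique[OF trivial_limit_at_right_real])
  then show False using alive_iff[OF \<omega> s] a by simp
qed

text \<open>If B is dead at S (\<open>hit t\<close>) both sides are 0. If it is alive there and the
  passage time is finite, the strict inequality between the two passage times holds automatically,
  so the indicator only records finiteness.\<close>

lemma first_term:
  assumes \<omega>: "\<omega> \<in> space M"
  shows "at_cemetery_zero \<phi> (B (S (hit t \<omega>) \<omega>) \<omega>) *
      indicator {\<omega>. passage_time S (ereal t) \<omega> < passage_time S (life_time \<Omega> B \<omega>) \<omega>} \<omega>
    = at_cemetery_zero \<phi> (B (S (hit t \<omega>) \<omega>) \<omega>) * indicator {\<omega>. passage_time S (ereal t) \<omega> < \<infinity>} \<omega>"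
proof (cases "passage_time S (ereal t) \<omega> < \<infinity> \<and> alive (S (hit t \<omega>) \<omega>) \<omega>")
  case True
  let ?l = "life_time \<Omega> B \<omega>"
  have l: "ereal (S (hit t \<omega>) \<omega>) < ?l"
    using True by (intro alive_less_life_time[OF \<omega>] S_nonneg[OF \<omega>] hit_nonneg) auto
  \<comment> \<open>A level strictly between S (\<open>hit t\<close>) and the life time: by right
    continuity S stays below c slightly beyond \<open>hit t\<close>, so the passage over the life
    time comes strictly later.\<close>
  obtain c where c: "ereal (S (hit t \<omega>) \<omega>) < ereal c" "ereal c < ?l"
    using ereal_dense2[OF l] by auto
  have "\<forall>\<^sub>F r in at_right (hit t \<omega>). S r \<omega> < c"
    using order_tendstoD(2)[OF S_right_continuous[OF \<omega> hit_nonneg]] c(1) by simp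
  then have "\<forall>\<^sub>F r in at_right (hit t \<omega>). S r \<omega> < c \<and> hit t \<omega> < r"
    using eventually_at_right_less by eventually_elim simp
  then obtain r where r: "S r \<omega> < c" "hit t \<omega> < r"
    using eventually_happens'[OF trivial_limit_at_right_real] by blast
  have "ereal r \<le> passage_time S ?l \<omega>"
  proof (rule ccontr)
    assume "\<not> ereal r \<le> passage_time S ?l \<omega>"
    then have "?l < ereal (S r \<omega>)" by (intro S_after_passage[OF \<omega>]) simp
    then have "?l < ereal c" using r(1) by (meson ereal_less_eq(3) less_le_trans less_imp_le)
    then show False using c(2) by simp
  qed
  moreover have "passage_time S (ereal t) \<omega> < ereal r" 
    using r(2) ereal_hit[OF conjunct1[OF True]] by (metis ereal_less_eq(3) not_le)
  ultimately show ?thesis using True by (simp add: less_le_trans)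
next
  case False
  then show ?thesis
  proof (cases "passage_time S (ereal t) \<omega> < \<infinity>")
    case True
    with False have "\<not> alive (S (hit t \<omega>) \<omega>) \<omega>" by simp
    then show ?thesis by (simp add: at_cemetery_zero_eq)
  qed simp
qed

text \<open>Before the passage over t the factor \<open>below\<close> is 1, after it 0; after the
  passage over the life time B is dead and the integrand vanishes by itself. The two endpoints are
  single times and hence null.\<close>

lemma second_term:
  assumes \<omega>: "\<omega> \<in> space M" and t: "0 \<le> t" and g: "g \<in> borel_measurable borel"
  shows "(LBINT r=0..min (passage_time S (ereal t) \<omega>) (passage_time S (life_time \<Omega> B \<omega>) \<omega>). along g t (S r \<omega>) \<omega>)
    = (\<integral>r. below t (r, \<omega>) * along g t (S (max 0 r) \<omega>) \<omega> \<partial>lborel)"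
proof -
  let ?a = "passage_time S (ereal t) \<omega>" and ?b = "passage_time S (life_time \<Omega> B \<omega>) \<omega>"
  have l0: "0 \<le> life_time \<Omega> B \<omega>" unfolding life_time_def by (rule Inf_greatest) auto
  have ae: "AE r in lborel. ereal r \<noteq> c" for c
    using AE_lborel_singleton[of "real_of_ereal c"] by (rule eventually_mono) auto
  have Am [measurable]: "(\<lambda>r. along g t (S (max 0 r) \<omega>) \<omega>) \<in> borel_measurable lborel"
    using measurable_compose[OF measurable_Pair2'[OF \<omega>, of lborel] along_pair_measurable[OF g, of t]] by simp
  have Bm [measurable]: "(\<lambda>r. below t (r, \<omega>)) \<in> borel_measurable lborel"
    using measurable_compose[OF measurable_Pair2'[OF \<omega>, of lborel] below_measurable[of t]] by simp
  have "(LBINT r=0..min ?a ?b. along g t (S r \<omega>) \<omega>)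
      = (\<integral>r. indicator (einterval 0 (min ?a ?b)) r *\<^sub>R along g t (S r \<omega>) \<omega> \<partial>lborel)"
    using passage_time_nonneg by (simp add: interval_lebesgue_integral_def set_lebesgue_integral_def)
  also have "\<dots> = (\<integral>r. indicator (einterval 0 (min ?a ?b)) r * along g t (S (max 0 r) \<omega>) \<omega> \<partial>lborel)"
    by (rule Bochner_Integration.integral_cong[OF refl]) (auto simp: indicator_def einterval_iff max_absorb2)
  also have "\<dots> = (\<integral>r. below t (r, \<omega>) * along g t (S (max 0 r) \<omega>) \<omega> \<partial>lborel)"
  proof (rule integral_cong_AE)
    show "AE r in lborel. indicator (einterval 0 (min ?a ?b)) r * along g t (S (max 0 r) \<omega>) \<omega>
        = below t (r, \<omega>) * along g t (S (max 0 r) \<omega>) \<omega>"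
      using ae[of ?a] ae[of ?b]
    proof eventually_elim
      case (elim r)
      show ?case
      proof (cases "0 < r")
        case r: True
        show ?thesis
        proof (cases "ereal r < ?a")
          case True
          then have "S r \<omega> \<le> t" using S_before_passage[OF \<omega>, of "ereal t" r] t r by simp
          then have b: "below t (r, \<omega>) = 1" using r by (simp add: below_def max_absorb2)
          show ?thesis
          proof (cases "ereal r < ?b")
            case True
            then show ?thesis using \<open>ereal r < ?a\<close> r b by (simp add: einterval_iff)
          next
            case False
            then have "?b < ereal r" using elim by auto
            from life_time_less[OF \<omega> S_after_passage[OF \<omega> this]]
            show ?thesis using r by (simp add: along_def at_cemetery_zero_eq max_absorb2)
          qed
        next
          case False
          then have "?a < ereal r" using elim by auto
          from S_after_passage[OF \<omega> this] have "t < S r \<omega>" by simp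
          then show ?thesis using False r by (simp add: below_def max_absorb2 einterval_iff)
        qed
      qed (simp add: below_def einterval_iff)
    qed
  qed measurable
  finally show ?thesis .
qed

lemma representation:
  assumes \<phi>: "\<phi> \<in> C_infty \<Omega>" and g: "g \<in> borel_measurable borel" and t: "0 \<le> t"
    and int: "integrable (lborel \<Otimes>\<^sub>M M) (\<lambda>p. below t p * along g t (S (max 0 (fst p)) (snd p)) (snd p))"
  shows "stochastic_representation M \<Omega> B S g \<phi> t = (\<integral>\<omega>. P (S (hit t \<omega>) \<omega>) \<phi> x \<partial>M)
    + (\<integral>p. below t p * along g t (S (max 0 (fst p)) (snd p)) (snd p) \<partial>(lborel \<Otimes>\<^sub>M M))"
proof -
  have "(\<integral>\<omega>. at_cemetery_zero \<phi> (B (S (hit t \<omega>) \<omega>) \<omega>) *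
        indicator {\<omega>. passage_time S (ereal t) \<omega> < passage_time S (life_time \<Omega> B \<omega>) \<omega>} \<omega> \<partial>M)
      = (\<integral>\<omega>. at_cemetery_zero \<phi> (B (S (hit t \<omega>) \<omega>) \<omega>) * indicator {\<omega>. passage_time S (ereal t) \<omega> < \<infinity>} \<omega> \<partial>M)"
    by (rule Bochner_Integration.integral_cong[OF refl]) (rule first_term)
  also have "\<dots> = (\<integral>\<omega>. at_cemetery_zero \<phi> (B (S (hit t \<omega>) \<omega>) \<omega>) \<partial>M)"
  proof (rule integral_cong_AE)
    have nn: "0 \<le> S (hit t \<omega>) \<omega>" if "\<omega> \<in> space M" for \<omega> using that by (simp add: S_nonneg hit_nonneg)
    have "(\<lambda>\<omega>. at_cemetery_zero \<phi> (B (max 0 (S (hit t \<omega>) \<omega>)) \<omega>)) \<in> borel_measurable M"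
      by (rule B_joint[OF B_measurable refl S_hit_measurable[OF S_measurable refl] measurable_ident \<phi>, unfolded id_def]) simp_all
    then show m [measurable]: "(\<lambda>\<omega>. at_cemetery_zero \<phi> (B (S (hit t \<omega>) \<omega>) \<omega>)) \<in> borel_measurable M"
      by (rule measurable_cong[THEN iffD1, rotated]) (simp add: max_absorb2[OF nn])
    have [measurable]: "passage_time S (ereal t) \<in> borel_measurable M"
      by (rule passage_time_measurable[OF S_measurable refl])
    show "(\<lambda>\<omega>. at_cemetery_zero \<phi> (B (S (hit t \<omega>) \<omega>) \<omega>) * indicator {\<omega>. passage_time S (ereal t) \<omega> < \<infinity>} \<omega>) \<in> borel_measurable M"
      by measurable
    show "AE \<omega> in M. at_cemetery_zero \<phi> (B (S (hit t \<omega>) \<omega>) \<omega>) * indicator {\<omega>. passage_time S (ereal t) \<omega> < \<infinity>} \<omega>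
        = at_cemetery_zero \<phi> (B (S (hit t \<omega>) \<omega>) \<omega>)"
      using AE_passage_time_finite[of t] by (rule eventually_mono) simp
  qed
  also have "\<dots> = (\<integral>\<omega>. P (S (hit t \<omega>) \<omega>) \<phi> x \<partial>M)" by (rule expectation_at_passage[OF \<phi>])
  finally have 1: "(\<integral>\<omega>. at_cemetery_zero \<phi> (B (S (hit t \<omega>) \<omega>) \<omega>) *
        indicator {\<omega>. passage_time S (ereal t) \<omega> < passage_time S (life_time \<Omega> B \<omega>) \<omega>} \<omega> \<partial>M)
      = (\<integral>\<omega>. P (S (hit t \<omega>) \<omega>) \<phi> x \<partial>M)" .
  have "(\<integral>\<omega>. (LBINT r=0..min (passage_time S (ereal t) \<omega>) (passage_time S (life_time \<Omega> B \<omega>) \<omega>). along g t (S r \<omega>) \<omega>) \<partial>M)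
      = (\<integral>\<omega>. (\<integral>r. below t (r, \<omega>) * along g t (S (max 0 r) \<omega>) \<omega> \<partial>lborel) \<partial>M)"
    by (rule Bochner_Integration.integral_cong[OF refl]) (rule second_term[OF _ t g])
  also have "\<dots> = (\<integral>p. below t p * along g t (S (max 0 (fst p)) (snd p)) (snd p) \<partial>(lborel \<Otimes>\<^sub>M M))"
    using LM.integral_snd[of "\<lambda>r \<omega>. below t (r, \<omega>) * along g t (S (max 0 r) \<omega>) \<omega>"] int
    by (simp add: case_prod_beta')
  finally show ?thesis
    unfolding stochastic_representation_def hit_def[symmetric] along_def[symmetric] 1 by simp
qed

end

section \<open>Generalised solutions\<close>

text \<open>Continuous approximants of g are truncated at C, cut off in space to vanish at infinity,
  and blended into \<psi> near t = 0 to obtain the required trace. All three changes disappear in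
  the limit on (0,T) \<times> \<Omega>.\<close>

lemma bounded_pointwise_approximation:
  fixes \<Omega> :: "'a::euclidean_space set" and g :: "real \<times> 'a \<Rightarrow> real"
  assumes \<Omega>: "\<Omega> \<in> sets borel" and k: "k \<in> C_infty \<Omega>" "\<And>y. y \<in> \<Omega> \<Longrightarrow> 0 < k y"
    and g: "L_infty ({0<..<T} \<times> \<Omega>) g" and \<psi>: "\<psi> \<in> C_infty \<Omega>" and T: "0 < T"
  shows "\<exists>gs. (\<forall>n::nat. gs n \<in> C_infty ({0..T} \<times> \<Omega>)) \<and> (\<forall>n. \<forall>x\<in>\<Omega>. gs n (0, x) = \<psi> x) \<and>
    (AE z in lborel. z \<in> {0<..<T} \<times> \<Omega> \<longrightarrow> (\<lambda>n. gs n z) \<longlonglongrightarrow> g z) \<and>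
    (\<exists>C. \<forall>n z. \<bar>gs n z\<bar> \<le> C)"
proof -
  let ?A = "{0<..<T} \<times> \<Omega>" and ?E = "{0..T} \<times> \<Omega>"
  have gm [measurable]: "g \<in> borel_measurable borel" using g by (simp add: L_infty_def)
  obtain C0 where C0: "AE z in lborel. z \<in> ?A \<longrightarrow> \<bar>g z\<bar> \<le> C0" using g by (auto simp: L_infty_def)
  obtain D where D: "D > 0" "\<And>y. \<bar>\<psi> y\<bar> \<le> D" using C_infty_bounded[OF \<psi>] by blast
  \<comment> \<open>C bounds both g (almost everywhere) and \<psi>, so the blend with weights \<eta>
    and 1 - \<eta> stays within C.\<close>
  define C where "C = max C0 D"
  have C: "0 < C" "C0 \<le> C" "\<And>y. \<bar>\<psi> y\<bar> \<le> C"
    using D(1) order_trans[OF D(2)] by (auto simp: C_def)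
  \<comment> \<open>A Lebesgue measurable function is a limit of continuous functions off a
    negligible set.\<close>
  have "g \<in> borel_measurable lebesgue" using gm by (intro measurable_completion) simp
  then have "g measurable_on UNIV" by (intro lebesgue_measurable_imp_measurable_on_real) auto
  then obtain N c where N: "negligible N" and cc: "\<And>n. continuous_on UNIV (c n)"
    and cl: "\<And>z. z \<notin> N \<Longrightarrow> (\<lambda>n. c n z) \<longlonglongrightarrow> g z"
    by (auto simp: measurable_on_def)
  have knn: "0 \<le> k y" for y using k(2)[of y] C_infty_off[OF k(1), of y] by (cases "y \<in> \<Omega>") auto
  let ?ct = "\<lambda>v. \<lambda>(t, x). if t \<in> {0..T} then v x else (0::real)"
  \<comment> \<open>A spatial cut-off in \<open>C_infty\<close> that tends to 1 on \<Omega> because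
    k is positive there.\<close>
  define \<kappa> where "\<kappa> n y = min 1 (real n * k y)" for n y
  have \<kappa>C: "\<kappa> n \<in> C_infty \<Omega>" for n unfolding \<kappa>_def by (rule C_infty_min_one[OF k(1) knn])
  have \<kappa>01: "0 \<le> \<kappa> n y" "\<kappa> n y \<le> 1" for n y using knn[of y] by (auto simp: \<kappa>_def)
  \<comment> \<open>A continuous time cut-off that is 0 at t = 0 and eventually 1 for each t >
    0.\<close>
  define \<eta> where "\<eta> n t = max 0 (min 1 (real n * t))" for n and t :: real
  have \<eta>01: "0 \<le> \<eta> n t" "\<eta> n t \<le> 1" for n t by (auto simp: \<eta>_def)
  define a where "a n z = \<eta> n (fst z) * max (- C) (min C (c n z))" for n z
  have a: "\<bar>a n z\<bar> \<le> \<eta> n (fst z) * C" for n z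
  proof -
    have "\<bar>max (- C) (min C (c n z))\<bar> \<le> C" using C(1) by auto
    then show ?thesis using \<eta>01[of n "fst z"] by (simp add: a_def abs_mult mult_left_mono)
  qed
  have aC: "\<bar>a n z\<bar> \<le> C" for n z
    using order_trans[OF a[of n z]] mult_right_mono[OF \<eta>01(2)[of n "fst z"], of C] C(1) by simp
  have ac: "continuous_on ?E (a n)" for n
    unfolding a_def \<eta>_def
    by (intro continuous_intros continuous_on_max continuous_on_min continuous_on_subset[OF cc]) auto
  define gs where "gs n z = 1 * (a n z * ?ct (\<kappa> n) z) + 1 * ((1 - \<eta> n (fst z)) * ?ct \<psi> z)" for n z
  have gsC: "gs n \<in> C_infty ?E" for n
    unfolding gs_def
  proof (rule C_infty_lincomb)
    show "(\<lambda>z. a n z * ?ct (\<kappa> n) z) \<in> C_infty ?E"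
      by (rule C_infty_mult_bounded[OF C_infty_constant_in_time[OF \<kappa>C] ac aC])
    show "(\<lambda>z. (1 - \<eta> n (fst z)) * ?ct \<psi> z) \<in> C_infty ?E"
    proof (rule C_infty_mult_bounded[OF C_infty_constant_in_time[OF \<psi>]])
      show "continuous_on ?E (\<lambda>z. 1 - \<eta> n (fst z))"
        unfolding \<eta>_def by (intro continuous_intros continuous_on_max continuous_on_min)
      show "\<bar>1 - \<eta> n (fst z)\<bar> \<le> 1" for z using \<eta>01[of n "fst z"] by auto
    qed
  qed
  have gs0: "gs n (0, x) = \<psi> x" for n x using T by (simp add: gs_def a_def \<eta>_def)
  have gsb: "\<bar>gs n z\<bar> \<le> C" for n z
  proof -
    obtain t x where z: "z = (t, x)" by (cases z)
    have "\<bar>a n z * ?ct (\<kappa> n) z\<bar> \<le> \<eta> n t * C * 1"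
      unfolding abs_mult using a[of n z] \<kappa>01[of n x] \<eta>01[of n t] C(1)
      by (intro mult_mono) (auto simp: z)
    moreover have "\<bar>(1 - \<eta> n (fst z)) * ?ct \<psi> z\<bar> \<le> (1 - \<eta> n t) * C"
      unfolding abs_mult using C(1,3) \<eta>01[of n t] by (intro mult_mono) (auto simp: z)
    ultimately have "\<bar>gs n z\<bar> \<le> \<eta> n t * C + (1 - \<eta> n t) * C" unfolding gs_def by linarith
    then show ?thesis by (simp add: algebra_simps)
  qed
  \<comment> \<open>N is null only for the completed measure; it is enlarged to a Borel null
    set.\<close>
  have "N \<in> null_sets lebesgue" using N by (simp add: negligible_iff_null_sets)
  then obtain N' where N': "N' \<in> null_sets lborel" "N \<subseteq> N'" by (auto simp: null_sets_completion_iff2)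
  have "AE z in lborel. z \<in> ?A \<longrightarrow> (\<lambda>n. gs n z) \<longlonglongrightarrow> g z"
    using C0 AE_not_in[OF N'(1)]
  proof eventually_elim
    case (elim z)
    show ?case
    proof
      assume zA: "z \<in> ?A"
      obtain t x where z: "z = (t, x)" by (cases z)
      have tx: "0 < t" "t < T" "x \<in> \<Omega>" using zA z by auto
      have gC: "\<bar>g z\<bar> \<le> C" using elim(1) zA C(2) by linarith
      have "(\<lambda>n. c n z) \<longlonglongrightarrow> g z" using elim(2) N'(2) by (intro cl) blast
      then have "(\<lambda>n. max (- C) (min C (c n z))) \<longlonglongrightarrow> max (- C) (min C (g z))"
        by (intro tendsto_max tendsto_min tendsto_const)
      moreover have "max (- C) (min C (g z)) = g z" using gC by auto
      ultimately have 1: "(\<lambda>n. max (- C) (min C (c n z))) \<longlonglongrightarrow> g z" by simp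
      have 2: "(\<lambda>n. \<eta> n t) \<longlonglongrightarrow> 1"
        using tendsto_max[OF tendsto_const[of 0] min_one_indicator_limit[of t]] tx by (simp add: \<eta>_def)
      have 3: "(\<lambda>n. \<kappa> n x) \<longlonglongrightarrow> 1"
        using min_one_indicator_limit[of "k x"] k(2)[OF tx(3)] by (simp add: \<kappa>_def)
      have "(\<lambda>n. 1 * (\<eta> n t * max (- C) (min C (c n z)) * \<kappa> n x) + 1 * ((1 - \<eta> n t) * \<psi> x))
          \<longlonglongrightarrow> 1 * (1 * g z * 1) + 1 * ((1 - 1) * \<psi> x)"
        by (intro tendsto_add tendsto_mult tendsto_diff tendsto_const 1 2 3)
      moreover have "gs n z = 1 * (\<eta> n t * max (- C) (min C (c n z)) * \<kappa> n x) + 1 * ((1 - \<eta> n t) * \<psi> x)" for n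
        using tx by (simp add: gs_def a_def z)
      ultimately show "(\<lambda>n. gs n z) \<longlonglongrightarrow> g z" by simp
    qed
  qed
  then show ?thesis using gsC gs0 gsb by blast
qed

theorem theorem3p6:
  fixes T :: real
    and \<Omega> :: "'a::euclidean_space set"
    and P :: "real \<Rightarrow> ('a \<Rightarrow> real) \<Rightarrow> 'a \<Rightarrow> real"
    and \<nu> :: "real \<Rightarrow> real"
    and M :: "'w measure"
    and B :: "'a \<Rightarrow> real \<Rightarrow> 'w \<Rightarrow> 'a option"
    and S :: "real \<Rightarrow> 'w \<Rightarrow> real"
    and g :: "real \<times> 'a \<Rightarrow> real"
    and \<phi>\<^sub>0 :: "'a \<Rightarrow> real"
  defines "p \<equiv> subordinator_density M S"
  assumes "0 < T"
    and "admissible_domain \<Omega>"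
    and "feller_semigroup \<Omega> P"
    and "H0 \<nu>"
    and "H1 \<Omega> P"
    and "prob_space M"
    and "\<And>x. x \<in> \<Omega> \<Longrightarrow> feller_process M \<Omega> P x (B x)"
    and "levy_subordinator M \<nu> S"
    and "\<And>x. x \<in> \<Omega> \<Longrightarrow>
           independent_processes M (borel_sigma_of (compactified \<Omega>)) (B x) borel S"
    and "L_infty ({0<..<T} \<times> \<Omega>) g"
    and "\<phi>\<^sub>0 \<in> generator_dom \<Omega> (space_semigroup P p)"
  shows "(\<exists>!u. generalised_solution T \<Omega> P p g \<phi>\<^sub>0 u) \<and>
         (\<forall>u. generalised_solution T \<Omega> P p g \<phi>\<^sub>0 u \<longrightarrow>
            (\<forall>t\<in>{0<..T}. \<forall>x\<in>\<Omega>. u (t, x) = stochastic_representation M \<Omega> (B x) S g \<phi>\<^sub>0 t))"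
proof -
  let ?E = "{0..T} \<times> \<Omega>"
  note T = \<open>0 < T\<close>
  have PS: "contraction_semigroup \<Omega> P" by (rule feller_semigroup_contraction_semigroup) fact
  have \<Omega>: "\<Omega> \<in> sets borel" by (rule admissible_domain_borel) fact
  obtain k where k: "k \<in> C_infty \<Omega>" and k0: "\<forall>y\<in>\<Omega>. 0 < k y"
    using admissible_domain_weight[OF \<open>admissible_domain \<Omega>\<close>] by (rule bexE)
  note k = k bspec[OF k0]
  interpret subordinator M \<nu> S
    using assms by (simp add: subordinator_def subordinator_axioms_def)
  have path: "subordinated_path M \<nu> S \<Omega> P x (B x) k" if x: "x \<in> \<Omega>" for x
    using assms PS \<Omega> x k subordinator_axioms prob_space_axioms
    by (simp add: subordinated_path_def subordinated_path_axioms_def feller_path_def feller_path_axioms_def)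
  define \<psi> where "\<psi> = generator \<Omega> (space_semigroup P p) \<phi>\<^sub>0"
  have "generator_rel \<Omega> (space_semigroup P p) \<phi>\<^sub>0 \<psi>"
    unfolding \<psi>_def by (rule generator_rel_generator) fact
  then have \<phi>C: "\<phi>\<^sub>0 \<in> C_infty \<Omega>" and \<psi>C: "\<psi> \<in> C_infty \<Omega>" by (auto simp: generator_rel_def)
  have gm: "g \<in> borel_measurable borel" using \<open>L_infty _ g\<close> by (simp add: L_infty_def)
  \<comment> \<open>Pointwise convergence is required at every point of the type, so the candidate
    also prescribes the initial value and the value 0 outside [0,T] \<times> \<Omega>.\<close>
  define U where "U z = (if z \<in> {0<..T} \<times> \<Omega> then stochastic_representation M \<Omega> (B (snd z)) S g \<phi>\<^sub>0 (fst z)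
      else if z \<in> {0} \<times> \<Omega> then \<phi>\<^sub>0 (snd z) else 0)" for z
  \<comment> \<open>Common core of both halves: every admissible approximation converges to the same
    U. This is uniqueness and, once one admissible approximation is built, existence.\<close>
  have lim: "(\<lambda>n. us n z) \<longlonglongrightarrow> U z"
    if gsC: "\<And>n. gs n \<in> C_infty ?E" and ae: "AE z in lborel. z \<in> {0<..<T} \<times> \<Omega> \<longrightarrow> (\<lambda>n. gs n z) \<longlonglongrightarrow> g z"
      and gb: "\<And>n. sup_norm ?E (gs n) \<le> C" and sol: "\<And>n. domain_solution T \<Omega> P p (gs n) \<phi>\<^sub>0 (us n)"
    for gs :: "nat \<Rightarrow> real \<times> 'a \<Rightarrow> real" and us C z
  proof -
    have usC: "us n \<in> C_infty ?E" for n
      using sol[of n] by (auto simp: domain_solution_def generator_dom_def generator_rel_def)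
    obtain t x where z: "z = (t, x)" by (cases z)
    consider "z \<in> {0<..T} \<times> \<Omega>" | "z \<in> {0} \<times> \<Omega>" | "z \<notin> ?E" using z by force
    then show ?thesis
    proof cases
      case 1
      then have t: "t \<in> {0<..T}" "t \<in> {0..T}" "0 \<le> t" and x: "x \<in> \<Omega>" using z by auto
      interpret X: subordinated_path M \<nu> S \<Omega> P x "B x" k by (rule path[OF x])
      have ne: "?E \<noteq> {}" using t x by auto
      \<comment> \<open>The absolute value of C makes the bound valid outside [0,T] \<times>
        \<Omega> too, where the forcing terms are 0.\<close>
      have b: "\<bar>gs n z\<bar> \<le> \<bar>C\<bar>" for n z
      proof (cases "z \<in> ?E")
        case True
        then have "\<bar>gs n z\<bar> \<le> C" using gb[of n] sup_norm_le_iff[OF gsC ne] by blast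
        then show ?thesis by linarith
      qed (simp add: C_infty_off[OF gsC])
      note L = X.generalised_solution_limit[OF gsC b ae gm t(1)]
      have rep: "us n (t, x) = (\<integral>\<omega>. P (S (hit t \<omega>) \<omega>) \<phi>\<^sub>0 x \<partial>M)
          + (\<integral>p. below t p * X.along (gs n) t (S (max 0 (fst p)) (snd p)) (snd p) \<partial>(lborel \<Otimes>\<^sub>M M))" for n
        using domain_solution_representation[OF PS T gsC \<phi>C sol[unfolded p_def] t(2) x]
        unfolding X.potential_along[OF gsC t(2)] .
      have "stochastic_representation M \<Omega> (B x) S g \<phi>\<^sub>0 t = (\<integral>\<omega>. P (S (hit t \<omega>) \<omega>) \<phi>\<^sub>0 x \<partial>M)
          + (\<integral>p. below t p * X.along g t (S (max 0 (fst p)) (snd p)) (snd p) \<partial>(lborel \<Otimes>\<^sub>M M))"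
        by (rule X.representation[OF \<phi>C gm t(3) L(2)])
      moreover have "U z = stochastic_representation M \<Omega> (B x) S g \<phi>\<^sub>0 t" using 1 by (simp add: U_def z)
      ultimately show ?thesis
        using tendsto_add[OF tendsto_const L(1)] unfolding z rep by simp
    next
      case 2
      then have "us n z = \<phi>\<^sub>0 x" for n using sol[of n] z by (auto simp: domain_solution_def)
      moreover have "U z = \<phi>\<^sub>0 x" using 2 z by (simp add: U_def)
      ultimately show ?thesis by simp
    next
      case 3
      then have "us n z = 0" for n by (rule C_infty_off[OF usC])
      moreover have "U z = 0" using 3 T z by (auto simp: U_def)
      ultimately show ?thesis by simp
    qed
  qed
  have unique: "u = U" if u: "generalised_solution T \<Omega> P p g \<phi>\<^sub>0 u" for u
  proof -
    obtain gs us where G: "(\<forall>n::nat. gs n \<in> C_infty ?E) \<and>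
        (\<forall>n. \<forall>x\<in>\<Omega>. gs n (0, x) = - generator \<Omega> (space_semigroup P p) \<phi>\<^sub>0 x) \<and>
        (AE z in lborel. z \<in> {0<..<T} \<times> \<Omega> \<longrightarrow> (\<lambda>n. gs n z) \<longlonglongrightarrow> g z) \<and>
        (\<exists>C. \<forall>n. sup_norm ?E (gs n) \<le> C) \<and>
        (\<forall>n. domain_solution T \<Omega> P p (gs n) \<phi>\<^sub>0 (us n)) \<and> (\<forall>z. (\<lambda>n. us n z) \<longlonglongrightarrow> u z)"
      using u unfolding generalised_solution_def by (elim exE) (rule that)
    from G have 1: "gs n \<in> C_infty ?E" for n by (elim conjE) (rule spec)
    from G have 2: "AE z in lborel. z \<in> {0<..<T} \<times> \<Omega> \<longrightarrow> (\<lambda>n. gs n z) \<longlonglongrightarrow> g z" by (elim conjE)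
    from G have "\<exists>C. \<forall>n. sup_norm ?E (gs n) \<le> C" by (elim conjE)
    then obtain C where "\<forall>n. sup_norm ?E (gs n) \<le> C" by (rule exE)
    then have 3: "sup_norm ?E (gs n) \<le> C" for n by (rule spec)
    from G have 4: "domain_solution T \<Omega> P p (gs n) \<phi>\<^sub>0 (us n)" for n by (elim conjE) (rule spec)
    from G have us: "(\<lambda>n. us n z) \<longlonglongrightarrow> u z" for z by (elim conjE) (rule spec)
    show ?thesis by (rule ext, rule LIMSEQ_unique[OF us lim[OF 1 2 3 4]])
  qed
  have exist: "generalised_solution T \<Omega> P p g \<phi>\<^sub>0 U"
  proof -
    have neg: "(\<lambda>x. - \<psi> x) \<in> C_infty \<Omega>" using C_infty_lincomb[OF \<psi>C \<psi>C, of "-1" 0] by simp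
    from bounded_pointwise_approximation[OF \<Omega> k \<open>L_infty _ g\<close> neg T]
    obtain gs where G: "(\<forall>n::nat. gs n \<in> C_infty ?E) \<and> (\<forall>n. \<forall>x\<in>\<Omega>. gs n (0, x) = - \<psi> x) \<and>
        (AE z in lborel. z \<in> {0<..<T} \<times> \<Omega> \<longrightarrow> (\<lambda>n. gs n z) \<longlonglongrightarrow> g z) \<and> (\<exists>C. \<forall>n z. \<bar>gs n z\<bar> \<le> C)"
      by (rule exE)
    from G have gs1: "gs n \<in> C_infty ?E" for n by (elim conjE) (rule spec)
    from G have "\<forall>n. \<forall>x\<in>\<Omega>. gs n (0, x) = - \<psi> x" by (elim conjE)
    then have gs2: "gs n (0, x) = - \<psi> x" if "x \<in> \<Omega>" for n x using that by simp
    from G have gs3: "AE z in lborel. z \<in> {0<..<T} \<times> \<Omega> \<longrightarrow> (\<lambda>n. gs n z) \<longlonglongrightarrow> g z" by (elim conjE)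
    from G have gs4: "\<exists>C. \<forall>n z. \<bar>gs n z\<bar> \<le> C" by (elim conjE)
    \<comment> \<open>For empty \<Omega> \<open>sup_norm\<close> is the unspecified
      \<open>Sup {}\<close>, the same for every n, which serves as its own bound.\<close>
    obtain C where C: "\<And>n. sup_norm ?E (gs n) \<le> C"
    proof (cases "?E = {}")
      case True
      then have "sup_norm ?E (gs n) \<le> Sup {}" for n unfolding sup_norm_def True by simp
      then show ?thesis by (rule that)
    next
      case False
      obtain C where "\<And>n z. \<bar>gs n z\<bar> \<le> C" using gs4 by blast
      then have "sup_norm ?E (gs n) \<le> C" for n using sup_norm_le_iff[OF gs1 False] by blast
      then show ?thesis by (rule that)
    qed
    have "\<exists>u. domain_solution T \<Omega> P p (gs n) \<phi>\<^sub>0 u" for n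
      unfolding p_def
      by (rule domain_solution_exists[OF PS T gs1]) (use assms gs2 in \<open>auto simp: \<psi>_def\<close>)
    then obtain us where us: "\<And>n. domain_solution T \<Omega> P p (gs n) \<phi>\<^sub>0 (us n)" by metis
    show ?thesis
      unfolding generalised_solution_def
    proof (intro exI conjI allI ballI)
      show "gs n (0, x) = - generator \<Omega> (space_semigroup P p) \<phi>\<^sub>0 x" if "x \<in> \<Omega>" for n x
        using gs2[OF that] by (simp add: \<psi>_def)
      show "(\<lambda>n. us n z) \<longlonglongrightarrow> U z" for z by (rule lim[OF gs1 gs3 C us])
    qed (fact gs1 gs3 C us)+
  qed
  have "U (t, x) = stochastic_representation M \<Omega> (B x) S g \<phi>\<^sub>0 t" if "t \<in> {0<..T}" "x \<in> \<Omega>" for t x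
    using that by (simp add: U_def)
  then show ?thesis using unique exist by blast
qed

end
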